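(* The noisy voter-exclusion process with rates $q_e,q_v,\beta,\delta$ on $\mathcal{S}$ is ergodic if and only if $$P^x\Big[\int_0^\infty \big(\beta(X(t))+\delta(X(t))\big)\,dt=\infty\Big]=1\quad\text{for all }x\in\mathcal{S}.$$
   Context: $\mathcal{S}$ is a countable set; $q_e(x,y)\ge 0$ and $q_v(x,y)\ge 0$ for $x,y\in\mathcal{S}$; $q(x,y)=q_e(x,y)+q_v(x,y)$ and $q_x=\sum_y q(x,y)$. Standing assumptions: (a) $\mathcal{S}$ is irreducible with respect to $q(x,y)$; (b) $q_e(x,y)=q_e(y,x)$; (c) $\sup_x q_x<\infty$; (d) $\inf_x q_x>0$; $\beta,\delta:\mathcal{S}\to[0,\infty)$ satisfy $\sup_x(\beta(x)+\delta(x))<\infty$; and $q_v(x,y)>0$ for some $x,y\in\mathcal{S}$. For $\eta\in\{0,1\}^{\mathcal{S}}$, $\eta_x$ is $\eta$ with the value at $x$ replaced by $1-\eta(x)$, and $\eta_{xy}$ is $\eta$ with the values at $x$ and $y$ interchanged. The noisy voter-exclusion (NVE) process is the Feller process $\eta_t$ on $\{0,1\}^{\mathcal{S}}$ whose generator is the closure of the operator, defined on functions $f$ depending on finitely many coordinates, $$\Omega f(\eta)=\sum_{\eta(x)=1,\eta(y)=0}q_e(x,y)[f(\eta_{xy})-f(\eta)]+\sum_x c(x,\eta)[f(\eta_x)-f(\eta)],$$ where $c(x,\eta)=\beta(x)+\sum_y q_v(x,y)\eta(y)$ if $\eta(x)=0$ and $c(x,\eta)=\delta(x)+\sum_y q_v(x,y)[1-\eta(y)]$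 if $\eta(x)=1$. Its semigroup is $S(t)$; $\mu S(t)$ is the law at time $t$ when the initial law is $\mu$. The process is ergodic if there is a unique invariant probability measure $\nu$ and $\mu S(t)\to\nu$ weakly as $t\to\infty$ for every probability measure $\mu$ on $\{0,1\}^{\mathcal{S}}$. $X(t)$ is the continuous time Markov chain on $\mathcal{S}$ with transition rates $q(x,y)$, and $P^x$ is its law started from $x$. *)

theory Defs
  imports "HOL-Probability.Probability"
begin

section \<open>Rates\<close>

text \<open>
  The countable site space is the type \<open>'a\<close>.  The diagonal of the rates is unrestricted.
  Summability is stated separately because \<open>infsum\<close> is \<open>0\<close> on families that are not summable.
\<close>

locale nve_rates =
  fixes qe qv :: "'a::countable \<Rightarrow> 'a \<Rightarrow> real"
    and \<beta> \<delta> :: "'a \<Rightarrow> real"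
  assumes qe_nonneg: "qe x y \<ge> 0"
    and qv_nonneg: "qv x y \<ge> 0"
    and irreducible: "(x, y) \<in> {(u, v). qe u v + qv u v > 0}\<^sup>*"
    and qe_sym: "qe x y = qe y x"
    and q_summable: "(\<lambda>y. qe x y + qv x y) summable_on UNIV"
    and q_bounded: "bdd_above (range (\<lambda>x. \<Sum>\<^sub>\<infinity>y. qe x y + qv x y))"
    and q_pos: "(INF x. \<Sum>\<^sub>\<infinity>y. qe x y + qv x y) > 0"
    and \<beta>_nonneg: "\<beta> x \<ge> 0"
    and \<delta>_nonneg: "\<delta> x \<ge> 0"
    and noise_bounded: "bdd_above (range (\<lambda>x. \<beta> x + \<delta> x))"
    and qv_nontrivial: "\<exists>x y. qv x y > 0"


section \<open>Feller processes on \<open>{0,1}\<^sup>S\<close>\<close>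

text \<open>
  Configurations are functions \<open>'a \<Rightarrow> bool\<close> with the product topology, which is compact and
  metrizable, so \<open>('a \<Rightarrow> bool) \<Rightarrow>\<^sub>C real\<close> with its sup norm is the space of all continuous
  functions.  A Feller process is given by its transition function:
  \<open>K t \<eta>\<close> is the law at time \<open>t \<ge> 0\<close> of the process started from \<open>\<eta>\<close>.
\<close>

type_synonym 'a config = "'a \<Rightarrow> bool"
type_synonym 'a transition = "real \<Rightarrow> 'a config \<Rightarrow> 'a config measure"

definition feller_semigroup :: "'a transition \<Rightarrow> real \<Rightarrow> ('a config \<Rightarrow>\<^sub>C real) \<Rightarrow> ('a config \<Rightarrow>\<^sub>C real)" where
  "feller_semigroup K t f = Bcontfun (\<lambda>\<eta>. \<integral>\<zeta>. f \<zeta> \<partial>K t \<eta>)"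

definition feller_process :: "'a transition \<Rightarrow> bool" where
  "feller_process K \<longleftrightarrow>
     (\<forall>t\<ge>0. K t \<in> borel \<rightarrow>\<^sub>M prob_algebra borel) \<and>
     (\<forall>\<eta>. K 0 \<eta> = return borel \<eta>) \<and>
     (\<forall>s\<ge>0. \<forall>t\<ge>0. \<forall>\<eta>. K (s + t) \<eta> = K s \<eta> \<bind> K t) \<and>
     (\<forall>t\<ge>0. \<forall>f :: 'a config \<Rightarrow>\<^sub>C real. continuous_on UNIV (\<lambda>\<eta>. \<integral>\<zeta>. f \<zeta> \<partial>K t \<eta>)) \<and>
     (\<forall>f. ((\<lambda>t. feller_semigroup K t f) \<longlongrightarrow> f) (at_right 0))"

text \<open>Unbounded operators are represented by their graphs.\<close>

definition generator :: "'a transition \<Rightarrow> (('a config \<Rightarrow>\<^sub>C real) \<times> ('a config \<Rightarrow>\<^sub>C real)) set" where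
  "generator K = {(f, g). ((\<lambda>t. (feller_semigroup K t f - f) /\<^sub>R t) \<longlongrightarrow> g) (at_right 0)}"

definition law_at :: "'a transition \<Rightarrow> 'a config measure \<Rightarrow> real \<Rightarrow> 'a config measure" where
  "law_at K \<mu> t = \<mu> \<bind> K t"

definition invariant_measure :: "'a transition \<Rightarrow> 'a config measure \<Rightarrow> bool" where
  "invariant_measure K \<nu> \<longleftrightarrow>
     \<nu> \<in> space (prob_algebra borel) \<and> (\<forall>t\<ge>0. law_at K \<nu> t = \<nu>)"

definition converges_weakly :: "(real \<Rightarrow> 'a config measure) \<Rightarrow> 'a config measure \<Rightarrow> bool" where
  "converges_weakly M \<nu> \<longleftrightarrow>
     (\<forall>f :: 'a config \<Rightarrow>\<^sub>C real. ((\<lambda>t. \<integral>\<eta>. f \<eta> \<partial>M t) \<longlongrightarrow> (\<integral>\<eta>. f \<eta> \<partial>\<nu>)) at_top)"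

definition ergodic :: "'a transition \<Rightarrow> bool" where
  "ergodic K \<longleftrightarrow>
     (\<exists>\<nu>. invariant_measure K \<nu> \<and> (\<forall>\<nu>'. invariant_measure K \<nu>' \<longrightarrow> \<nu>' = \<nu>) \<and>
          (\<forall>\<mu> \<in> space (prob_algebra borel). converges_weakly (law_at K \<mu>) \<nu>))"


section \<open>The noisy voter-exclusion process\<close>

definition flip :: "'a \<Rightarrow> 'a config \<Rightarrow> 'a config" where
  "flip x \<eta> = \<eta>(x := \<not> \<eta> x)"

definition exchange :: "'a \<Rightarrow> 'a \<Rightarrow> 'a config \<Rightarrow> 'a config" where
  "exchange x y \<eta> = \<eta>(x := \<eta> y, y := \<eta> x)"

definition flip_rate ::
  "('a \<Rightarrow> 'a \<Rightarrow> real) \<Rightarrow> ('a \<Rightarrow> real) \<Rightarrow> ('a \<Rightarrow> real) \<Rightarrow> 'a \<Rightarrow> 'a config \<Rightarrow> real" where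
  "flip_rate qv \<beta> \<delta> x \<eta> =
     (if \<eta> x then \<delta> x + (\<Sum>\<^sub>\<infinity>y. qv x y * (1 - of_bool (\<eta> y)))
      else \<beta> x + (\<Sum>\<^sub>\<infinity>y. qv x y * of_bool (\<eta> y)))"

definition nve_operator ::
  "('a \<Rightarrow> 'a \<Rightarrow> real) \<Rightarrow> ('a \<Rightarrow> 'a \<Rightarrow> real) \<Rightarrow> ('a \<Rightarrow> real) \<Rightarrow> ('a \<Rightarrow> real)
     \<Rightarrow> ('a config \<Rightarrow> real) \<Rightarrow> 'a config \<Rightarrow> real" where
  "nve_operator qe qv \<beta> \<delta> f \<eta> =
     (\<Sum>\<^sub>\<infinity>(x, y) \<in> {(x, y). \<eta> x \<and> \<not> \<eta> y}. qe x y * (f (exchange x y \<eta>) - f \<eta>)) +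
     (\<Sum>\<^sub>\<infinity>x. flip_rate qv \<beta> \<delta> x \<eta> * (f (flip x \<eta>) - f \<eta>))"

definition finitely_dependent :: "('a config \<Rightarrow> real) \<Rightarrow> bool" where
  "finitely_dependent f \<longleftrightarrow>
     (\<exists>A. finite A \<and> (\<forall>\<eta> \<zeta>. (\<forall>x\<in>A. \<eta> x = \<zeta> x) \<longrightarrow> f \<eta> = f \<zeta>))"

definition nve_pregenerator ::
  "('a \<Rightarrow> 'a \<Rightarrow> real) \<Rightarrow> ('a \<Rightarrow> 'a \<Rightarrow> real) \<Rightarrow> ('a \<Rightarrow> real) \<Rightarrow> ('a \<Rightarrow> real)
     \<Rightarrow> (('a config \<Rightarrow>\<^sub>C real) \<times> ('a config \<Rightarrow>\<^sub>C real)) set" where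
  "nve_pregenerator qe qv \<beta> \<delta> =
     {(f, g). finitely_dependent (apply_bcontfun f) \<and>
              (\<forall>\<eta>. apply_bcontfun g \<eta> = nve_operator qe qv \<beta> \<delta> (apply_bcontfun f) \<eta>)}"

definition nve_process ::
  "('a \<Rightarrow> 'a \<Rightarrow> real) \<Rightarrow> ('a \<Rightarrow> 'a \<Rightarrow> real) \<Rightarrow> ('a \<Rightarrow> real) \<Rightarrow> ('a \<Rightarrow> real)
     \<Rightarrow> 'a transition \<Rightarrow> bool" where
  "nve_process qe qv \<beta> \<delta> K \<longleftrightarrow>
     feller_process K \<and> generator K = closure (nve_pregenerator qe qv \<beta> \<delta>)"


section \<open>Continuous time Markov chains\<close>

text \<open>
  \<open>P x\<close> is the law of the chain started from \<open>x\<close>.  The assumptions are, in order: the initial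
  state, right-continuity of the paths in the discrete topology, the time-homogeneous Markov
  property at time \<open>s\<close> (with \<open>F\<close> a finite set of observation times, the last of which is \<open>s\<close>,
  and \<open>c\<close> the observed states), and the jump and holding rates.  Values \<open>q x x\<close> play no role.
\<close>

locale markov_chain =
  fixes q :: "'a::countable \<Rightarrow> 'a \<Rightarrow> real"
    and P :: "'a \<Rightarrow> 'w measure"
    and X :: "real \<Rightarrow> 'w \<Rightarrow> 'a"
  assumes prob: "prob_space (P x)"
    and measurable_X: "t \<ge> 0 \<Longrightarrow> X t \<in> P x \<rightarrow>\<^sub>M count_space UNIV"
    and start: "measure (P x) {\<omega> \<in> space (P x). X 0 \<omega> = x} = 1"
    and right_continuous:
      "\<omega> \<in> space (P x) \<Longrightarrow> t \<ge> 0 \<Longrightarrow> \<forall>\<^sub>F s in at_right t. X s \<omega> = X t \<omega>"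
    and markov:
      "finite F \<Longrightarrow> F \<subseteq> {0..s} \<Longrightarrow> s \<in> F \<Longrightarrow> t \<ge> 0 \<Longrightarrow>
         measure (P x) {\<omega> \<in> space (P x). (\<forall>r\<in>F. X r \<omega> = c r) \<and> X (s + t) \<omega> = z} =
         measure (P x) {\<omega> \<in> space (P x). \<forall>r\<in>F. X r \<omega> = c r} *
         measure (P (c s)) {\<omega> \<in> space (P (c s)). X t \<omega> = z}"
    and jump_rate:
      "x \<noteq> y \<Longrightarrow>
         ((\<lambda>t. measure (P x) {\<omega> \<in> space (P x). X t \<omega> = y} / t) \<longlongrightarrow> q x y) (at_right 0)"
    and holding_rate:
      "((\<lambda>t. measure (P x) {\<omega> \<in> space (P x). X t \<omega> \<noteq> x} / t)
          \<longlongrightarrow> (\<Sum>\<^sub>\<infinity>y\<in>-{x}. q x y)) (at_right 0)"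

end

theory Submission
  imports Defs
begin

text \<open>
  The process is studied through a dual system of particles.  For a finite set \<open>A\<close> of sites let
  \<open>occ A\<close> be the product of the coordinates in \<open>A\<close>.  The generator maps \<open>occ A\<close> to a combination of
  products \<open>occ B\<close> with \<open>card B \<le> card A\<close> (\<open>nve_operator_occ\<close>), and the coefficients are the rates
  of a Markov process on finite sets: a particle moves from \<open>x\<close> to \<open>y\<close> at rate \<open>q\<^sub>e + q\<^sub>v\<close>, it
  merges with a particle that it meets by a move of the second kind, it disappears at rate
  \<open>\<beta> x\<close>, and at rate \<open>\<delta> x\<close> the whole system is killed.  Therefore the moments
  \<open>moment t \<eta> A\<close>, the expectations of \<open>occ A\<close> at time \<open>t\<close>, solve a closed linear system, whose
  operator \<open>dual_op\<close> is bounded on functions of sets with at most \<open>n\<close> elements.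

  For one particle the difference \<open>gap t x\<close> of the moments of \<open>{x}\<close> started from the all-one and
  from the all-zero configuration solves \<open>d' = (Q - \<beta> - \<delta>) d\<close>, \<open>d\<^sub>0 = 1\<close>, where \<open>Q\<close> is the generator of the chain
  \<open>X\<close>.  So the Feynman--Kac formula (\<open>feynman_kac\<close>) gives
  \<open>gap t x = E\<^sup>x exp (- \<integral>\<^sub>0\<^sup>t (\<beta> + \<delta>) (X s) ds)\<close>, and \<open>gap t x\<close> tends to \<open>0\<close> if and only if the total
  integral is almost surely infinite (\<open>killing_probability_one_iff\<close>).

  It remains to see that ergodicity means that all gaps vanish in the limit
  (\<open>ergodic_iff_gap_vanishes\<close>).  If the process is ergodic, the laws started from the two extreme
  configurations have the same limit.  Conversely, \<open>A \<mapsto> \<Sum>x\<in>A. gap t x\<close> is a supersolution of the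
  dual system: merging and killing only decrease such a sum, and the symmetric exchange rates
  between two sites of \<open>A\<close> cancel.  By the maximum principle (\<open>comparison\<close>) it dominates
  \<open>\<bar>moment t \<eta> A - moment t \<zeta> A\<bar>\<close> for all \<open>\<eta>\<close> and \<open>\<zeta>\<close> (\<open>moment_diff_le_gap\<close>).  Hence, if the gaps
  vanish, the semigroup forgets the initial configuration on products of coordinates, and by
  density on all continuous functions.  The limits form a positive linear functional, which a
  measure represents because the configuration space is compact (\<open>riesz_configs\<close>); this measure is
  invariant, unique and attracts every initial law.

  Neither semigroup is differentiated at positive times.  Both are compared with Euler steps:
  an error of order \<open>h\<^sup>2\<close> per step of length \<open>h\<close>, uniform in the state, adds up to an error of order
  \<open>h\<close> over a bounded time interval.  The uniform second order estimates follow from the limits at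
  time \<open>0\<close> by cutting \<open>[0, h]\<close> into \<open>n\<close> pieces and letting \<open>n\<close> tend to infinity
  (\<open>generator_increment\<close>, \<open>evolve_second_order\<close>).
\<close>

section \<open>Absolutely convergent sums\<close>

lemma
  fixes p \<phi> :: "'a \<Rightarrow> real"
  assumes p: "\<And>y. p y \<ge> 0" "p summable_on UNIV" and \<phi>: "\<And>y. \<bar>\<phi> y\<bar> \<le> c"
  shows weighted_summable: "(\<lambda>y. p y * \<phi> y) summable_on UNIV"
    and weighted_infsum_bound: "\<bar>\<Sum>\<^sub>\<infinity>y. p y * \<phi> y\<bar> \<le> c * (\<Sum>\<^sub>\<infinity>y. p y)"
proof -
  have s: "(\<lambda>y. c * p y) summable_on UNIV"
    using p(2) by (rule summable_on_cmult_right)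
  have b: "norm (p y * \<phi> y) \<le> c * p y" for y
    using mult_right_mono[OF \<phi>[of y] p(1)[of y]] p(1)[of y] by (simp add: abs_mult mult.commute)
  have a: "(\<lambda>y. norm (p y * \<phi> y)) summable_on UNIV"
    using summable_on_comparison_test[OF s b] by simp
  then show sp: "(\<lambda>y. p y * \<phi> y) summable_on UNIV" by (rule abs_summable_summable)
  have "norm (\<Sum>\<^sub>\<infinity>y. p y * \<phi> y) \<le> (\<Sum>\<^sub>\<infinity>y. c * p y)"
    by (rule norm_infsum_le[OF has_sum_infsum[OF sp] has_sum_infsum[OF s] b])
  then show "\<bar>\<Sum>\<^sub>\<infinity>y. p y * \<phi> y\<bar> \<le> c * (\<Sum>\<^sub>\<infinity>y. p y)"
    by (simp add: infsum_cmult_right')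
qed

lemma infsum_finite_Times:
  fixes f :: "'a \<Rightarrow> 'b \<Rightarrow> real"
  assumes "finite A" "\<And>x. x \<in> A \<Longrightarrow> f x summable_on B"
  shows "(\<lambda>(x, y). f x y) summable_on A \<times> B"
    and "(\<Sum>\<^sub>\<infinity>(x, y)\<in>A \<times> B. f x y) = (\<Sum>x\<in>A. \<Sum>\<^sub>\<infinity>y\<in>B. f x y)"
proof -
  show s: "(\<lambda>(x, y). f x y) summable_on A \<times> B"
    using assms
  proof (induction A)
    case (insert x A)
    have 1: "(\<lambda>(x, y). f x y) summable_on Pair x ` B"
      by (subst summable_on_reindex) (use insert in \<open>auto simp: inj_on_def o_def\<close>)
    have "insert x A \<times> B = Pair x ` B \<union> A \<times> B" by auto
    then show ?case
      using summable_on_union[OF 1 insert.IH] insert.prems by simp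
  qed simp
  show "(\<Sum>\<^sub>\<infinity>(x, y)\<in>A \<times> B. f x y) = (\<Sum>x\<in>A. \<Sum>\<^sub>\<infinity>y\<in>B. f x y)"
    using infsum_Sigma'_banach[OF s[unfolded], symmetric] assms(1) by simp
qed

section \<open>The compact space of configurations\<close>

lemma compact_configs: "compact (UNIV :: 'a config set)"
proof -
  have "finite (UNIV :: bool set)" by simp
  then have "compact_space (euclidean :: bool topology)"
    using finite_imp_compact compactin_euclidean_iff by (metis compact_space_def topspace_euclidean)
  then have "compact_space (product_topology (\<lambda>_::'a. euclidean :: bool topology) UNIV)"
    by (simp add: compact_space_product_topology)
  then show ?thesis
    by (metis compact_space_def compactin_euclidean_iff euclidean_product_topology topspace_euclidean)
qed

definition cylinder :: "'a set \<Rightarrow> 'a config \<Rightarrow> 'a config set" where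
  "cylinder A \<eta> = {\<zeta>. \<forall>x\<in>A. \<zeta> x = \<eta> x}"

lemma continuous_coordinate: "continuous_on S (\<lambda>\<eta>. \<eta> x)"
  for S :: "'a config set"
  by (rule continuous_on_subset[OF continuous_on_product_coordinates]) simp

lemma continuous_of_bool: "continuous_on S (of_bool :: bool \<Rightarrow> real)"
  by (simp add: continuous_on_open_invariant Topological_Spaces.open_discrete)

lemma clopen_coordinate: "open {\<zeta> :: 'a config. \<zeta> x = b}"
proof -
  have "open ((\<lambda>\<eta> :: 'a config. \<eta> x) -` {b})"
    by (rule open_vimage[OF _ continuous_coordinate]) (rule Topological_Spaces.open_discrete)
  then show ?thesis by (simp add: vimage_def)
qed

lemma open_cylinder: "finite A \<Longrightarrow> open (cylinder A \<eta>)"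
proof (induction A rule: finite_induct)
  case empty
  then show ?case by (simp add: cylinder_def)
next
  case (insert x A)
  have "cylinder (insert x A) \<eta> = {\<zeta>. \<zeta> x = \<eta> x} \<inter> cylinder A \<eta>"
    by (auto simp: cylinder_def)
  with insert show ?case by (simp add: open_Int clopen_coordinate)
qed

lemma open_contains_cylinder:
  assumes "open (U :: 'a config set)" "\<eta> \<in> U"
  obtains A where "finite A" "cylinder A \<eta> \<subseteq> U"
proof -
  have "openin (product_topology (\<lambda>i::'a. euclidean :: bool topology) UNIV) U"
    using assms(1) by (simp add: open_fun_def)
  from product_topology_open_contains_basis[OF this assms(2)]
  obtain V where V: "\<eta> \<in> Pi\<^sub>E UNIV V" "finite {i. V i \<noteq> topspace (euclidean::bool topology)}" "Pi\<^sub>E UNIV V \<subseteq> U"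
    by blast
  have "cylinder {i. V i \<noteq> UNIV} \<eta> \<subseteq> U"
  proof
    fix \<zeta> assume "\<zeta> \<in> cylinder {i. V i \<noteq> UNIV} \<eta>"
    then have "\<zeta> i \<in> V i" for i
      using V(1) by (cases "V i = UNIV") (auto simp: cylinder_def PiE_iff)
    then show "\<zeta> \<in> U" using V(3) by auto
  qed
  then show thesis using that V(2) by auto
qed

text \<open>
  By compactness finitely many cylinders suffice on which the function varies little; the union of
  their coordinate sets serves as \<open>A\<close>.
\<close>

lemma uniformly_finitely_dependent:
  fixes f :: "'a config \<Rightarrow> real"
  assumes f: "continuous_on UNIV f" and "\<epsilon> > 0"
  obtains A where "finite A" "\<And>\<eta> \<zeta>. (\<forall>x\<in>A. \<eta> x = \<zeta> x) \<Longrightarrow> \<bar>f \<eta> - f \<zeta>\<bar> < \<epsilon>"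
proof -
  have "\<exists>A. finite A \<and> cylinder A \<eta> \<subseteq> f -` ball (f \<eta>) (\<epsilon>/2)" for \<eta>
    by (rule open_contains_cylinder[of "f -` ball (f \<eta>) (\<epsilon>/2)" \<eta>])
      (use assms in \<open>auto intro!: open_vimage\<close>)
  then obtain A where A: "\<And>\<eta>. finite (A \<eta>)" "\<And>\<eta>. cylinder (A \<eta>) \<eta> \<subseteq> f -` ball (f \<eta>) (\<epsilon>/2)"
    by metis
  have "UNIV \<subseteq> (\<Union>\<eta>. cylinder (A \<eta>) \<eta>)" by (auto simp: cylinder_def)
  then obtain F where F: "finite F" "UNIV \<subseteq> (\<Union>\<eta>\<in>F. cylinder (A \<eta>) \<eta>)"
    using compactE_image[OF compact_configs, of UNIV "\<lambda>\<eta>. cylinder (A \<eta>) \<eta>"] A(1)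
    by (metis open_cylinder)
  show thesis
  proof (rule that[of "\<Union>\<eta>\<in>F. A \<eta>"])
    show "finite (\<Union>\<eta>\<in>F. A \<eta>)" using F A by auto
    fix \<eta> \<zeta> :: "'a config" assume eq: "\<forall>x\<in>(\<Union>\<eta>\<in>F. A \<eta>). \<eta> x = \<zeta> x"
    obtain \<xi> where "\<xi> \<in> F" "\<eta> \<in> cylinder (A \<xi>) \<xi>" using F(2) by auto
    moreover from this have "\<zeta> \<in> cylinder (A \<xi>) \<xi>" using eq by (auto simp: cylinder_def)
    ultimately have "dist (f \<xi>) (f \<eta>) < \<epsilon>/2" "dist (f \<xi>) (f \<zeta>) < \<epsilon>/2" using A(2)[of \<xi>] by auto
    then show "\<bar>f \<eta> - f \<zeta>\<bar> < \<epsilon>" unfolding dist_real_def by argo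
  qed
qed

lemma continuous_bounded:
  fixes f :: "'a config \<Rightarrow> real"
  assumes "continuous_on UNIV f"
  obtains B where "\<And>\<eta>. \<bar>f \<eta>\<bar> \<le> B"
  using compact_imp_bounded[OF compact_continuous_image[OF assms compact_configs]]
  by (auto simp: bounded_iff)

lemma integrable_continuous:
  fixes f :: "'a config \<Rightarrow> real"
  assumes "finite_measure M" "sets M = sets borel" "continuous_on UNIV f"
  shows "integrable M f"
proof -
  interpret finite_measure M by fact
  obtain B where "\<And>\<eta>. \<bar>f \<eta>\<bar> \<le> B" using continuous_bounded[OF assms(3)] by blast
  then show ?thesis
    using borel_measurable_continuous_onI[OF assms(3)] assms(2)
    by (intro integrable_const_bound[where B=B]) (auto cong: measurable_cong_sets)
qed

lemma continuous_in_bcontfun: "continuous_on UNIV f \<Longrightarrow> f \<in> bcontfun"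
  for f :: "'a config \<Rightarrow> real"
  by (metis bcontfun_normI continuous_bounded real_norm_def)

lemma continuous_apply_Bcontfun: "continuous_on UNIV f \<Longrightarrow> apply_bcontfun (Bcontfun f) = f"
  for f :: "'a config \<Rightarrow> real"
  by (simp add: Bcontfun_inverse continuous_in_bcontfun)

section \<open>Products of coordinates\<close>

definition occ :: "'a set \<Rightarrow> 'a config \<Rightarrow> real" where
  "occ A \<eta> = of_bool (\<forall>x\<in>A. \<eta> x)"

lemma occ_bounds: "0 \<le> occ A \<eta>" "occ A \<eta> \<le> 1" "\<bar>occ A \<eta>\<bar> \<le> 1"
  by (auto simp: occ_def)

lemma continuous_occ: "finite A \<Longrightarrow> continuous_on UNIV (occ A)"
proof (induction A rule: finite_induct)
  case empty
  then show ?case by (simp add: occ_def)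
next
  case (insert x A)
  have "occ (insert x A) = (\<lambda>\<eta>. of_bool (\<eta> x) * occ A \<eta>)"
    by (auto simp: occ_def fun_eq_iff)
  moreover have "continuous_on UNIV (\<lambda>\<eta>. of_bool (\<eta> x) :: real)"
    by (rule continuous_on_compose2[OF continuous_of_bool continuous_coordinate]) auto
  ultimately show ?case using insert by (simp add: continuous_on_mult)
qed

text \<open>
  A function of finitely many coordinates is affine in each of them, so the coordinates can be split
  off one at a time.  For the induction the claim is strengthened to products of \<open>g\<close> with \<open>occ B\<close>.
\<close>

lemma finitely_dependent_in_occ_span:
  assumes occ: "\<And>A. finite A \<Longrightarrow> C (occ A)"
    and add: "\<And>f g. C f \<Longrightarrow> C g \<Longrightarrow> C (\<lambda>\<eta>. f \<eta> + g \<eta>)"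
    and scale: "\<And>f c. C f \<Longrightarrow> C (\<lambda>\<eta>. c * f \<eta>)"
    and g: "finite A" "\<And>\<eta> \<zeta>. (\<forall>x\<in>A. \<eta> x = \<zeta> x) \<Longrightarrow> g \<eta> = g \<zeta>"
  shows "C g"
proof -
  have "C (\<lambda>\<eta>. g \<eta> * occ B \<eta>)" if "finite B" for B
    using g that
  proof (induction A arbitrary: g B rule: finite_induct)
    case empty
    have "g = (\<lambda>_. g (\<lambda>_. True))" by (rule ext) (rule empty.prems, simp)
    then have "(\<lambda>\<eta>. g \<eta> * occ B \<eta>) = (\<lambda>\<eta>. g (\<lambda>_. True) * occ B \<eta>)"
      by metis
    then show ?case using scale[OF occ[OF empty.prems(2)], of "g (\<lambda>_. True)"] by simp
  next
    case (insert x A)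
    define G where "G b = (\<lambda>\<eta>. g (\<eta>(x := b)))" for b
    have G: "C (\<lambda>\<eta>. G b \<eta> * occ B \<eta>)" if "finite B" for b B
      unfolding G_def by (rule insert.IH[OF _ that]) (rule insert.prems, auto)
    have "C (\<lambda>\<eta>. G False \<eta> * occ B \<eta> +
        (G True \<eta> * occ (insert x B) \<eta> + (-1) * (G False \<eta> * occ (insert x B) \<eta>)))"
      by (intro add scale G) (use insert.prems in auto)
    also have "(\<lambda>\<eta>. G False \<eta> * occ B \<eta> +
        (G True \<eta> * occ (insert x B) \<eta> + (-1) * (G False \<eta> * occ (insert x B) \<eta>)))
        = (\<lambda>\<eta>. g \<eta> * occ B \<eta>)"
    proof
      fix \<eta> :: "'a config"
      have "g \<eta> = G (\<eta> x) \<eta>" by (simp add: G_def)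
      then show "G False \<eta> * occ B \<eta> +
        (G True \<eta> * occ (insert x B) \<eta> + (-1) * (G False \<eta> * occ (insert x B) \<eta>)) = g \<eta> * occ B \<eta>"
        by (cases "\<eta> x") (auto simp: occ_def)
    qed
    finally show ?case .
  qed
  from this[of "{}"] show ?thesis by (simp add: occ_def)
qed

section \<open>The dual operator\<close>

context nve_rates begin

definition rate_bound :: real where
  "rate_bound = (SUP x. \<beta> x + \<delta> x) + (SUP x. \<Sum>\<^sub>\<infinity>y. qe x y + qv x y)"

text \<open>
  The rate at which the particle at \<open>x\<close> in the dual system \<open>A\<close> moves to \<open>y\<close>.  Two particles of \<open>A\<close> that
  exchange their positions leave \<open>A\<close> unchanged, hence the case distinction.
\<close>

definition dual_rate :: "'a set \<Rightarrow> 'a \<Rightarrow> 'a \<Rightarrow> real" where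
  "dual_rate A x y = qv x y + (if y \<in> A then 0 else qe x y)"

definition dual_term :: "('a set \<Rightarrow> real) \<Rightarrow> 'a set \<Rightarrow> 'a \<Rightarrow> real" where
  "dual_term u A x = \<beta> x * (u (A - {x}) - u A) - \<delta> x * u A
     + (\<Sum>\<^sub>\<infinity>y. dual_rate A x y * (u (insert y (A - {x})) - u A))"

definition dual_op :: "('a set \<Rightarrow> real) \<Rightarrow> 'a set \<Rightarrow> real" where
  "dual_op u A = (\<Sum>x\<in>A. dual_term u A x)"

lemma rate_bound: "\<beta> x + \<delta> x + (\<Sum>\<^sub>\<infinity>y. qe x y + qv x y) \<le> rate_bound"
  unfolding rate_bound_def
  by (intro add_mono cSUP_upper noise_bounded q_bounded) auto

lemma total_rate_nonneg: "0 \<le> (\<Sum>\<^sub>\<infinity>y. qe x y + qv x y)"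
  by (intro infsum_nonneg add_nonneg_nonneg qe_nonneg qv_nonneg)

lemma rate_bound_nonneg: "0 \<le> rate_bound"
  using rate_bound[of undefined] \<beta>_nonneg[of undefined] \<delta>_nonneg[of undefined]
    total_rate_nonneg[of undefined] by linarith

lemma noise_le_rate_bound: "\<beta> x + \<delta> x \<le> rate_bound"
  using rate_bound[of x] total_rate_nonneg[of x] by linarith

lemma qe_summable: "qe x summable_on UNIV" and qv_summable: "qv x summable_on UNIV"
  by (rule summable_on_comparison_test[OF q_summable[of x]]; simp add: qe_nonneg qv_nonneg)+

lemma dual_rate_nonneg: "0 \<le> dual_rate A x y"
  by (simp add: dual_rate_def qe_nonneg qv_nonneg)

lemma dual_rate_le: "dual_rate A x y \<le> qe x y + qv x y"
  by (simp add: dual_rate_def qe_nonneg qv_nonneg)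

lemma dual_rate_summable: "dual_rate A x summable_on UNIV"
  by (rule summable_on_comparison_test[OF q_summable[of x]])
    (auto simp: dual_rate_le dual_rate_nonneg)

lemma dual_rate_total: "(\<Sum>\<^sub>\<infinity>y. dual_rate A x y) \<le> (\<Sum>\<^sub>\<infinity>y. qe x y + qv x y)"
  by (intro infsum_mono dual_rate_summable q_summable dual_rate_le)

lemma dual_rate_bound: "\<beta> x + \<delta> x + (\<Sum>\<^sub>\<infinity>y. dual_rate A x y) \<le> rate_bound"
  using rate_bound[of x] dual_rate_total[of A x] by linarith

text \<open>
  All estimates for the dual system are uniform only for a bounded number of particles, since the
  total jump rate grows with that number.
\<close>

definition bounded_upto :: "nat \<Rightarrow> real \<Rightarrow> ('a set \<Rightarrow> real) \<Rightarrow> bool" where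
  "bounded_upto n c u \<longleftrightarrow> (\<forall>A. finite A \<longrightarrow> card A \<le> n \<longrightarrow> \<bar>u A\<bar> \<le> c)"

lemma card_jump:
  assumes "finite A" "x \<in> A"
  shows "card (insert y (A - {x})) \<le> card A"
proof -
  have "card (insert y (A - {x})) \<le> Suc (card (A - {x}))"
    using assms(1) by (simp add: card_insert_if)
  also have "\<dots> = card A" by (rule card_Suc_Diff1[OF assms])
  finally show ?thesis .
qed

lemma bounded_uptoD:
  assumes "bounded_upto n c u" "finite A" "card A \<le> n"
  shows "\<bar>u A\<bar> \<le> c" and "x \<in> A \<Longrightarrow> \<bar>u (A - {x})\<bar> \<le> c"
    and "x \<in> A \<Longrightarrow> \<bar>u (insert y (A - {x}))\<bar> \<le> c"
proof -
  show "\<bar>u A\<bar> \<le> c" using assms by (auto simp: bounded_upto_def)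
  show "\<bar>u (A - {x})\<bar> \<le> c" if "x \<in> A"
    using assms that by (auto simp: bounded_upto_def)
  show "\<bar>u (insert y (A - {x}))\<bar> \<le> c" if "x \<in> A"
    using assms that card_jump[OF assms(2) that, of y] by (auto simp: bounded_upto_def)
qed

lemma jump_summable:
  assumes "bounded_upto n c u" "finite A" "card A \<le> n" "x \<in> A"
  shows "(\<lambda>y. dual_rate A x y * (u (insert y (A - {x})) - u A)) summable_on UNIV"
    and "(\<lambda>y. dual_rate A x y * u (insert y (A - {x}))) summable_on UNIV"
proof -
  have "\<bar>u (insert y (A - {x})) - u A\<bar> \<le> 2 * c" for y
    using bounded_uptoD(1)[OF assms(1-3)] bounded_uptoD(3)[OF assms, of y] by linarith
  from weighted_summable[OF dual_rate_nonneg dual_rate_summable this]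
  show "(\<lambda>y. dual_rate A x y * (u (insert y (A - {x})) - u A)) summable_on UNIV" .
  show "(\<lambda>y. dual_rate A x y * u (insert y (A - {x}))) summable_on UNIV"
    by (rule weighted_summable[OF dual_rate_nonneg dual_rate_summable bounded_uptoD(3)[OF assms]])
qed

lemma dual_op_bound:
  assumes u: "bounded_upto n c u" and A: "finite A" "card A \<le> n"
  shows "\<bar>dual_op u A\<bar> \<le> n * (2 * rate_bound * c)"
proof -
  have c: "0 \<le> c" using bounded_uptoD(1)[OF u A] by linarith
  have "\<bar>dual_term u A x\<bar> \<le> 2 * rate_bound * c" if x: "x \<in> A" for x
  proof -
    have 1: "\<bar>u (insert y (A - {x})) - u A\<bar> \<le> 2 * c" for y
      using bounded_uptoD(1)[OF u A] bounded_uptoD(3)[OF u A x, of y] by linarith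
    have 2: "\<bar>\<Sum>\<^sub>\<infinity>y. dual_rate A x y * (u (insert y (A - {x})) - u A)\<bar>
        \<le> 2 * c * (\<Sum>\<^sub>\<infinity>y. dual_rate A x y)"
      by (rule weighted_infsum_bound[OF dual_rate_nonneg dual_rate_summable 1])
    have "\<bar>u (A - {x}) - u A\<bar> \<le> 2 * c"
      using bounded_uptoD(1)[OF u A] bounded_uptoD(2)[OF u A x] by linarith
    then have 3: "\<bar>\<beta> x * (u (A - {x}) - u A)\<bar> \<le> \<beta> x * (2 * c)"
      using \<beta>_nonneg[of x] by (simp add: abs_mult mult_left_mono)
    have "\<bar>u A\<bar> \<le> 2 * c" using bounded_uptoD(1)[OF u A] c by linarith
    then have 4: "\<bar>\<delta> x * u A\<bar> \<le> \<delta> x * (2 * c)"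
      using \<delta>_nonneg[of x] by (simp add: abs_mult mult_left_mono)
    have "\<bar>dual_term u A x\<bar> \<le> (\<beta> x + \<delta> x + (\<Sum>\<^sub>\<infinity>y. dual_rate A x y)) * (2 * c)"
      using 2 3 4 unfolding dual_term_def by (simp add: algebra_simps)
    also have "\<dots> \<le> rate_bound * (2 * c)"
      using dual_rate_bound c by (intro mult_right_mono) auto
    finally show ?thesis by simp
  qed
  then have "(\<Sum>x\<in>A. \<bar>dual_term u A x\<bar>) \<le> card A * (2 * rate_bound * c)"
    by (rule sum_bounded_above)
  moreover have "\<bar>dual_op u A\<bar> \<le> (\<Sum>x\<in>A. \<bar>dual_term u A x\<bar>)"
    unfolding dual_op_def by (rule sum_abs)
  moreover have "card A * (2 * rate_bound * c) \<le> n * (2 * rate_bound * c)"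
    using A c rate_bound_nonneg by (intro mult_right_mono) auto
  ultimately show ?thesis by linarith
qed

lemma dual_op_diff:
  assumes u: "bounded_upto n c u" and v: "bounded_upto n d v" and A: "finite A" "card A \<le> n"
  shows "dual_op (\<lambda>B. u B - v B) A = dual_op u A - dual_op v A"
proof -
  have "dual_term (\<lambda>B. u B - v B) A x = dual_term u A x - dual_term v A x" if x: "x \<in> A" for x
  proof -
    define F where "F = (\<lambda>y. dual_rate A x y * (u (insert y (A - {x})) - u A))"
    define G where "G = (\<lambda>y. dual_rate A x y * (v (insert y (A - {x})) - v A))"
    have F: "F summable_on UNIV" unfolding F_def by (rule jump_summable(1)[OF u A x])
    have "G summable_on UNIV" unfolding G_def by (rule jump_summable(1)[OF v A x])
    then have G: "(\<lambda>y. - G y) summable_on UNIV" by (rule iffD2[OF summable_on_uminus])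
    have "(\<Sum>\<^sub>\<infinity>y. dual_rate A x y * ((u (insert y (A - {x})) - v (insert y (A - {x}))) - (u A - v A)))
      = (\<Sum>\<^sub>\<infinity>y. F y + - G y)"
      unfolding F_def G_def by (rule infsum_cong) algebra
    also have "\<dots> = infsum F UNIV + - infsum G UNIV"
      unfolding infsum_add[OF F G] infsum_uminus ..
    finally have "(\<Sum>\<^sub>\<infinity>y. dual_rate A x y * ((u (insert y (A - {x})) - v (insert y (A - {x}))) - (u A - v A)))
      = infsum F UNIV - infsum G UNIV" by simp
    then show ?thesis unfolding dual_term_def F_def G_def by (simp add: algebra_simps)
  qed
  then show ?thesis by (simp add: dual_op_def sum_subtractf)
qed

text \<open>
  The maximum principle in discrete time.  If \<open>h\<close> is at most the reciprocal of the total rate,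
  then \<open>u A + h * dual_op u A\<close> is a combination of values of \<open>u\<close> with nonnegative coefficients, and
  these sum to at most \<open>1\<close> because of the killing at rate \<open>\<delta>\<close>.
\<close>

lemma dual_step_positive:
  assumes u: "bounded_upto n c u" and A: "finite A" "card A \<le> n"
    and low: "\<And>B. finite B \<Longrightarrow> card B \<le> n \<Longrightarrow> - \<epsilon> \<le> u B"
    and h: "0 \<le> h" "h * (n * rate_bound) \<le> 1" and \<epsilon>: "0 \<le> \<epsilon>"
  shows "- \<epsilon> \<le> u A + h * dual_op u A"
proof -
  define s where "s x = \<beta> x + \<delta> x + (\<Sum>\<^sub>\<infinity>y. dual_rate A x y)" for x
  have t: "dual_term u A x \<ge> - s x * (u A + \<epsilon>)" if x: "x \<in> A" for x
  proof -
    have "(\<Sum>\<^sub>\<infinity>y. dual_rate A x y * (- (u A + \<epsilon>)))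
        \<le> (\<Sum>\<^sub>\<infinity>y. dual_rate A x y * (u (insert y (A - {x})) - u A))"
    proof (intro infsum_mono mult_left_mono dual_rate_nonneg)
      show "(\<lambda>y. dual_rate A x y * (- (u A + \<epsilon>))) summable_on UNIV"
        by (intro summable_on_cmult_left dual_rate_summable)
      show "(\<lambda>y. dual_rate A x y * (u (insert y (A - {x})) - u A)) summable_on UNIV"
        by (rule jump_summable[OF u A x])
      show "- (u A + \<epsilon>) \<le> u (insert y (A - {x})) - u A" for y
        using low[of "insert y (A - {x})"] A card_jump[OF A(1) x, of y] by simp
    qed
    then have 1: "(\<Sum>\<^sub>\<infinity>y. dual_rate A x y) * (- (u A + \<epsilon>))
        \<le> (\<Sum>\<^sub>\<infinity>y. dual_rate A x y * (u (insert y (A - {x})) - u A))"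
      by (simp only: infsum_cmult_left')
    have "- (u A + \<epsilon>) \<le> u (A - {x}) - u A"
      using low[of "A - {x}"] A card_mono[OF A(1) Diff_subset[of A "{x}"]] by simp
    then have 2: "\<beta> x * (- (u A + \<epsilon>)) \<le> \<beta> x * (u (A - {x}) - u A)"
      by (rule mult_left_mono[OF _ \<beta>_nonneg])
    have 3: "\<delta> x * (- (u A + \<epsilon>)) \<le> - (\<delta> x * u A)"
      using mult_nonneg_nonneg[OF \<delta>_nonneg[of x] \<epsilon>] by (simp add: algebra_simps)
    show ?thesis using 1 2 3 unfolding dual_term_def s_def by (simp add: algebra_simps)
  qed
  have "(\<Sum>x\<in>A. - s x * (u A + \<epsilon>)) \<le> dual_op u A"
    unfolding dual_op_def by (intro sum_mono t)
  then have 1: "- (\<Sum>x\<in>A. s x) * (u A + \<epsilon>) \<le> dual_op u A"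
    by (simp add: sum_distrib_right sum_negf)
  have "(\<Sum>x\<in>A. s x) \<le> card A * rate_bound"
    unfolding s_def by (intro sum_bounded_above dual_rate_bound)
  also have "\<dots> \<le> n * rate_bound"
    using A rate_bound_nonneg by (intro mult_right_mono) auto
  finally have "h * (\<Sum>x\<in>A. s x) \<le> 1"
    using h by (meson mult_left_mono order_trans)
  then have "h * (\<Sum>x\<in>A. s x) * (u A + \<epsilon>) \<le> 1 * (u A + \<epsilon>)"
    using low[OF A] by (intro mult_right_mono) auto
  moreover have "h * (- (\<Sum>x\<in>A. s x) * (u A + \<epsilon>)) \<le> h * dual_op u A"
    by (intro mult_left_mono 1 h)
  ultimately show ?thesis by (simp add: algebra_simps)
qed

lemma dual_op_singleton:
  assumes "u {} = 0"
  shows "dual_op u {x} = (\<Sum>\<^sub>\<infinity>y. (qe x y + qv x y) * (u {y} - u {x})) - (\<beta> x + \<delta> x) * u {x}"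
proof -
  have "(\<Sum>\<^sub>\<infinity>y. dual_rate {x} x y * (u (insert y ({x} - {x})) - u {x}))
      = (\<Sum>\<^sub>\<infinity>y. (qe x y + qv x y) * (u {y} - u {x}))"
    by (intro infsum_cong) (auto simp: dual_rate_def)
  then show ?thesis using assms by (simp add: dual_op_def dual_term_def algebra_simps)
qed

text \<open>
  On a sum over the particles the dual operator acts at most like the generator of independent
  particles that are killed at rate \<open>\<beta> + \<delta>\<close>: when particles merge the sum counts their common site only once, killing
  of the whole system loses at least the term of the particle at \<open>x\<close>, and the exchanges inside
  \<open>A\<close>, which \<open>dual_rate\<close> omits, cancel in the total because \<open>qe\<close> is symmetric.
\<close>

lemma dual_op_sum_le:
  assumes d: "\<And>x. 0 \<le> d x" "\<And>x. d x \<le> c" and A: "finite A"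
  shows "dual_op (\<lambda>B. \<Sum>x\<in>B. d x) A
    \<le> (\<Sum>x\<in>A. (\<Sum>\<^sub>\<infinity>y. (qe x y + qv x y) * (d y - d x)) - (\<beta> x + \<delta> x) * d x)"
proof -
  define w where "w = (\<lambda>B. \<Sum>x\<in>B. d x)"
  have c: "0 \<le> c" using d[of undefined] by linarith
  have dd: "\<bar>d y - d x\<bar> \<le> c" for x y using d[of x] d[of y] by linarith
  have w: "bounded_upto (card A) (card A * c) w"
    unfolding bounded_upto_def w_def
  proof (intro allI impI)
    fix B :: "'a set" assume "finite B" "card B \<le> card A"
    have "(\<Sum>x\<in>B. d x) \<le> card B * c" by (rule sum_bounded_above) (rule d)
    also have "\<dots> \<le> card A * c" using c \<open>card B \<le> card A\<close> by (intro mult_right_mono) auto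
    finally show "\<bar>\<Sum>x\<in>B. d x\<bar> \<le> card A * c" using sum_nonneg[of B d] d by simp
  qed
  have sume: "(\<lambda>y. qe x y * (d y - d x)) summable_on UNIV" for x
    by (rule weighted_summable[OF qe_nonneg qe_summable dd])
  have sumv: "(\<lambda>y. qv x y * (d y - d x)) summable_on UNIV" for x
    by (rule weighted_summable[OF qv_nonneg qv_summable dd])
  have sumd: "(\<lambda>y. dual_rate A x y * (d y - d x)) summable_on UNIV" for x
    by (rule weighted_summable[OF dual_rate_nonneg dual_rate_summable dd])
  have term_le: "dual_term w A x \<le> (\<Sum>\<^sub>\<infinity>y. (qe x y + qv x y) * (d y - d x)) - (\<beta> x + \<delta> x) * d x
      - (\<Sum>y\<in>A. qe x y * (d y - d x))" if x: "x \<in> A" for x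
  proof -
    have wx: "w (A - {x}) = w A - d x" using A x by (simp add: w_def sum_diff1)
    have wy: "w (insert y (A - {x})) - w A \<le> d y - d x" for y
    proof -
      have "w (insert y (A - {x})) \<le> d y + w (A - {x})"
        using A d(1) by (cases "y \<in> A - {x}") (auto simp: w_def insert_absorb)
      then show ?thesis by (simp add: wx)
    qed
    have "(\<Sum>\<^sub>\<infinity>y. dual_rate A x y * (w (insert y (A - {x})) - w A))
        \<le> (\<Sum>\<^sub>\<infinity>y. dual_rate A x y * (d y - d x))"
      by (intro infsum_mono mult_left_mono wy dual_rate_nonneg sumd jump_summable[OF w A _ x]) simp
    also have "\<dots> = (\<Sum>\<^sub>\<infinity>y. (qe x y + qv x y) * (d y - d x)
        + (if y \<in> A then - (qe x y * (d y - d x)) else 0))"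
      by (intro infsum_cong) (auto simp: dual_rate_def algebra_simps)
    also have "\<dots> = (\<Sum>\<^sub>\<infinity>y. (qe x y + qv x y) * (d y - d x))
        + (\<Sum>\<^sub>\<infinity>y. if y \<in> A then - (qe x y * (d y - d x)) else 0)"
    proof (rule infsum_add)
      show "(\<lambda>y. (qe x y + qv x y) * (d y - d x)) summable_on UNIV"
        using summable_on_add[OF sume[of x] sumv[of x]] by (simp add: algebra_simps)
      show "(\<lambda>y. if y \<in> A then - (qe x y * (d y - d x)) else 0) summable_on UNIV"
        by (rule finite_nonzero_values_imp_summable_on) (rule finite_subset[OF _ A], auto)
    qed
    also have "(\<Sum>\<^sub>\<infinity>y. if y \<in> A then - (qe x y * (d y - d x)) else 0)
        = (\<Sum>\<^sub>\<infinity>y\<in>A. - (qe x y * (d y - d x)))"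
      by (rule infsum_cong_neutral) auto
    also have "\<dots> = - (\<Sum>y\<in>A. qe x y * (d y - d x))"
      using A by (simp add: sum_negf)
    finally have 1: "(\<Sum>\<^sub>\<infinity>y. dual_rate A x y * (w (insert y (A - {x})) - w A))
      \<le> (\<Sum>\<^sub>\<infinity>y. (qe x y + qv x y) * (d y - d x)) + - (\<Sum>y\<in>A. qe x y * (d y - d x))" .
    have "d x \<le> w A" unfolding w_def using A x d by (intro member_le_sum) auto
    then have "\<delta> x * d x \<le> \<delta> x * w A" by (rule mult_left_mono[OF _ \<delta>_nonneg])
    then show ?thesis using 1 unfolding dual_term_def wx by (simp add: algebra_simps)
  qed
  \<comment> \<open>The double sum over \<open>A\<close> is antisymmetric under the exchange of \<open>x\<close> and \<open>y\<close>.\<close>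
  have "(\<Sum>x\<in>A. \<Sum>y\<in>A. qe x y * (d y - d x)) = (\<Sum>x\<in>A. \<Sum>y\<in>A. qe y x * (d x - d y))"
    by (rule sum.swap)
  also have "\<dots> = - (\<Sum>x\<in>A. \<Sum>y\<in>A. qe x y * (d y - d x))"
    unfolding sum_negf[symmetric]
    by (intro sum.cong refl) (subst qe_sym, simp add: algebra_simps)
  finally have anti: "(\<Sum>x\<in>A. \<Sum>y\<in>A. qe x y * (d y - d x)) = 0" by linarith
  have "dual_op w A \<le> (\<Sum>x\<in>A. ((\<Sum>\<^sub>\<infinity>y. (qe x y + qv x y) * (d y - d x)) - (\<beta> x + \<delta> x) * d x)
      - (\<Sum>y\<in>A. qe x y * (d y - d x)))"
    unfolding dual_op_def by (intro sum_mono term_le)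
  then show ?thesis using anti unfolding w_def by (simp add: sum_subtractf)
qed

section \<open>The generator on products of coordinates\<close>

lemma occ_jump_bounded: "bounded_upto n 1 (\<lambda>B. occ B \<eta>)"
  by (simp add: bounded_upto_def occ_bounds)

text \<open>
  The sign of the change of \<open>\<eta> x\<close> turns the flip rate into an affine function:
  \<open>c(x, \<eta>) (1 - 2 \<eta>(x)) = \<beta>(x) (1 - \<eta>(x)) - \<delta>(x) \<eta>(x) + \<Sum>\<^sub>y q\<^sub>v(x, y) (\<eta>(y) - \<eta>(x))\<close>.
\<close>

lemma flip_rate_occ:
  assumes x: "x \<in> A"
  shows "flip_rate qv \<beta> \<delta> x \<eta> * (occ A (flip x \<eta>) - occ A \<eta>)
    = \<beta> x * (occ (A - {x}) \<eta> - occ A \<eta>) - \<delta> x * occ A \<eta>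
      + (\<Sum>\<^sub>\<infinity>y. qv x y * (occ (insert y (A - {x})) \<eta> - occ A \<eta>))"
proof -
  define a where "a = occ (A - {x}) \<eta>"
  have o: "occ A \<eta> = a * of_bool (\<eta> x)" using x by (auto simp: occ_def a_def)
  have f: "occ A (flip x \<eta>) = a * of_bool (\<not> \<eta> x)"
    using x by (auto simp: occ_def a_def flip_def)
  have i: "occ (insert y (A - {x})) \<eta> = a * of_bool (\<eta> y)" for y
    by (auto simp: occ_def a_def)
  show ?thesis
  proof (cases "\<eta> x")
    case True
    have "(\<Sum>\<^sub>\<infinity>y. qv x y * (a * of_bool (\<eta> y) - a)) = (\<Sum>\<^sub>\<infinity>y. (- a) * (qv x y * (1 - of_bool (\<eta> y))))"
      by (intro infsum_cong) (simp add: algebra_simps)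
    also have "\<dots> = - a * (\<Sum>\<^sub>\<infinity>y. qv x y * (1 - of_bool (\<eta> y)))"
      by (rule infsum_cmult_right')
    finally show ?thesis
      unfolding o f i a_def[symmetric] using True by (simp add: flip_rate_def algebra_simps)
  next
    case False
    have "(\<Sum>\<^sub>\<infinity>y. qv x y * (a * of_bool (\<eta> y))) = (\<Sum>\<^sub>\<infinity>y. a * (qv x y * of_bool (\<eta> y)))"
      by (intro infsum_cong) (simp add: algebra_simps)
    also have "\<dots> = a * (\<Sum>\<^sub>\<infinity>y. qv x y * of_bool (\<eta> y))"
      by (rule infsum_cmult_right')
    finally show ?thesis
      unfolding o f i a_def[symmetric] using False by (simp add: flip_rate_def algebra_simps)
  qed
qed

lemma flip_part_occ:
  assumes A: "finite A"
  shows "(\<Sum>\<^sub>\<infinity>x. flip_rate qv \<beta> \<delta> x \<eta> * (occ A (flip x \<eta>) - occ A \<eta>))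
    = (\<Sum>x\<in>A. \<beta> x * (occ (A - {x}) \<eta> - occ A \<eta>) - \<delta> x * occ A \<eta>
      + (\<Sum>\<^sub>\<infinity>y. qv x y * (occ (insert y (A - {x})) \<eta> - occ A \<eta>)))"
proof -
  have "occ A (flip x \<eta>) = occ A \<eta>" if "x \<notin> A" for x
    using that by (auto simp: occ_def flip_def)
  then have "(\<Sum>\<^sub>\<infinity>x. flip_rate qv \<beta> \<delta> x \<eta> * (occ A (flip x \<eta>) - occ A \<eta>))
      = (\<Sum>\<^sub>\<infinity>x\<in>A. flip_rate qv \<beta> \<delta> x \<eta> * (occ A (flip x \<eta>) - occ A \<eta>))"
    by (intro infsum_cong_neutral) auto
  then show ?thesis using A by (simp add: flip_rate_occ)
qed

text \<open>
  Only exchanges between a site \<open>x\<close> in \<open>A\<close> and a site \<open>y\<close> outside matter.  The particle leaves \<open>x\<close> when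
  \<open>\<eta> x \<and> \<not> \<eta> y\<close> and enters \<open>x\<close> when \<open>\<eta> y \<and> \<not> \<eta> x\<close>; by the symmetry of \<open>qe\<close> the two contributions \<open>G1\<close>
  and \<open>G2\<close> combine to \<open>\<eta> y - \<eta> x\<close>.
\<close>

lemma exchange_part_occ:
  assumes A: "finite A"
  shows "(\<Sum>\<^sub>\<infinity>(x, y) \<in> {(x, y). \<eta> x \<and> \<not> \<eta> y}. qe x y * (occ A (exchange x y \<eta>) - occ A \<eta>))
    = (\<Sum>x\<in>A. \<Sum>\<^sub>\<infinity>y\<in>-A. qe x y * (occ (insert y (A - {x})) \<eta> - occ A \<eta>))"
proof -
  define F where "F = (\<lambda>(x, y). qe x y * (occ A (exchange x y \<eta>) - occ A \<eta>))"
  define D1 where "D1 = {(x, y). \<eta> x \<and> \<not> \<eta> y} \<inter> A \<times> (-A)"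
  define D2 where "D2 = {(x, y). \<eta> x \<and> \<not> \<eta> y} \<inter> (-A) \<times> A"
  define G1 where "G1 = (\<lambda>(x, y). qe x y * (- (occ (A - {x}) \<eta> * of_bool (\<eta> x \<and> \<not> \<eta> y))))"
  define G2 where "G2 = (\<lambda>(x, y). qe x y * (occ (A - {x}) \<eta> * of_bool (\<eta> y \<and> \<not> \<eta> x)))"
  have b1: "\<bar>- (occ (A - {x}) \<eta> * of_bool (\<eta> x \<and> \<not> \<eta> y))\<bar> \<le> 1"
    and b2: "\<bar>occ (A - {x}) \<eta> * of_bool (\<eta> y \<and> \<not> \<eta> x)\<bar> \<le> 1" for x y
    using occ_bounds[of "A - {x}" \<eta>] by auto
  have s1: "(\<lambda>y. qe x y * (- (occ (A - {x}) \<eta> * of_bool (\<eta> x \<and> \<not> \<eta> y)))) summable_on -A"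
    and s2: "(\<lambda>y. qe x y * (occ (A - {x}) \<eta> * of_bool (\<eta> y \<and> \<not> \<eta> x))) summable_on -A" for x
    by (rule summable_on_subset[OF weighted_summable[OF qe_nonneg qe_summable b1] subset_UNIV]
        summable_on_subset[OF weighted_summable[OF qe_nonneg qe_summable b2] subset_UNIV])+
  have G1: "G1 summable_on A \<times> -A" and G2: "G2 summable_on A \<times> -A"
    unfolding G1_def G2_def using infsum_finite_Times(1)[OF A s1] infsum_finite_Times(1)[OF A s2]
    by auto
  have F1: "F p = G1 p" if "p \<in> D1" for p
  proof -
    obtain x y where p: "p = (x, y)" by force
    have "x \<in> A" "y \<notin> A" "\<eta> x" "\<not> \<eta> y" using that p by (auto simp: D1_def)
    then have "occ A \<eta> = occ (A - {x}) \<eta>" "occ A (exchange x y \<eta>) = 0"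
      by (auto simp: occ_def exchange_def)
    then show ?thesis using \<open>\<eta> x\<close> \<open>\<not> \<eta> y\<close> by (simp add: F_def G1_def p)
  qed
  have F2: "F (prod.swap p) = G2 p" if "p \<in> prod.swap ` D2" for p
  proof -
    obtain x y where p: "p = (x, y)" by force
    have "x \<in> A" "y \<notin> A" "\<eta> y" "\<not> \<eta> x" using that p by (auto simp: D2_def)
    then have "occ A \<eta> = 0" "occ A (exchange y x \<eta>) = occ (A - {x}) \<eta>"
      by (auto simp: occ_def exchange_def)
    then show ?thesis using \<open>\<eta> y\<close> \<open>\<not> \<eta> x\<close> by (simp add: F_def G2_def p qe_sym)
  qed
  have D1_sum: "infsum F D1 = infsum G1 (A \<times> -A)"
    by (rule infsum_cong_neutral) (auto simp: F1 D1_def[symmetric], auto simp: G1_def D1_def)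
  have "infsum F D2 = infsum (F \<circ> prod.swap) (prod.swap ` D2)"
    by (subst infsum_reindex[symmetric]) (auto simp: image_image)
  also have "\<dots> = infsum G2 (A \<times> -A)"
    by (rule infsum_cong_neutral) (auto simp: F2 o_def, auto simp: G2_def D2_def image_iff)
  finally have D2_sum: "infsum F D2 = infsum G2 (A \<times> -A)" .
  have "F summable_on D1"
    using summable_on_subset[OF G1, of D1] summable_on_cong[of D1 F G1] F1 by (auto simp: D1_def)
  moreover have "F summable_on D2"
  proof -
    have "G2 summable_on prod.swap ` D2"
      by (rule summable_on_subset[OF G2]) (auto simp: D2_def)
    then have "(F \<circ> prod.swap) summable_on prod.swap ` D2"
      using summable_on_cong[of "prod.swap ` D2" "F \<circ> prod.swap" G2] F2 by auto
    then show ?thesis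
      by (subst (asm) summable_on_reindex[symmetric]) (auto simp: image_image)
  qed
  ultimately have "infsum F (D1 \<union> D2) = infsum F D1 + infsum F D2"
    by (intro infsum_Un_disjoint) (auto simp: D1_def D2_def)
  also have "\<dots> = infsum (\<lambda>p. G1 p + G2 p) (A \<times> -A)"
    unfolding D1_sum D2_sum by (rule infsum_add[OF G1 G2, symmetric])
  also have "\<dots> = (\<Sum>\<^sub>\<infinity>(x, y)\<in>A \<times> -A. qe x y * (occ (insert y (A - {x})) \<eta> - occ A \<eta>))"
    by (rule infsum_cong) (auto simp: G1_def G2_def occ_def)
  also have "\<dots> = (\<Sum>x\<in>A. \<Sum>\<^sub>\<infinity>y\<in>-A. qe x y * (occ (insert y (A - {x})) \<eta> - occ A \<eta>))"
  proof (rule infsum_finite_Times(2)[OF A])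
    fix x
    have "\<bar>occ (insert y (A - {x})) \<eta> - occ A \<eta>\<bar> \<le> 2" for y
      by (auto simp: occ_def)
    from summable_on_subset[OF weighted_summable[OF qe_nonneg qe_summable this] subset_UNIV]
    show "(\<lambda>y. qe x y * (occ (insert y (A - {x})) \<eta> - occ A \<eta>)) summable_on -A" .
  qed
  also have "infsum F (D1 \<union> D2) = infsum F {(x, y). \<eta> x \<and> \<not> \<eta> y}"
  proof (rule infsum_cong_neutral)
    fix p assume "p \<in> {(x, y). \<eta> x \<and> \<not> \<eta> y} - (D1 \<union> D2)"
    then obtain x y where p: "p = (x, y)" "\<eta> x" "\<not> \<eta> y" "x \<in> A \<longleftrightarrow> y \<in> A"
      by (auto simp: D1_def D2_def)
    then have "occ A (exchange x y \<eta>) = occ A \<eta>" by (auto simp: occ_def exchange_def)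
    then show "F p = 0" by (simp add: F_def p)
  qed (auto simp: D1_def D2_def)
  finally show ?thesis by (simp add: F_def)
qed

lemma nve_operator_occ:
  assumes A: "finite A"
  shows "nve_operator qe qv \<beta> \<delta> (occ A) \<eta> = dual_op (\<lambda>B. occ B \<eta>) A"
proof -
  have "(\<Sum>\<^sub>\<infinity>y. dual_rate A x y * (occ (insert y (A - {x})) \<eta> - occ A \<eta>))
      = (\<Sum>\<^sub>\<infinity>y. qv x y * (occ (insert y (A - {x})) \<eta> - occ A \<eta>))
        + (\<Sum>\<^sub>\<infinity>y\<in>-A. qe x y * (occ (insert y (A - {x})) \<eta> - occ A \<eta>))" for x
  proof -
    have b: "\<bar>occ (insert y (A - {x})) \<eta> - occ A \<eta>\<bar> \<le> 2" for y by (auto simp: occ_def)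
    have e: "(\<lambda>y. if y \<in> A then 0 else qe x y) summable_on UNIV"
      by (rule summable_on_comparison_test[OF qe_summable[of x]]) (auto simp: qe_nonneg)
    have "(\<Sum>\<^sub>\<infinity>y\<in>-A. qe x y * (occ (insert y (A - {x})) \<eta> - occ A \<eta>))
      = (\<Sum>\<^sub>\<infinity>y. (if y \<in> A then 0 else qe x y) * (occ (insert y (A - {x})) \<eta> - occ A \<eta>))"
      by (rule infsum_cong_neutral) auto
    moreover have "(\<Sum>\<^sub>\<infinity>y. qv x y * (occ (insert y (A - {x})) \<eta> - occ A \<eta>)
          + (if y \<in> A then 0 else qe x y) * (occ (insert y (A - {x})) \<eta> - occ A \<eta>))
        = (\<Sum>\<^sub>\<infinity>y. qv x y * (occ (insert y (A - {x})) \<eta> - occ A \<eta>))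
        + (\<Sum>\<^sub>\<infinity>y. (if y \<in> A then 0 else qe x y) * (occ (insert y (A - {x})) \<eta> - occ A \<eta>))"
      by (intro infsum_add weighted_summable[OF _ _ b] qv_nonneg qv_summable e) (simp add: qe_nonneg)
    ultimately show ?thesis
      unfolding dual_rate_def distrib_right by simp
  qed
  then show ?thesis
    unfolding nve_operator_def exchange_part_occ[OF A] flip_part_occ[OF A] dual_op_def dual_term_def
    by (simp add: sum.distrib[symmetric] algebra_simps)
qed

end

section \<open>Short time expansions of Feller semigroups\<close>

locale feller =
  fixes K :: "'a::countable transition"
  assumes feller: "feller_process K"
begin

definition S :: "real \<Rightarrow> ('a config \<Rightarrow> real) \<Rightarrow> 'a config \<Rightarrow> real" where
  "S t f \<eta> = (\<integral>\<zeta>. f \<zeta> \<partial>K t \<eta>)"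

lemma kernel: "t \<ge> 0 \<Longrightarrow> K t \<in> borel \<rightarrow>\<^sub>M prob_algebra borel"
  using feller by (simp add: feller_process_def)

lemma prob_kernel: "t \<ge> 0 \<Longrightarrow> prob_space (K t \<eta>)"
  and sets_kernel_borel: "t \<ge> 0 \<Longrightarrow> sets (K t \<eta>) = sets borel"
  using measurable_space[OF kernel, of t \<eta>] by (auto simp: space_prob_algebra)

lemma integrable_kernel: "t \<ge> 0 \<Longrightarrow> continuous_on UNIV f \<Longrightarrow> integrable (K t \<eta>) f"
  for f :: "'a config \<Rightarrow> real"
  using prob_kernel[of t \<eta>] sets_kernel_borel[of t \<eta>]
  by (intro integrable_continuous) (auto simp: prob_space.finite_measure)

lemma S_continuous:
  assumes "t \<ge> 0" "continuous_on UNIV f"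
  shows "continuous_on UNIV (S t f)"
proof -
  have "continuous_on UNIV (\<lambda>\<eta>. \<integral>\<zeta>. apply_bcontfun (Bcontfun f) \<zeta> \<partial>K t \<eta>)"
    using feller assms(1) unfolding feller_process_def by blast
  then show ?thesis unfolding S_def continuous_apply_Bcontfun[OF assms(2)] .
qed

lemma S_diff:
  assumes "t \<ge> 0" "continuous_on UNIV f" "continuous_on UNIV g"
  shows "S t (\<lambda>\<eta>. f \<eta> - g \<eta>) \<eta> = S t f \<eta> - S t g \<eta>"
  unfolding S_def by (intro Bochner_Integration.integral_diff integrable_kernel assms)

lemma S_cmult: "S t (\<lambda>\<eta>. c * f \<eta>) \<eta> = c * S t f \<eta>"
  unfolding S_def by simp

lemma S_const: "t \<ge> 0 \<Longrightarrow> S t (\<lambda>_. c) \<eta> = c"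
  unfolding S_def using prob_space.prob_space[OF prob_kernel] by (simp add: prob_space.prob_space prob_kernel)

lemma S_mono:
  assumes "t \<ge> 0" "continuous_on UNIV f" "continuous_on UNIV g" "\<And>\<eta>. f \<eta> \<le> g \<eta>"
  shows "S t f \<eta> \<le> S t g \<eta>"
  unfolding S_def by (intro integral_mono integrable_kernel assms)

lemma S_bound:
  assumes "t \<ge> 0" "continuous_on UNIV f" "\<And>\<eta>. \<bar>f \<eta>\<bar> \<le> c"
  shows "\<bar>S t f \<eta>\<bar> \<le> c"
proof -
  have "f \<zeta> \<le> c \<and> - c \<le> f \<zeta>" for \<zeta> using assms(3)[of \<zeta>] by linarith
  then have "S t f \<eta> \<le> S t (\<lambda>_. c) \<eta>" "S t (\<lambda>_. - c) \<eta> \<le> S t f \<eta>"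
    by (intro S_mono assms continuous_on_const; simp)+
  then show ?thesis using assms(1) by (simp add: S_const)
qed

lemma S_zero: "continuous_on UNIV f \<Longrightarrow> S 0 f \<eta> = f \<eta>"
proof -
  assume f: "continuous_on UNIV f"
  have "K 0 \<eta> = return borel \<eta>" using feller by (simp add: feller_process_def)
  then show ?thesis
    unfolding S_def using borel_measurable_continuous_onI[OF f] by (simp add: integral_return)
qed

text \<open>
  Integrals against the law at time \<open>t\<close> are integrals of \<open>S t f\<close> against the initial law; the
  semigroup property and the statements about invariant measures all come from this.
\<close>

lemma integral_bind_kernel:
  fixes f :: "'a config \<Rightarrow> real"
  assumes t: "t \<ge> 0" and f: "continuous_on UNIV f"
    and M: "prob_space M" "sets M = sets borel"
  shows "(\<integral>\<zeta>. f \<zeta> \<partial>(M \<bind> K t)) = (\<integral>\<eta>. S t f \<eta> \<partial>M)"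
proof -
  obtain B where B: "\<And>\<eta>. \<bar>f \<eta>\<bar> \<le> B" using continuous_bounded[OF f] by blast
  have m: "K t \<in> M \<rightarrow>\<^sub>M subprob_algebra borel"
    using measurable_prob_algebraD[OF kernel[OF t]] M(2) by (simp cong: measurable_cong_sets)
  show ?thesis unfolding S_def
  proof (rule integral_bind[OF borel_measurable_continuous_onI[OF f] B m])
    show "finite_measure M" using M(1) by (rule prob_space.finite_measure)
    show "AE x in M. emeasure (K t x) (space (K t x)) \<le> ennreal 1"
      using prob_space.emeasure_space_1[OF prob_kernel[OF t]] by simp
  qed
qed

lemma S_add:
  assumes "s \<ge> 0" "t \<ge> 0" "continuous_on UNIV f"
  shows "S (s + t) f \<eta> = S s (S t f) \<eta>"
proof -
  have "K (s + t) \<eta> = K s \<eta> \<bind> K t"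
    using feller assms(1,2) unfolding feller_process_def by blast
  then show ?thesis
    using integral_bind_kernel[OF assms(2,3) prob_kernel[OF assms(1)] sets_kernel_borel[OF assms(1)]]
    by (simp add: S_def)
qed

lemma generatorD:
  assumes "(F, G) \<in> generator K" "\<epsilon> > 0"
  obtains r where "r > 0"
    "\<And>t \<eta>. 0 < t \<Longrightarrow> t < r \<Longrightarrow>
       \<bar>S t (apply_bcontfun F) \<eta> - apply_bcontfun F \<eta> - t * apply_bcontfun G \<eta>\<bar> \<le> \<epsilon> * t"
proof -
  have "((\<lambda>t. (feller_semigroup K t F - F) /\<^sub>R t) \<longlongrightarrow> G) (at_right 0)"
    using assms(1) by (simp add: generator_def)
  then have "\<forall>\<^sub>F t in at_right 0. dist ((feller_semigroup K t F - F) /\<^sub>R t) G < \<epsilon>"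
    using assms(2) by (rule tendstoD)
  then obtain r where r: "r > 0" "\<And>t. 0 < t \<Longrightarrow> t < r \<Longrightarrow> dist ((feller_semigroup K t F - F) /\<^sub>R t) G < \<epsilon>"
    by (auto simp: eventually_at_right_field)
  show thesis
  proof (rule that[OF r(1)])
    fix t \<eta> assume t: "0 < t" "t < (r::real)"
    let ?f = "apply_bcontfun F" and ?g = "apply_bcontfun G"
    have f: "continuous_on UNIV ?f"
      using apply_bcontfun[of F] by (simp add: bcontfun_def)
    have "apply_bcontfun (feller_semigroup K t F) \<eta> = S t ?f \<eta>"
      using continuous_apply_Bcontfun[OF S_continuous[OF _ f], of t] t
      by (simp add: feller_semigroup_def S_def[abs_def])
    moreover have "dist (apply_bcontfun ((feller_semigroup K t F - F) /\<^sub>R t) \<eta>) (?g \<eta>) < \<epsilon>"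
      using r(2)[OF t] dist_bounded[of "(feller_semigroup K t F - F) /\<^sub>R t" \<eta> G] by linarith
    ultimately have "\<bar>(S t ?f \<eta> - ?f \<eta>) / t - ?g \<eta>\<bar> < \<epsilon>"
      by (simp add: dist_real_def scaleR_bcontfun.rep_eq minus_bcontfun.rep_eq divide_inverse mult.commute)
    moreover have "(S t ?f \<eta> - ?f \<eta>) / t - ?g \<eta> = (S t ?f \<eta> - ?f \<eta> - t * ?g \<eta>) / t"
      using t by (simp add: field_simps)
    ultimately show "\<bar>S t ?f \<eta> - ?f \<eta> - t * ?g \<eta>\<bar> \<le> \<epsilon> * t"
      using t by (simp add: field_simps)
  qed
qed

text \<open>
  Cut \<open>[0, h]\<close> into \<open>N\<close> pieces of length \<open>\<tau>\<close> so small that the definition of the generator applies with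
  error \<open>\<epsilon> * \<tau>\<close>.  The increments \<open>S (n * \<tau>) (S \<tau> f - f)\<close> sum up to \<open>S h f - f\<close>, and each is close to
  \<open>\<tau> * k\<close>.  The function \<open>k\<close> is chosen as \<open>0\<close> for a first order and as \<open>G\<close> for a second order estimate.
\<close>

lemma generator_increment:
  assumes FG: "(F, G) \<in> generator K" and h: "h > 0"
    and D: "\<And>s \<eta>. 0 \<le> s \<Longrightarrow> s \<le> h \<Longrightarrow> \<bar>S s (apply_bcontfun G) \<eta> - k \<eta>\<bar> \<le> D"
  shows "\<bar>S h (apply_bcontfun F) \<eta> - apply_bcontfun F \<eta> - h * k \<eta>\<bar> \<le> h * D"
proof (rule field_le_epsilon)
  fix e :: real assume "e > 0"
  define \<epsilon> where "\<epsilon> = e / h"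
  have \<epsilon>: "\<epsilon> > 0" using \<open>e > 0\<close> h by (simp add: \<epsilon>_def)
  let ?f = "apply_bcontfun F" and ?g = "apply_bcontfun G"
  have f: "continuous_on UNIV ?f" and g: "continuous_on UNIV ?g"
    using apply_bcontfun[of F] apply_bcontfun[of G] by (auto simp: bcontfun_def)
  obtain r where r: "r > 0" "\<And>t \<eta>. 0 < t \<Longrightarrow> t < r \<Longrightarrow> \<bar>S t ?f \<eta> - ?f \<eta> - t * ?g \<eta>\<bar> \<le> \<epsilon> * t"
    using generatorD[OF FG \<epsilon>] by blast
  obtain N :: nat where N: "h / r < N" using reals_Archimedean2 by blast
  then have N0: "real N > 0" using r h by (smt (verit) divide_nonneg_nonneg)
  define \<tau> where "\<tau> = h / N"
  have \<tau>: "0 < \<tau>" "\<tau> < r" "N * \<tau> = h" using N N0 h r by (auto simp: \<tau>_def field_simps)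
  have "\<bar>S (n * \<tau>) ?f \<eta> - ?f \<eta> - n * \<tau> * k \<eta>\<bar> \<le> n * \<tau> * (\<epsilon> + D)" if "n \<le> N" for n
    using that
  proof (induction n)
    case 0
    then show ?case by (simp add: S_zero f)
  next
    case (Suc n)
    define s where "s = n * \<tau>"
    have s: "0 \<le> s" "s \<le> h" "Suc n * \<tau> = s + \<tau>"
      using \<tau> Suc.prems mult_right_mono[of "real n" "real N" \<tau>] by (auto simp: s_def algebra_simps)
    have c: "continuous_on UNIV (\<lambda>\<zeta>. S \<tau> ?f \<zeta> - ?f \<zeta>)" "continuous_on UNIV (\<lambda>\<zeta>. \<tau> * ?g \<zeta>)"
      using \<tau> by (auto intro!: continuous_intros S_continuous f g)
    have "S (s + \<tau>) ?f \<eta> - S s ?f \<eta> - \<tau> * S s ?g \<eta>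
        = S s (\<lambda>\<zeta>. (S \<tau> ?f \<zeta> - ?f \<zeta>) - \<tau> * ?g \<zeta>) \<eta>"
      using s \<tau> by (simp add: S_diff[OF _ c] S_diff S_continuous S_cmult f g S_add)
    moreover have "\<bar>S s (\<lambda>\<zeta>. (S \<tau> ?f \<zeta> - ?f \<zeta>) - \<tau> * ?g \<zeta>) \<eta>\<bar> \<le> \<epsilon> * \<tau>"
      by (rule S_bound[OF s(1) continuous_on_diff[OF c] r(2)[OF \<tau>(1,2)]])
    moreover have "\<bar>\<tau> * S s ?g \<eta> - \<tau> * k \<eta>\<bar> \<le> \<tau> * D"
      using mult_left_mono[OF D[OF s(1,2), of \<eta>], of \<tau>] \<tau>(1)
      by (simp add: abs_mult flip: right_diff_distrib)
    moreover have "\<bar>S s ?f \<eta> - ?f \<eta> - s * k \<eta>\<bar> \<le> s * (\<epsilon> + D)"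
      using Suc unfolding s_def by simp
    ultimately have "\<bar>S (s + \<tau>) ?f \<eta> - ?f \<eta> - (s + \<tau>) * k \<eta>\<bar> \<le> (s + \<tau>) * (\<epsilon> + D)"
      unfolding distrib_left distrib_right by (simp add: abs_le_iff algebra_simps)
    then show ?case unfolding s(3) .
  qed
  from this[of N] have "\<bar>S h ?f \<eta> - ?f \<eta> - h * k \<eta>\<bar> \<le> h * (\<epsilon> + D)"
    using \<tau>(3) by simp
  then show "\<bar>S h ?f \<eta> - ?f \<eta> - h * k \<eta>\<bar> \<le> h * D + e"
    using h by (simp add: \<epsilon>_def algebra_simps)
qed

end

section \<open>Moments and the gap between the extreme initial states\<close>

context nve_rates begin

lemma uniform_limit_jumps:
  assumes "\<And>y B. \<bar>\<phi> y B\<bar> \<le> c"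
  shows "uniform_limit UNIV (\<lambda>F \<zeta>. \<Sum>y\<in>F. dual_rate A x y * \<phi> y \<zeta>)
    (\<lambda>\<zeta>. \<Sum>\<^sub>\<infinity>y. dual_rate A x y * \<phi> y \<zeta>) (finite_subsets_at_top UNIV)"
proof (rule Weierstrass_m_test_general)
  show "norm (dual_rate A x y * \<phi> y \<zeta>) \<le> c * dual_rate A x y" for y \<zeta>
    using mult_right_mono[OF assms[of y \<zeta>] dual_rate_nonneg[of A x y]] dual_rate_nonneg[of A x y]
    by (simp add: abs_mult mult.commute)
  show "(\<lambda>y. c * dual_rate A x y) summable_on UNIV"
    by (intro summable_on_cmult_right dual_rate_summable)
qed

lemma occ_jump_le: "\<bar>occ (insert y (A - {x})) \<zeta> - occ A \<zeta>\<bar> \<le> 1"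
  by (auto simp: occ_def)

lemma continuous_jump_sum:
  assumes A: "finite A"
  shows "continuous_on UNIV (\<lambda>\<zeta>. \<Sum>\<^sub>\<infinity>y. dual_rate A x y * (occ (insert y (A - {x})) \<zeta> - occ A \<zeta>))"
  by (rule uniform_limit_theorem[OF _ uniform_limit_jumps[OF occ_jump_le]])
    (use A in \<open>auto intro!: always_eventually continuous_intros continuous_occ\<close>)

lemma continuous_dual_op_occ:
  assumes A: "finite A"
  shows "continuous_on UNIV (\<lambda>\<eta>. dual_op (\<lambda>B. occ B \<eta>) A)"
  unfolding dual_op_def dual_term_def using A
  by (intro continuous_intros continuous_jump_sum continuous_occ) auto

text \<open>
  This interchange of the expectation with the sum over the jumps closes the moment equations.
  The finite partial sums converge uniformly in the configuration, so their integrals converge.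
\<close>

lemma integral_dual_op_occ:
  assumes A: "finite A" and M: "prob_space M" "sets M = sets borel"
  shows "(\<integral>\<zeta>. dual_op (\<lambda>B. occ B \<zeta>) A \<partial>M) = dual_op (\<lambda>B. \<integral>\<zeta>. occ B \<zeta> \<partial>M) A"
proof -
  interpret prob_space M by fact
  have int: "integrable M f" if "continuous_on UNIV f" for f :: "'a config \<Rightarrow> real"
    by (rule integrable_continuous[OF finite_measure_axioms M(2) that])
  have jump: "(\<integral>\<zeta>. (\<Sum>\<^sub>\<infinity>y. dual_rate A x y * (occ (insert y (A - {x})) \<zeta> - occ A \<zeta>)) \<partial>M)
      = (\<Sum>\<^sub>\<infinity>y. dual_rate A x y * ((\<integral>\<zeta>. occ (insert y (A - {x})) \<zeta> \<partial>M) - (\<integral>\<zeta>. occ A \<zeta> \<partial>M)))"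
    (is "?l = ?r") for x
  proof -
    let ?g = "\<lambda>F \<zeta>. \<Sum>y\<in>F. dual_rate A x y * (occ (insert y (A - {x})) \<zeta> - occ A \<zeta>)"
    let ?G = "\<lambda>\<zeta>. \<Sum>\<^sub>\<infinity>y. dual_rate A x y * (occ (insert y (A - {x})) \<zeta> - occ A \<zeta>)"
    have ul: "uniform_limit UNIV ?g ?G (finite_subsets_at_top UNIV)"
      by (rule uniform_limit_jumps[OF occ_jump_le])
    have cg: "continuous_on UNIV (?g F)" for F
      using A by (intro continuous_intros continuous_occ) auto
    have "((\<lambda>F. \<integral>\<zeta>. ?g F \<zeta> \<partial>M) \<longlongrightarrow> ?l) (finite_subsets_at_top UNIV)"
    proof (rule tendstoI)
      fix e :: real assume "e > 0"
      then have "\<forall>\<^sub>F F in finite_subsets_at_top UNIV. \<forall>\<zeta>\<in>UNIV. dist (?g F \<zeta>) (?G \<zeta>) < e / 2"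
        using ul by (intro uniform_limitD) auto
      then show "\<forall>\<^sub>F F in finite_subsets_at_top UNIV. dist (\<integral>\<zeta>. ?g F \<zeta> \<partial>M) ?l < e"
      proof eventually_elim
        case (elim F)
        have eq: "(\<integral>\<zeta>. ?g F \<zeta> \<partial>M) - ?l = (\<integral>\<zeta>. ?g F \<zeta> - ?G \<zeta> \<partial>M)"
          by (rule Bochner_Integration.integral_diff[symmetric]) (intro int cg continuous_jump_sum A)+
        have "norm (\<integral>\<zeta>. ?g F \<zeta> - ?G \<zeta> \<partial>M) \<le> (\<integral>\<zeta>. norm (?g F \<zeta> - ?G \<zeta>) \<partial>M)"
          by (rule integral_norm_bound)
        also have "\<dots> \<le> (\<integral>\<zeta>. e / 2 \<partial>M)"
        proof (rule integral_mono)
          show "integrable M (\<lambda>\<zeta>. norm (?g F \<zeta> - ?G \<zeta>))"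
            by (rule int, rule continuous_on_norm, rule continuous_on_diff[OF cg continuous_jump_sum[OF A]])
          show "norm (?g F \<zeta> - ?G \<zeta>) \<le> e / 2" for \<zeta>
            using less_imp_le[OF bspec[OF elim UNIV_I, of \<zeta>]] unfolding dist_norm .
        qed simp
        also have "(\<integral>\<zeta>. e / 2 \<partial>M) = e / 2" by (simp add: prob_space)
        finally show ?case using \<open>e > 0\<close> unfolding dist_norm eq by linarith
      qed
    qed
    also have "(\<lambda>F. \<integral>\<zeta>. ?g F \<zeta> \<partial>M) = (\<lambda>F. \<Sum>y\<in>F. dual_rate A x y
        * ((\<integral>\<zeta>. occ (insert y (A - {x})) \<zeta> \<partial>M) - (\<integral>\<zeta>. occ A \<zeta> \<partial>M)))"
      using A by (intro ext, subst Bochner_Integration.integral_sum)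
        (auto intro!: int continuous_intros continuous_occ sum.cong Bochner_Integration.integral_diff)
    finally show ?thesis
      by (intro infsumI[symmetric]) (simp add: has_sum_def)
  qed
  have o: "integrable M (occ B)" if "finite B" for B by (intro int continuous_occ that)
  have "(\<integral>\<zeta>. dual_term (\<lambda>B. occ B \<zeta>) A x \<partial>M) = dual_term (\<lambda>B. \<integral>\<zeta>. occ B \<zeta> \<partial>M) A x"
    if x: "x \<in> A" for x
    unfolding dual_term_def jump[symmetric] using A
    by (subst Bochner_Integration.integral_add Bochner_Integration.integral_diff,
        (intro int continuous_intros continuous_occ continuous_jump_sum; simp)+)+ (simp add: o)
  moreover have "integrable M (\<lambda>\<zeta>. dual_term (\<lambda>B. occ B \<zeta>) A x)" for x
    unfolding dual_term_def using A
    by (intro int continuous_intros continuous_occ continuous_jump_sum) auto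
  ultimately show ?thesis
    unfolding dual_op_def by (subst Bochner_Integration.integral_sum) auto
qed

text \<open>
  The negative part of \<open>v\<close> does not grow by Euler steps of the dual operator
  (\<open>dual_step_positive\<close>), so after \<open>N\<close> steps of length \<open>T / N\<close> only the accumulated error
  \<open>N * C * (T / N)\<^sup>2\<close> remains, which vanishes as \<open>N\<close> grows.
\<close>

lemma comparison:
  assumes bdd: "\<And>t. 0 \<le> t \<Longrightarrow> bounded_upto n c (v t)"
    and step: "\<And>t h A. 0 \<le> t \<Longrightarrow> 0 < h \<Longrightarrow> finite A \<Longrightarrow> card A \<le> n \<Longrightarrow>
      v t A + h * dual_op (v t) A - C * h\<^sup>2 \<le> v (t + h) A"
    and init: "\<And>A. finite A \<Longrightarrow> card A \<le> n \<Longrightarrow> 0 \<le> v 0 A"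
    and C: "0 \<le> C" and T: "0 \<le> T" and A: "finite A" "card A \<le> n"
  shows "0 \<le> v T A"
proof (cases "T = 0")
  case True
  then show ?thesis using init A by simp
next
  case False
  with T have T: "0 < T" by simp
  have bound: "- (C * T\<^sup>2 / N) \<le> v T A" if N: "T * (n * rate_bound) \<le> N" "0 < N" for N :: nat
  proof -
    define h where "h = T / N"
    have h: "0 < h" "h * (n * rate_bound) \<le> 1" "N * h = T"
      using N T by (auto simp: h_def field_simps)
    have "- (k * (C * h\<^sup>2)) \<le> v (k * h) B" if "finite B" "card B \<le> n" for k :: nat and B
      using that
    proof (induction k arbitrary: B)
      case 0
      then show ?case using init by simp
    next
      case (Suc k)
      have "- (k * (C * h\<^sup>2)) \<le> v (k * h) B + h * dual_op (v (k * h)) B"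
        by (rule dual_step_positive[OF bdd Suc.prems Suc.IH])
          (use h C in auto)
      moreover have "v (k * h) B + h * dual_op (v (k * h)) B - C * h\<^sup>2 \<le> v (k * h + h) B"
        using h Suc.prems by (intro step) auto
      ultimately show ?case by (simp add: algebra_simps)
    qed
    from this[OF A, of N] show ?thesis
      using h N by (simp add: h_def power2_eq_square)
  qed
  have "(\<lambda>N. - (C * T\<^sup>2 / real N)) \<longlonglongrightarrow> - 0"
    by (intro tendsto_minus lim_const_over_n)
  moreover have "\<forall>\<^sub>F N in sequentially. - (C * T\<^sup>2 / real N) \<le> v T A"
  proof -
    obtain M :: nat where "T * (n * rate_bound) < M" using reals_Archimedean2 by blast
    then show ?thesis
      by (intro eventually_sequentiallyI[of "Suc M"] bound) auto
  qed
  ultimately show ?thesis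
    using tendsto_upperbound[of "\<lambda>N. - (C * T\<^sup>2 / real N)" "- 0" sequentially "v T A"] by simp
qed

end

locale nve = nve_rates qe qv \<beta> \<delta> + feller K
  for qe qv :: "'a::countable \<Rightarrow> 'a \<Rightarrow> real" and \<beta> \<delta> :: "'a \<Rightarrow> real" and K :: "'a transition" +
  assumes generator_eq: "generator K = closure (nve_pregenerator qe qv \<beta> \<delta>)"
begin

lemma occ_generator:
  assumes A: "finite A"
  shows "(Bcontfun (occ A), Bcontfun (\<lambda>\<eta>. dual_op (\<lambda>B. occ B \<eta>) A)) \<in> generator K"
proof -
  have "finitely_dependent (occ A)"
    unfolding finitely_dependent_def using A by (intro exI[of _ A]) (auto simp: occ_def)
  then have "(Bcontfun (occ A), Bcontfun (\<lambda>\<eta>. dual_op (\<lambda>B. occ B \<eta>) A)) \<in> nve_pregenerator qe qv \<beta> \<delta>"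
    using A by (simp add: nve_pregenerator_def continuous_apply_Bcontfun continuous_occ
        continuous_dual_op_occ nve_operator_occ)
  then show ?thesis using closure_subset generator_eq by auto
qed

definition moment :: "real \<Rightarrow> 'a config \<Rightarrow> 'a set \<Rightarrow> real" where
  "moment t \<eta> A = S t (occ A) \<eta>"

lemma moment_nonneg: "0 \<le> t \<Longrightarrow> finite A \<Longrightarrow> 0 \<le> moment t \<eta> A"
  using S_mono[of t "\<lambda>_. 0" "occ A" \<eta>] by (simp add: moment_def continuous_occ occ_bounds S_const)

lemma moment_le_1: "0 \<le> t \<Longrightarrow> finite A \<Longrightarrow> moment t \<eta> A \<le> 1"
  using S_mono[of t "occ A" "\<lambda>_. 1" \<eta>] by (simp add: moment_def continuous_occ occ_bounds S_const)

lemma moment_bounded: "0 \<le> t \<Longrightarrow> bounded_upto n 1 (moment t \<eta>)"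
  using moment_nonneg moment_le_1 by (force simp: bounded_upto_def abs_le_iff)

lemma moment_zero: "finite A \<Longrightarrow> moment 0 \<eta> A = occ A \<eta>"
  by (simp add: moment_def S_zero continuous_occ)

lemma moment_empty: "0 \<le> t \<Longrightarrow> moment t \<eta> {} = 1"
  by (simp add: moment_def occ_def[abs_def] S_const)

lemma S_dual_op_occ:
  assumes "finite A" "0 \<le> t"
  shows "S t (\<lambda>\<zeta>. dual_op (\<lambda>B. occ B \<zeta>) A) \<eta> = dual_op (moment t \<eta>) A"
  unfolding S_def moment_def
  by (rule integral_dual_op_occ[OF assms(1) prob_kernel[OF assms(2)] sets_kernel_borel[OF assms(2)]])

lemma moment_first_order:
  assumes A: "finite A" "card A \<le> n" and s: "0 \<le> s"
  shows "\<bar>moment s \<eta> A - occ A \<eta>\<bar> \<le> s * (n * (2 * rate_bound))"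
proof (cases "s = 0")
  case True
  then show ?thesis using A by (simp add: moment_zero)
next
  case False
  have "\<bar>S s (apply_bcontfun (Bcontfun (occ A))) \<eta> - apply_bcontfun (Bcontfun (occ A)) \<eta> - s * (\<lambda>_. 0) \<eta>\<bar>
      \<le> s * (n * (2 * rate_bound * 1))"
  proof (rule generator_increment[OF occ_generator[OF A(1)]])
    fix r \<zeta> assume "0 \<le> (r::real)"
    then show "\<bar>S r (apply_bcontfun (Bcontfun (\<lambda>\<eta>. dual_op (\<lambda>B. occ B \<eta>) A))) \<zeta> - 0\<bar>
        \<le> n * (2 * rate_bound * 1)"
      using A dual_op_bound[OF moment_bounded A]
      by (simp add: continuous_apply_Bcontfun continuous_dual_op_occ S_dual_op_occ)
  qed (use s False in simp)
  then show ?thesis using A by (simp add: continuous_apply_Bcontfun continuous_occ moment_def)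
qed

text \<open>
  A single second order expansion of \<open>occ A\<close> would not be uniform in \<open>A\<close>.  Since the generator maps
  \<open>occ A\<close> to products with at most \<open>n\<close> factors, \<open>moment_first_order\<close> bounds how much \<open>dual_op\<close> of the
  moments moves up to time \<open>h\<close>, with a constant that depends on \<open>n\<close> only.
\<close>

lemma moment_second_order:
  assumes A: "finite A" "card A \<le> n" and h: "0 < h"
  shows "\<bar>moment h \<eta> A - occ A \<eta> - h * dual_op (\<lambda>B. occ B \<eta>) A\<bar> \<le> (n * (2 * rate_bound))\<^sup>2 * h\<^sup>2"
proof -
  define c where "c = n * (2 * rate_bound)"
  have c: "0 \<le> c" using rate_bound_nonneg by (simp add: c_def)
  let ?F = "Bcontfun (occ A)" and ?G = "Bcontfun (\<lambda>\<eta>. dual_op (\<lambda>B. occ B \<eta>) A)"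
  have "\<bar>S h (apply_bcontfun ?F) \<eta> - apply_bcontfun ?F \<eta> - h * (\<lambda>\<zeta>. dual_op (\<lambda>B. occ B \<zeta>) A) \<eta>\<bar>
      \<le> h * (n * (2 * rate_bound * (h * c)))"
  proof (rule generator_increment[OF occ_generator[OF A(1)] h])
    fix s \<zeta> assume s: "0 \<le> (s::real)" "s \<le> h"
    have "bounded_upto n (h * c) (\<lambda>B. moment s \<zeta> B - occ B \<zeta>)"
      unfolding bounded_upto_def
    proof (intro allI impI)
      fix B :: "'a set" assume "finite B" "card B \<le> n"
      then have "\<bar>moment s \<zeta> B - occ B \<zeta>\<bar> \<le> s * c"
        unfolding c_def by (rule moment_first_order[OF _ _ s(1)])
      also have "\<dots> \<le> h * c" by (rule mult_right_mono[OF s(2) c])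
      finally show "\<bar>moment s \<zeta> B - occ B \<zeta>\<bar> \<le> h * c" .
    qed
    from dual_op_bound[OF this A]
    have "\<bar>dual_op (moment s \<zeta>) A - dual_op (\<lambda>B. occ B \<zeta>) A\<bar> \<le> n * (2 * rate_bound * (h * c))"
      by (subst (asm) dual_op_diff[OF moment_bounded[OF s(1)] occ_jump_bounded A])
    then show "\<bar>S s (apply_bcontfun ?G) \<zeta> - dual_op (\<lambda>B. occ B \<zeta>) A\<bar>
        \<le> n * (2 * rate_bound * (h * c))"
      using A s by (simp add: continuous_apply_Bcontfun continuous_dual_op_occ S_dual_op_occ)
  qed
  also have "h * (n * (2 * rate_bound * (h * c))) = c\<^sup>2 * h\<^sup>2"
    by (simp add: c_def power2_eq_square)
  finally show ?thesis
    using A by (simp add: continuous_apply_Bcontfun continuous_occ moment_def c_def)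
qed

lemma moment_step:
  assumes A: "finite A" "card A \<le> n" and t: "0 \<le> t" and h: "0 < h"
  shows "\<bar>moment (t + h) \<eta> A - moment t \<eta> A - h * dual_op (moment t \<eta>) A\<bar>
    \<le> (n * (2 * rate_bound))\<^sup>2 * h\<^sup>2"
proof -
  let ?d = "\<lambda>\<zeta>. dual_op (\<lambda>B. occ B \<zeta>) A"
  have c: "continuous_on UNIV (\<lambda>\<zeta>. S h (occ A) \<zeta>)" "continuous_on UNIV (occ A)"
    "continuous_on UNIV (\<lambda>\<zeta>. h * ?d \<zeta>)"
    using A h by (auto intro!: continuous_intros S_continuous continuous_occ continuous_dual_op_occ)
  have c2: "continuous_on UNIV (\<lambda>\<zeta>. S h (occ A) \<zeta> - occ A \<zeta>)" by (intro continuous_on_diff c)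
  have "moment (t + h) \<eta> A - moment t \<eta> A - h * dual_op (moment t \<eta>) A
      = S t (\<lambda>\<zeta>. (S h (occ A) \<zeta> - occ A \<zeta>) - h * ?d \<zeta>) \<eta>"
    unfolding S_diff[OF t c2 c(3)] S_diff[OF t c(1,2)] S_cmult
    unfolding S_dual_op_occ[OF A(1) t] using t h A by (simp add: moment_def S_add continuous_occ)
  also have "\<bar>\<dots>\<bar> \<le> (n * (2 * rate_bound))\<^sup>2 * h\<^sup>2"
  proof (rule S_bound[OF t])
    show "continuous_on UNIV (\<lambda>\<zeta>. (S h (occ A) \<zeta> - occ A \<zeta>) - h * ?d \<zeta>)"
      by (intro continuous_on_diff c c2)
    show "\<bar>S h (occ A) \<zeta> - occ A \<zeta> - h * ?d \<zeta>\<bar> \<le> (n * (2 * rate_bound))\<^sup>2 * h\<^sup>2" for \<zeta>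
      using moment_second_order[OF A h] by (simp add: moment_def)
  qed
  finally show ?thesis .
qed

definition full :: "'a config" where "full = (\<lambda>_. True)"
definition vacant :: "'a config" where "vacant = (\<lambda>_. False)"

text \<open>
  In terms of the dual system: the probability that a particle started at \<open>x\<close> has neither
  disappeared nor been killed by time \<open>t\<close>.
\<close>

definition gap :: "real \<Rightarrow> 'a \<Rightarrow> real" where
  "gap t x = moment t full {x} - moment t vacant {x}"

lemma moment_diff_bounded: "0 \<le> t \<Longrightarrow> bounded_upto n 1 (\<lambda>A. moment t \<eta> A - moment t \<zeta> A)"
  using moment_nonneg moment_le_1 unfolding bounded_upto_def
  by (smt (verit))

lemma moment_diff_step:
  assumes A: "finite A" "card A \<le> n" and t: "0 \<le> t" and h: "0 < h"
  shows "\<bar>(moment (t + h) \<eta> A - moment (t + h) \<zeta> A) - (moment t \<eta> A - moment t \<zeta> A)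
      - h * dual_op (\<lambda>B. moment t \<eta> B - moment t \<zeta> B) A\<bar> \<le> 2 * (n * (2 * rate_bound))\<^sup>2 * h\<^sup>2"
  using moment_step[OF A t h, of \<eta>] moment_step[OF A t h, of \<zeta>]
  unfolding dual_op_diff[OF moment_bounded[OF t] moment_bounded[OF t] A]
  by (simp add: right_diff_distrib abs_le_iff)

lemma gap_nonneg: assumes t: "0 \<le> t" shows "0 \<le> gap t x"
proof -
  define v where "v = (\<lambda>t A. moment t full A - moment t vacant A)"
  have "0 \<le> v t {x}"
  proof (rule comparison[where v=v and n=1 and c=1 and C="2 * (1 * (2 * rate_bound))\<^sup>2"])
    show "v t A + h * dual_op (v t) A - 2 * (1 * (2 * rate_bound))\<^sup>2 * h\<^sup>2 \<le> v (t + h) A"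
      if "0 \<le> t" "0 < h" "finite A" "card A \<le> 1" for t h A
      using moment_diff_step[OF that(3,4,1,2), of full vacant] by (simp add: v_def abs_le_iff)
    show "0 \<le> v 0 A" if "finite A" "card A \<le> 1" for A
      using that by (auto simp: v_def moment_zero occ_def full_def vacant_def)
  qed (use t in \<open>auto simp: v_def intro: moment_diff_bounded\<close>)
  then show ?thesis by (simp add: v_def gap_def)
qed

lemma gap_le_1: "0 \<le> t \<Longrightarrow> gap t x \<le> 1"
  using moment_le_1[of t "{x}" full] moment_nonneg[of t "{x}" vacant] by (simp add: gap_def)

lemma gap_zero: "gap 0 x = 1"
  by (simp add: gap_def moment_zero occ_def full_def vacant_def)

lemma gap_step:
  assumes t: "0 \<le> t" and h: "0 < h"
  shows "\<bar>gap (t + h) x - gap t x - h * ((\<Sum>\<^sub>\<infinity>y. (qe x y + qv x y) * (gap t y - gap t x))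
    - (\<beta> x + \<delta> x) * gap t x)\<bar> \<le> 8 * rate_bound\<^sup>2 * h\<^sup>2"
proof -
  have "dual_op (\<lambda>B. moment t full B - moment t vacant B) {x}
      = (\<Sum>\<^sub>\<infinity>y. (qe x y + qv x y) * (gap t y - gap t x)) - (\<beta> x + \<delta> x) * gap t x"
    unfolding gap_def by (rule dual_op_singleton) (simp add: moment_empty t)
  then show ?thesis
    using moment_diff_step[of "{x}" 1, OF _ _ t h, of full vacant]
    by (simp add: gap_def power_mult_distrib)
qed

text \<open>
  Both sides are compared with Euler steps: the right hand side is a supersolution by
  \<open>dual_op_sum_le\<close>, the difference of the moments, with either sign, is a solution by
  \<open>moment_diff_step\<close>.  Initially the difference
  of two products is at most \<open>1\<close>, and for nonempty \<open>A\<close> the sum is \<open>card A\<close>.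
\<close>

lemma moment_diff_le_gap:
  assumes t: "0 \<le> t" and A: "finite A"
  shows "\<bar>moment t \<eta> A - moment t \<zeta> A\<bar> \<le> (\<Sum>x\<in>A. gap t x)"
proof -
  define n where "n = card A"
  \<comment> \<open>The errors of \<open>gap_step\<close> for each of at most \<open>n\<close> sites, and the error of \<open>moment_diff_step\<close>.\<close>
  define C where "C = n * (8 * rate_bound\<^sup>2) + 2 * (n * (2 * rate_bound))\<^sup>2"
  define v where "v \<eta> \<zeta> = (\<lambda>t A. (\<Sum>x\<in>A. gap t x) - (moment t \<eta> A - moment t \<zeta> A))" for \<eta> \<zeta>
  have "0 \<le> v \<eta> \<zeta> t A" for \<eta> \<zeta>
  proof (rule comparison[where v="v \<eta> \<zeta>" and n=n and c="n + 1" and C=C])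
    have sb: "bounded_upto n n (\<lambda>A. \<Sum>x\<in>A. gap t x)" if "0 \<le> t" for t
      unfolding bounded_upto_def
    proof (intro allI impI)
      fix B :: "'a set" assume "finite B" "card B \<le> n"
      have "(\<Sum>x\<in>B. gap t x) \<le> real (card B) * 1"
        by (rule sum_bounded_above) (rule gap_le_1[OF that])
      moreover have "0 \<le> (\<Sum>x\<in>B. gap t x)" by (intro sum_nonneg gap_nonneg that)
      ultimately show "\<bar>\<Sum>x\<in>B. gap t x\<bar> \<le> n" using \<open>card B \<le> n\<close> by simp
    qed
    show "bounded_upto n (n + 1) (v \<eta> \<zeta> t)"
      if "0 \<le> t" for t
      using sb[OF that] moment_diff_bounded[OF that, of n \<eta> \<zeta>] unfolding bounded_upto_def v_def
      by (smt (verit) of_nat_1 of_nat_add)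
    show "v \<eta> \<zeta> t B
      + h * dual_op (v \<eta> \<zeta> t) B - C * h\<^sup>2
      \<le> v \<eta> \<zeta> (t + h) B"
      if t: "0 \<le> t" and h: "0 < h" and B: "finite B" "card B \<le> n" for t h B
    proof -
      define L where "L x = (\<Sum>\<^sub>\<infinity>y. (qe x y + qv x y) * (gap t y - gap t x)) - (\<beta> x + \<delta> x) * gap t x" for x
      have "dual_op (\<lambda>A. \<Sum>x\<in>A. gap t x) B \<le> (\<Sum>x\<in>B. L x)"
        unfolding L_def by (rule dual_op_sum_le[OF gap_nonneg[OF t] gap_le_1[OF t] B(1)])
      then have 1: "h * dual_op (\<lambda>A. \<Sum>x\<in>A. gap t x) B \<le> h * (\<Sum>x\<in>B. L x)"
        using h by (intro mult_left_mono) auto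
      have "gap (t + h) x \<ge> gap t x + h * L x - 8 * rate_bound\<^sup>2 * h\<^sup>2" for x
        using gap_step[OF t h, of x] by (simp add: L_def abs_le_iff)
      then have "(\<Sum>x\<in>B. gap (t + h) x) \<ge> (\<Sum>x\<in>B. gap t x + h * L x - 8 * rate_bound\<^sup>2 * h\<^sup>2)"
        by (intro sum_mono) auto
      then have 2: "(\<Sum>x\<in>B. gap (t + h) x)
          \<ge> (\<Sum>x\<in>B. gap t x) + h * (\<Sum>x\<in>B. L x) - card B * (8 * rate_bound\<^sup>2 * h\<^sup>2)"
        by (simp add: sum_subtractf sum.distrib sum_distrib_left)
      have 3: "card B * (8 * rate_bound\<^sup>2 * h\<^sup>2) \<le> n * (8 * rate_bound\<^sup>2) * h\<^sup>2"
        using B mult_right_mono[of "real (card B)" "real n" "8 * rate_bound\<^sup>2 * h\<^sup>2"] by simp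
      have 4: "h * dual_op (\<lambda>A. (\<Sum>x\<in>A. gap t x) - (moment t \<eta> A - moment t \<zeta> A)) B
        = h * dual_op (\<lambda>A. \<Sum>x\<in>A. gap t x) B - h * dual_op (\<lambda>A. moment t \<eta> A - moment t \<zeta> A) B"
        unfolding dual_op_diff[OF sb[OF t] moment_diff_bounded[OF t] B] by (simp add: right_diff_distrib)
      have "(moment (t + h) \<eta> B - moment (t + h) \<zeta> B) \<le> (moment t \<eta> B - moment t \<zeta> B)
        + h * dual_op (\<lambda>A. moment t \<eta> A - moment t \<zeta> A) B + 2 * (n * (2 * rate_bound))\<^sup>2 * h\<^sup>2"
        using moment_diff_step[OF B t h, of \<eta> \<zeta>] by (simp add: abs_le_iff)
      then show ?thesis using 1 2 3 4 unfolding C_def distrib_right v_def by linarith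
    qed
    show "0 \<le> v \<eta> \<zeta> 0 B"
      if "finite B" "card B \<le> n" for B
    proof (cases "B = {}")
      case False
      then have "1 \<le> real (card B)" using that by (simp add: Suc_leI card_gt_0_iff)
      then show ?thesis
        using that occ_bounds[of B \<eta>] occ_bounds[of B \<zeta>] by (simp add: v_def gap_zero moment_zero)
    qed (simp add: v_def moment_zero occ_def)
  qed (use t A in \<open>auto simp: n_def C_def\<close>)
  from this[of \<eta> \<zeta>] this[of \<zeta> \<eta>] show ?thesis by (simp add: v_def abs_le_iff)
qed

end

section \<open>Laws on countable sets\<close>

text \<open>
  Discrete laws are represented as \<open>pmf\<close>, so that two of them are equal as soon as their point masses are.
\<close>

definition law :: "'w measure \<Rightarrow> ('w \<Rightarrow> 'b::countable) \<Rightarrow> 'b pmf" where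
  "law M f = Abs_pmf (distr M (count_space UNIV) f)"

lemma measure_pmf_law:
  fixes f :: "'w \<Rightarrow> 'b::countable"
  assumes "prob_space M" and f: "f \<in> M \<rightarrow>\<^sub>M count_space UNIV"
  shows "measure_pmf (law M f) = distr M (count_space UNIV) f"
proof -
  let ?D = "distr M (count_space UNIV) f"
  interpret D: prob_space ?D
    using assms by (rule prob_space.prob_space_distr)
  let ?N = "{x. measure ?D {x} = 0}"
  have "emeasure ?D ?N = (\<integral>\<^sup>+x. emeasure ?D {x} \<partial>count_space ?N)"
    by (rule emeasure_countable_singleton) auto
  also have "\<dots> = 0"
    by (subst nn_integral_0_iff_AE) (auto simp: AE_count_space D.emeasure_eq_measure)
  finally have "?N \<in> null_sets ?D" by auto
  then have "AE x in ?D. measure ?D {x} \<noteq> 0"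
    by (rule AE_I') auto
  then show ?thesis
    unfolding law_def by (intro Abs_pmf_inverse) (auto simp: D.prob_space_axioms)
qed

lemma pmf_law:
  fixes f :: "'w \<Rightarrow> 'b::countable"
  assumes "prob_space M" "f \<in> M \<rightarrow>\<^sub>M count_space UNIV"
  shows "pmf (law M f) z = measure M {\<omega> \<in> space M. f \<omega> = z}"
proof -
  have "pmf (law M f) z = measure (distr M (count_space UNIV) f) {z}"
    using measure_pmf_law[OF assms] by (simp add: measure_pmf_single[symmetric])
  also have "\<dots> = measure M (f -` {z} \<inter> space M)"
    using assms by (intro measure_distr) auto
  also have "f -` {z} \<inter> space M = {\<omega> \<in> space M. f \<omega> = z}" by auto
  finally show ?thesis .
qed

lemma expectation_law:
  fixes f :: "'w \<Rightarrow> 'b::countable" and g :: "'b \<Rightarrow> real"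
  assumes "prob_space M" "f \<in> M \<rightarrow>\<^sub>M count_space UNIV"
  shows "measure_pmf.expectation (law M f) g = (\<integral>\<omega>. g (f \<omega>) \<partial>M)"
  unfolding measure_pmf_law[OF assms] using assms by (intro integral_distr) auto

lemma integrable_pmf_bounded:
  fixes g :: "'b \<Rightarrow> real"
  assumes "\<And>y. \<bar>g y\<bar> \<le> B"
  shows "integrable (measure_pmf p) g"
  by (rule measure_pmf.integrable_const_bound[where B=B]) (use assms in auto)

lemma expectation_bound:
  fixes g :: "'b \<Rightarrow> real"
  assumes "\<And>y. \<bar>g y\<bar> \<le> B"
  shows "\<bar>measure_pmf.expectation p g\<bar> \<le> B"
proof -
  have g: "g y \<le> B" "- B \<le> g y" for y using assms[of y] by linarith+
  have "measure_pmf.expectation p g \<le> B"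
    by (rule measure_pmf.integral_le_const[OF integrable_pmf_bounded[OF assms]]) (use g in auto)
  moreover have "- B \<le> measure_pmf.expectation p g"
    by (rule measure_pmf.integral_ge_const[OF integrable_pmf_bounded[OF assms]]) (use g in auto)
  ultimately show ?thesis by linarith
qed

lemma expectation_bind_pmf:
  fixes g :: "'b \<Rightarrow> real"
  assumes "\<And>y. \<bar>g y\<bar> \<le> B"
  shows "measure_pmf.expectation (bind_pmf p k) g
    = measure_pmf.expectation p (\<lambda>x. measure_pmf.expectation (k x) g)"
  unfolding measure_pmf_bind
  by (rule integral_bind[where K="count_space UNIV" and B=B and B'=1])
    (auto simp: assms measure_pmf.finite_measure space_subprob_algebra
      intro!: measure_pmf.emeasure_space_le_1 prob_space_imp_subprob_space prob_space_measure_pmf)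

lemma pmf_bind_pair:
  "pmf (bind_pmf p (\<lambda>c. map_pmf (Pair c) (k c))) (c, z) = pmf p c * pmf (k c) z"
proof -
  have "pmf (map_pmf (Pair c') (k c')) (c, z) = indicat_real {c} c' * pmf (k c) z" for c'
  proof (cases "c' = c")
    case True
    then show ?thesis using pmf_map_inj'[of "Pair c" "k c" z] by (simp add: inj_def)
  next
    case False
    then show ?thesis by (auto simp: pmf_eq_0_set_pmf)
  qed
  then show ?thesis by (simp add: pmf_bind measure_pmf_single)
qed

lemma pmf_summable: "pmf p summable_on A"
proof -
  have "integrable (count_space UNIV) (pmf p)" by (rule integrable_pmf)
  then have "Infinite_Set_Sum.abs_summable_on (pmf p) UNIV"
    by (simp add: Infinite_Set_Sum.abs_summable_on_def)
  then have "(\<lambda>x. norm (pmf p x)) summable_on UNIV" by (rule iffD2[OF abs_summable_equivalent])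
  then have "pmf p summable_on UNIV" by simp
  then show ?thesis by (rule summable_on_subset) simp
qed

lemma expectation_eq_infsum:
  fixes g :: "'b \<Rightarrow> real"
  assumes "\<And>y. \<bar>g y\<bar> \<le> B"
  shows "measure_pmf.expectation p g = (\<Sum>\<^sub>\<infinity>y. pmf p y * g y)"
proof -
  have "(\<lambda>y. norm (pmf p y * g y)) summable_on UNIV"
  proof (rule summable_on_comparison_test)
    show "(\<lambda>y. B * pmf p y) summable_on UNIV" by (intro summable_on_cmult_right pmf_summable)
    show "norm (pmf p y * g y) \<le> B * pmf p y" for y
      using mult_right_mono[OF assms[of y] pmf_nonneg[of p y]] by (simp add: abs_mult mult.commute)
  qed simp
  then have s: "Infinite_Set_Sum.abs_summable_on (\<lambda>y. pmf p y * g y) UNIV"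
    by (rule iffD1[OF abs_summable_equivalent])
  have "measure_pmf.expectation p g = infsetsum (\<lambda>y. pmf p y * g y) UNIV"
    unfolding infsetsum_def measure_pmf_eq_density by (subst integral_density) simp_all
  then show ?thesis using infsetsum_infsum[OF s] by simp
qed

lemma measure_pmf_eq_infsum: "measure (measure_pmf p) A = (\<Sum>\<^sub>\<infinity>y\<in>A. pmf p y)"
proof -
  have "measure (measure_pmf p) A = measure_pmf.expectation p (indicat_real A)" by simp
  also have "\<dots> = (\<Sum>\<^sub>\<infinity>y. pmf p y * indicat_real A y)"
    by (rule expectation_eq_infsum[where B=1]) (auto simp: indicator_def)
  also have "\<dots> = (\<Sum>\<^sub>\<infinity>y\<in>A. pmf p y)"
    by (rule infsum_cong_neutral) auto
  finally show ?thesis .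
qed

text \<open>
  Scheffe's lemma for sums: pointwise convergence of nonnegative weights together with convergence
  of their totals leaves no mass to escape to infinity, so sums of bounded functions converge.
  Outside a finite set that carries almost all of \<open>q\<close>, the weights \<open>r t\<close> eventually have small mass too.
\<close>

lemma tendsto_infsum_scheffe:
  fixes r :: "'t \<Rightarrow> 'b \<Rightarrow> real"
  assumes r: "\<forall>\<^sub>F t in F. r t summable_on A \<and> (\<forall>y\<in>A. 0 \<le> r t y)"
    and q: "q summable_on A" "\<And>y. y \<in> A \<Longrightarrow> 0 \<le> q y"
    and pt: "\<And>y. y \<in> A \<Longrightarrow> ((\<lambda>t. r t y) \<longlongrightarrow> q y) F"
    and tot: "((\<lambda>t. \<Sum>\<^sub>\<infinity>y\<in>A. r t y) \<longlongrightarrow> (\<Sum>\<^sub>\<infinity>y\<in>A. q y)) F"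
    and D: "\<And>y. \<bar>D y\<bar> \<le> c"
  shows "((\<lambda>t. \<Sum>\<^sub>\<infinity>y\<in>A. r t y * D y) \<longlongrightarrow> (\<Sum>\<^sub>\<infinity>y\<in>A. q y * D y)) F"
proof (rule tendstoI)
  fix e :: real assume e: "e > 0"
  have c: "0 \<le> c" using D[of undefined] by linarith
  have tail: "\<bar>(\<Sum>\<^sub>\<infinity>y\<in>A. p y * D y) - (\<Sum>y\<in>G. p y * D y)\<bar> \<le> c * ((\<Sum>\<^sub>\<infinity>y\<in>A. p y) - (\<Sum>y\<in>G. p y))"
    if p: "p summable_on A" "\<And>y. y \<in> A \<Longrightarrow> 0 \<le> p y" and G: "finite G" "G \<subseteq> A" for p G
  proof -
    have b: "norm (p y * D y) \<le> c * p y" if "y \<in> A" for y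
      using mult_right_mono[OF D[of y] p(2)[OF that]] p(2)[OF that] by (simp add: abs_mult mult.commute)
    have s1: "(\<lambda>y. c * p y) summable_on B" if "B \<subseteq> A" for B
      using summable_on_subset[OF p(1) that] by (rule summable_on_cmult_right)
    have s2: "(\<lambda>y. p y * D y) summable_on B" if "B \<subseteq> A" for B
      by (rule abs_summable_summable, rule summable_on_comparison_test[OF s1[OF that]]) (use b that in auto)
    have "(\<Sum>\<^sub>\<infinity>y\<in>A. p y * D y) - (\<Sum>y\<in>G. p y * D y) = (\<Sum>\<^sub>\<infinity>y\<in>A-G. p y * D y)"
      using infsum_Diff[OF s2 s2 G(2)] G by simp
    moreover have "norm (\<Sum>\<^sub>\<infinity>y\<in>A-G. p y * D y) \<le> (\<Sum>\<^sub>\<infinity>y\<in>A-G. c * p y)"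
      by (rule norm_infsum_le[OF has_sum_infsum[OF s2] has_sum_infsum[OF s1] b]) auto
    moreover have "(\<Sum>\<^sub>\<infinity>y\<in>A-G. c * p y) = c * ((\<Sum>\<^sub>\<infinity>y\<in>A. p y) - (\<Sum>y\<in>G. p y))"
      using infsum_Diff[OF p(1) summable_on_subset[OF p(1) G(2)] G(2)] G
      by (simp add: infsum_cmult_right')
    ultimately show ?thesis by simp
  qed
  \<comment> \<open>The summand \<open>1\<close> avoids a division by zero if \<open>c = 0\<close>.\<close>
  define \<epsilon> where "\<epsilon> = e / (3 * (c + 1))"
  have \<epsilon>: "\<epsilon> > 0" using e c by (simp add: \<epsilon>_def)
  \<comment> \<open>A finite set that carries all but \<open>\<epsilon>\<close> of the mass of \<open>q\<close>.\<close>
  obtain G where G: "finite G" "G \<subseteq> A" "dist (sum q G) (\<Sum>\<^sub>\<infinity>y\<in>A. q y) \<le> \<epsilon>"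
    using infsum_finite_approximation[OF q(1) \<epsilon>] by blast
  have qG: "(\<Sum>\<^sub>\<infinity>y\<in>A. q y) - sum q G \<le> \<epsilon>" using G(3) by (simp add: dist_real_def)
  have "((\<lambda>t. \<Sum>y\<in>G. r t y * D y) \<longlongrightarrow> (\<Sum>y\<in>G. q y * D y)) F"
    by (intro tendsto_intros pt) (use G in auto)
  then have ev1: "\<forall>\<^sub>F t in F. dist (\<Sum>y\<in>G. r t y * D y) (\<Sum>y\<in>G. q y * D y) < e / 3"
    using e by (intro tendstoD) auto
  have "((\<lambda>t. (\<Sum>\<^sub>\<infinity>y\<in>A. r t y) - sum (r t) G) \<longlongrightarrow> (\<Sum>\<^sub>\<infinity>y\<in>A. q y) - sum q G) F"
    by (intro tendsto_intros tot pt) (use G in auto)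
  then have "((\<lambda>t. c * ((\<Sum>\<^sub>\<infinity>y\<in>A. r t y) - sum (r t) G)) \<longlongrightarrow> c * ((\<Sum>\<^sub>\<infinity>y\<in>A. q y) - sum q G)) F"
    by (rule tendsto_mult[OF tendsto_const])
  moreover have cq: "c * ((\<Sum>\<^sub>\<infinity>y\<in>A. q y) - sum q G) < e / 3"
  proof -
    have "c * ((\<Sum>\<^sub>\<infinity>y\<in>A. q y) - sum q G) \<le> c * \<epsilon>" using qG c by (rule mult_left_mono)
    also have "\<dots> < (c + 1) * \<epsilon>" using \<epsilon> by (simp add: distrib_right)
    also have "\<dots> = e / 3"
    proof -
      have "c + 1 \<noteq> 0" using c by linarith
      then show ?thesis by (simp add: \<epsilon>_def field_simps)
    qed
    finally show ?thesis .
  qed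
  ultimately have ev2: "\<forall>\<^sub>F t in F. c * ((\<Sum>\<^sub>\<infinity>y\<in>A. r t y) - sum (r t) G) < e / 3"
    by (rule order_tendstoD(2))
  show "\<forall>\<^sub>F t in F. dist (\<Sum>\<^sub>\<infinity>y\<in>A. r t y * D y) (\<Sum>\<^sub>\<infinity>y\<in>A. q y * D y) < e"
    using ev1 ev2 r
  proof eventually_elim
    case (elim t)
    have "\<bar>(\<Sum>\<^sub>\<infinity>y\<in>A. r t y * D y) - (\<Sum>y\<in>G. r t y * D y)\<bar> < e / 3"
      using tail[of "r t" G] elim G by fastforce
    moreover have "\<bar>(\<Sum>\<^sub>\<infinity>y\<in>A. q y * D y) - (\<Sum>y\<in>G. q y * D y)\<bar> < e / 3"
      using tail[of q G] q G cq by fastforce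
    ultimately show ?case using elim(1) unfolding dist_real_def by linarith
  qed
qed

section \<open>The Markov chain at small times\<close>

lemma measurable_pair_discrete:
  fixes f :: "'w \<Rightarrow> 'b::countable" and g :: "'w \<Rightarrow> 'c::countable"
  assumes "f \<in> M \<rightarrow>\<^sub>M count_space UNIV" "g \<in> M \<rightarrow>\<^sub>M count_space UNIV"
  shows "(\<lambda>\<omega>. (f \<omega>, g \<omega>)) \<in> M \<rightarrow>\<^sub>M count_space UNIV"
proof -
  have "(\<lambda>\<omega>. (f \<omega>, g \<omega>)) -` {p} \<inter> space M = (f -` {fst p} \<inter> space M) \<inter> (g -` {snd p} \<inter> space M)" for p
    by auto
  then show ?thesis
    using assms by (subst measurable_count_space_eq2_countable) (auto intro: measurable_sets)
qed

locale bounded_rate_chain = markov_chain q P X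
  for q :: "'a::countable \<Rightarrow> 'a \<Rightarrow> real" and P :: "'a \<Rightarrow> 'w measure" and X :: "real \<Rightarrow> 'w \<Rightarrow> 'a" +
  fixes R :: real
  assumes q_nonneg: "0 \<le> q x y" and q_summable: "q x summable_on UNIV"
    and q_le: "(\<Sum>\<^sub>\<infinity>y. q x y) \<le> R"
begin

definition kern :: "real \<Rightarrow> 'a \<Rightarrow> 'a pmf" where
  "kern t x = law (P x) (X t)"

definition evolve :: "real \<Rightarrow> ('a \<Rightarrow> real) \<Rightarrow> 'a \<Rightarrow> real" where
  "evolve t g x = measure_pmf.expectation (kern t x) g"

definition Q :: "('a \<Rightarrow> real) \<Rightarrow> 'a \<Rightarrow> real" where
  "Q g x = (\<Sum>\<^sub>\<infinity>y. q x y * (g y - g x))"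

lemma R_nonneg: "0 \<le> R"
  using q_le[of undefined] infsum_nonneg[of UNIV "q undefined"] q_nonneg by force

lemma pmf_kern: "0 \<le> t \<Longrightarrow> pmf (kern t x) z = measure (P x) {\<omega> \<in> space (P x). X t \<omega> = z}"
  unfolding kern_def by (rule pmf_law[OF prob measurable_X])

lemma history_measurable:
  "set ts \<subseteq> {0..} \<Longrightarrow> (\<lambda>\<omega>. map (\<lambda>r. X r \<omega>) ts) \<in> P x \<rightarrow>\<^sub>M count_space UNIV"
proof (induction ts)
  case (Cons r ts)
  have "(\<lambda>\<omega>. (X r \<omega>, map (\<lambda>r. X r \<omega>) ts)) \<in> P x \<rightarrow>\<^sub>M count_space UNIV"
    using Cons by (intro measurable_pair_discrete measurable_X) auto
  then have "(\<lambda>\<omega>. case (X r \<omega>, map (\<lambda>r. X r \<omega>) ts) of (a, as) \<Rightarrow> a # as) \<in> P x \<rightarrow>\<^sub>M count_space UNIV"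
    by (rule measurable_compose) simp
  then show ?case by simp
qed simp

text \<open>
  The finite dimensional Markov property as an identity of discrete laws: given the states at the
  times in \<open>ts\<close>, of which the \<open>i\<close>-th is the last, the state after a further time \<open>t\<close> depends on the \<open>i\<close>-th
  entry only.  Point masses of histories are the events of the Markov property, with \<open>c\<close> read off from \<open>cs\<close>.
\<close>

lemma law_step:
  assumes ts: "distinct ts" "i < length ts" "set ts \<subseteq> {0..ts ! i}" and t: "0 \<le> t"
  shows "law (P x) (\<lambda>\<omega>. (map (\<lambda>r. X r \<omega>) ts, X (ts ! i + t) \<omega>))
    = bind_pmf (law (P x) (\<lambda>\<omega>. map (\<lambda>r. X r \<omega>) ts)) (\<lambda>cs. map_pmf (Pair cs) (kern t (cs ! i)))"
proof (rule pmf_eqI)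
  fix p :: "'a list \<times> 'a"
  obtain cs z where p: "p = (cs, z)" by force
  let ?Y = "\<lambda>\<omega>. map (\<lambda>r. X r \<omega>) ts"
  have s: "0 \<le> ts ! i" using subsetD[OF ts(3) nth_mem[OF ts(2)]] by simp
  have Y: "?Y \<in> P x \<rightarrow>\<^sub>M count_space UNIV" using ts(3) by (intro history_measurable) auto
  have pair: "(\<lambda>\<omega>. (?Y \<omega>, X (ts ! i + t) \<omega>)) \<in> P x \<rightarrow>\<^sub>M count_space UNIV"
    using s t by (intro measurable_pair_discrete Y measurable_X) auto
  have L: "pmf (law (P x) (\<lambda>\<omega>. (?Y \<omega>, X (ts ! i + t) \<omega>))) p
      = measure (P x) {\<omega> \<in> space (P x). ?Y \<omega> = cs \<and> X (ts ! i + t) \<omega> = z}"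
    unfolding pmf_law[OF prob pair] p by simp
  have Rr: "pmf (bind_pmf (law (P x) ?Y) (\<lambda>cs. map_pmf (Pair cs) (kern t (cs ! i)))) p
      = measure (P x) {\<omega> \<in> space (P x). ?Y \<omega> = cs}
        * measure (P (cs ! i)) {\<omega> \<in> space (P (cs ! i)). X t \<omega> = z}"
    unfolding p pmf_bind_pair pmf_law[OF prob Y] pmf_kern[OF t] ..
  show "pmf (law (P x) (\<lambda>\<omega>. (?Y \<omega>, X (ts ! i + t) \<omega>))) p
      = pmf (bind_pmf (law (P x) ?Y) (\<lambda>cs. map_pmf (Pair cs) (kern t (cs ! i)))) p"
  proof (cases "length cs = length ts")
    case False
    then have empty: "{\<omega> \<in> space (P x). ?Y \<omega> = cs} = {}"
      "{\<omega> \<in> space (P x). ?Y \<omega> = cs \<and> X (ts ! i + t) \<omega> = z} = {}" by auto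
    show ?thesis unfolding L Rr empty by simp
  next
    case True
    define c where "c r = the (map_of (zip ts cs) r)" for r
    have c: "c (ts ! j) = cs ! j" if "j < length ts" for j
      using that ts(1) True by (simp add: c_def map_of_zip_nth)
    have eq: "?Y \<omega> = cs \<longleftrightarrow> (\<forall>r\<in>set ts. X r \<omega> = c r)" for \<omega>
      unfolding all_set_conv_all_nth using True c by (auto simp: list_eq_iff_nth_eq)
    have "measure (P x) {\<omega> \<in> space (P x). (\<forall>r\<in>set ts. X r \<omega> = c r) \<and> X (ts ! i + t) \<omega> = z}
      = measure (P x) {\<omega> \<in> space (P x). \<forall>r\<in>set ts. X r \<omega> = c r}
        * measure (P (c (ts ! i))) {\<omega> \<in> space (P (c (ts ! i))). X t \<omega> = z}"
      using ts t by (intro markov) auto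
    then show ?thesis unfolding L Rr eq c[OF ts(2)] .
  qed
qed

lemma markov_expectation:
  assumes ts: "distinct ts" "i < length ts" "set ts \<subseteq> {0..ts ! i}" and t: "0 \<le> t"
    and \<Psi>: "\<And>cs. \<bar>\<Psi> cs\<bar> \<le> A" and g: "\<And>y. \<bar>g y\<bar> \<le> B"
  shows "(\<integral>\<omega>. \<Psi> (map (\<lambda>r. X r \<omega>) ts) * g (X (ts ! i + t) \<omega>) \<partial>P x)
    = (\<integral>\<omega>. \<Psi> (map (\<lambda>r. X r \<omega>) ts) * evolve t g (X (ts ! i) \<omega>) \<partial>P x)"
proof -
  let ?Y = "\<lambda>\<omega>. map (\<lambda>r. X r \<omega>) ts"
  have s: "0 \<le> ts ! i" using subsetD[OF ts(3) nth_mem[OF ts(2)]] by simp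
  have Y: "?Y \<in> P x \<rightarrow>\<^sub>M count_space UNIV" using ts(3) by (intro history_measurable) auto
  have pair: "(\<lambda>\<omega>. (?Y \<omega>, X (ts ! i + t) \<omega>)) \<in> P x \<rightarrow>\<^sub>M count_space UNIV"
    using s t by (intro measurable_pair_discrete Y measurable_X) auto
  have b: "\<bar>(\<lambda>(cs, z). \<Psi> cs * g z) y\<bar> \<le> A * B" for y
  proof -
    have "0 \<le> A" using \<Psi>[of undefined] by linarith
    then show ?thesis using \<Psi>[of "fst y"] g[of "snd y"]
      by (auto simp: abs_mult case_prod_beta intro!: mult_mono)
  qed
  have "(\<integral>\<omega>. \<Psi> (?Y \<omega>) * g (X (ts ! i + t) \<omega>) \<partial>P x)
      = measure_pmf.expectation (law (P x) (\<lambda>\<omega>. (?Y \<omega>, X (ts ! i + t) \<omega>))) (\<lambda>(cs, z). \<Psi> cs * g z)"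
    unfolding expectation_law[OF prob pair] by simp
  also have "\<dots> = measure_pmf.expectation (law (P x) ?Y) (\<lambda>cs. \<Psi> cs * evolve t g (cs ! i))"
    unfolding law_step[OF ts t] expectation_bind_pmf[of "\<lambda>(cs, z). \<Psi> cs * g z", OF b] evolve_def
    by simp
  also have "\<dots> = (\<integral>\<omega>. \<Psi> (?Y \<omega>) * evolve t g (X (ts ! i) \<omega>) \<partial>P x)"
    unfolding expectation_law[OF prob Y] using ts(2) by simp
  finally show ?thesis .
qed

lemma evolve_eq: "0 \<le> t \<Longrightarrow> evolve t g x = (\<integral>\<omega>. g (X t \<omega>) \<partial>P x)"
  unfolding evolve_def kern_def by (rule expectation_law[OF prob measurable_X])

lemma evolve_add:
  assumes "0 \<le> s" "0 \<le> t" "\<And>y. \<bar>g y\<bar> \<le> B"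
  shows "evolve (s + t) g x = evolve s (evolve t g) x"
  using markov_expectation[of "[s]" 0 t "\<lambda>_. 1" 1 g B x] assms by (simp add: evolve_eq)

lemma evolve_bound: "(\<And>y. \<bar>g y\<bar> \<le> B) \<Longrightarrow> \<bar>evolve t g x\<bar> \<le> B"
  unfolding evolve_def by (rule expectation_bound)

lemma evolve_const: "evolve t (\<lambda>_. c) x = c"
  by (simp add: evolve_def measure_pmf.prob_space)

lemma evolve_diff:
  assumes "\<And>y. \<bar>f y\<bar> \<le> A" "\<And>y. \<bar>g y\<bar> \<le> B"
  shows "evolve t (\<lambda>y. f y - g y) x = evolve t f x - evolve t g x"
  unfolding evolve_def
  by (intro Bochner_Integration.integral_diff integrable_pmf_bounded[of f A] integrable_pmf_bounded[of g B] assms)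

lemma evolve_cmult: "evolve t (\<lambda>y. c * g y) x = c * evolve t g x"
  unfolding evolve_def by simp

lemma expectation_start:
  fixes g :: "'a \<Rightarrow> real"
  shows "(\<integral>\<omega>. g (X 0 \<omega>) \<partial>P x) = g x"
proof -
  have "measure (measure_pmf (kern 0 x)) {x} = 1" using start by (simp add: pmf_kern measure_pmf_single)
  then have "AE y in measure_pmf (kern 0 x). y \<in> {x}"
    by (subst measure_pmf.AE_in_set_eq_1) auto
  then have "kern 0 x = return_pmf x"
    by (auto simp: AE_measure_pmf_iff simp flip: set_pmf_subset_singleton)
  then show ?thesis using evolve_eq[of 0 g x] by (simp add: evolve_def)
qed

lemma evolve_zero: "evolve 0 g x = g x"
  by (simp add: evolve_eq expectation_start)

text \<open>
  The jump rates converge, and so does the total rate of leaving \<open>x\<close>, so Scheffe's lemma applies to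
  the point masses at the other states, divided by \<open>t\<close>.
\<close>

lemma rate_limit:
  assumes g: "\<And>y. \<bar>g y\<bar> \<le> B"
  shows "((\<lambda>t. (evolve t g x - g x) / t) \<longlongrightarrow> Q g x) (at_right 0)"
proof -
  define D where "D y = g y - g x" for y
  have D: "\<bar>D y\<bar> \<le> 2 * B" for y unfolding D_def using g[of y] g[of x] by linarith
  have pos: "\<forall>\<^sub>F t in at_right (0::real). t > 0" by (simp add: eventually_at_right_less)
  have lim: "((\<lambda>t. \<Sum>\<^sub>\<infinity>y\<in>-{x}. pmf (kern t x) y / t * D y) \<longlongrightarrow> (\<Sum>\<^sub>\<infinity>y\<in>-{x}. q x y * D y)) (at_right 0)"
  proof (rule tendsto_infsum_scheffe)
    show "\<forall>\<^sub>F t in at_right 0. (\<lambda>y. pmf (kern t x) y / t) summable_on - {x}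
        \<and> (\<forall>y\<in>- {x}. 0 \<le> pmf (kern t x) y / t)"
      using pos
    proof eventually_elim
      case (elim t)
      have "(\<lambda>y. pmf (kern t x) y * (1 / t)) summable_on - {x}"
        by (intro summable_on_cmult_left pmf_summable)
      then show ?case using elim by simp
    qed
    show "q x summable_on - {x}" by (rule summable_on_subset[OF q_summable]) auto
    show "0 \<le> q x y" for y by (rule q_nonneg)
    show "((\<lambda>t. pmf (kern t x) y / t) \<longlongrightarrow> q x y) (at_right 0)" if "y \<in> - {x}" for y
    proof (rule Lim_transform_eventually[OF jump_rate])
      show "\<forall>\<^sub>F t in at_right 0. measure (P x) {\<omega> \<in> space (P x). X t \<omega> = y} / t = pmf (kern t x) y / t"
        using pos by eventually_elim (simp add: pmf_kern)
    qed (use that in auto)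
    show "((\<lambda>t. \<Sum>\<^sub>\<infinity>y\<in>- {x}. pmf (kern t x) y / t) \<longlongrightarrow> (\<Sum>\<^sub>\<infinity>y\<in>- {x}. q x y)) (at_right 0)"
    proof (rule Lim_transform_eventually[OF holding_rate])
      show "\<forall>\<^sub>F t in at_right 0. measure (P x) {\<omega> \<in> space (P x). X t \<omega> \<noteq> x} / t
          = (\<Sum>\<^sub>\<infinity>y\<in>- {x}. pmf (kern t x) y / t)"
        using pos
      proof eventually_elim
        case (elim t)
        have "(\<Sum>\<^sub>\<infinity>y\<in>- {x}. pmf (kern t x) y * (1 / t)) = (\<Sum>\<^sub>\<infinity>y\<in>- {x}. pmf (kern t x) y) * (1 / t)"
          by (rule infsum_cmult_left')
        also have "(\<Sum>\<^sub>\<infinity>y\<in>- {x}. pmf (kern t x) y) = measure (distr (P x) (count_space UNIV) (X t)) (- {x})"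
          unfolding measure_pmf_eq_infsum[symmetric] kern_def
          using elim by (simp add: measure_pmf_law[OF prob measurable_X])
        also have "\<dots> = measure (P x) (X t -` (- {x}) \<inter> space (P x))"
          using elim by (intro measure_distr measurable_X) auto
        also have "X t -` (- {x}) \<inter> space (P x) = {\<omega> \<in> space (P x). X t \<omega> \<noteq> x}" by auto
        finally show ?case by simp
      qed
    qed
    show "\<bar>D y\<bar> \<le> 2 * B" for y by (rule D)
  qed
  have rate: "(\<Sum>\<^sub>\<infinity>y\<in>-{x}. q x y * D y) = Q g x"
    unfolding Q_def D_def by (rule infsum_cong_neutral) auto
  have "\<forall>\<^sub>F t in at_right 0. (\<Sum>\<^sub>\<infinity>y\<in>-{x}. pmf (kern t x) y / t * D y) = (evolve t g x - g x) / t"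
    using pos
  proof eventually_elim
    case (elim t)
    have "(\<Sum>\<^sub>\<infinity>y\<in>-{x}. pmf (kern t x) y / t * D y) = (\<Sum>\<^sub>\<infinity>y. pmf (kern t x) y * D y * (1 / t))"
      by (rule infsum_cong_neutral) (auto simp: D_def)
    also have "\<dots> = evolve t D x * (1 / t)"
      unfolding infsum_cmult_left' evolve_def expectation_eq_infsum[of D, OF D] ..
    also have "evolve t D x = evolve t g x - g x"
      unfolding D_def using evolve_diff[of g B "\<lambda>_. g x" B t x] g by (simp add: evolve_const)
    finally show ?case by simp
  qed
  then show ?thesis by (rule Lim_transform_eventually[OF lim[unfolded rate]])
qed

lemma evolve_small_steps:
  assumes "\<And>y. \<bar>g y\<bar> \<le> B" and h: "0 < h"
  shows "(\<lambda>n. real n * (evolve (h / n) g x - g x)) \<longlonglongrightarrow> h * Q g x"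
proof -
  have "filterlim (\<lambda>n. h / real n) (at_right 0) sequentially"
    unfolding filterlim_at using h
    by (auto intro!: lim_const_over_n eventually_sequentiallyI[of 1])
  from filterlim_compose[OF rate_limit[OF assms(1)] this]
  have "(\<lambda>n. h * ((evolve (h / n) g x - g x) / (h / n))) \<longlonglongrightarrow> h * Q g x"
    by (intro tendsto_intros)
  then show ?thesis
    by (rule Lim_transform_eventually) (use h in \<open>auto intro!: eventually_sequentiallyI[of 1] simp: field_simps\<close>)
qed

text \<open>
  Staying at \<open>x\<close> at all multiples of \<open>h / n\<close> shows \<open>pmf (kern h x) x \<ge> pmf (kern (h / n) x) x ^ n\<close>, and
  Bernoulli's inequality bounds this below by \<open>1 - n * (1 - pmf (kern (h / n) x) x)\<close>, which tends to
  \<open>1 + h * Q g x\<close> for the indicator \<open>g\<close> of \<open>{x}\<close>.  This makes the limits at time \<open>0\<close>, given for each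
  \<open>x\<close> separately, uniform in \<open>x\<close>.
\<close>

lemma leave_prob_le:
  assumes h: "0 < h"
  shows "1 - pmf (kern h x) x \<le> R * h"
proof -
  define g where "g = indicat_real {x}"
  have g: "\<bar>g y\<bar> \<le> 1" for y by (simp add: g_def indicator_def)
  have gx: "g x = 1" by (simp add: g_def)
  have a: "evolve t g x = pmf (kern t x) x" for t
    by (simp add: evolve_def g_def measure_pmf_single)
  have "- R \<le> Q g x"
  proof -
    have "Q g x = (\<Sum>\<^sub>\<infinity>y\<in>-{x}. - q x y)"
      unfolding Q_def by (rule infsum_cong_neutral) (auto simp: g_def)
    then have "Q g x = - (\<Sum>\<^sub>\<infinity>y\<in>-{x}. q x y)" by (simp only: infsum_uminus)
    moreover have "(\<Sum>\<^sub>\<infinity>y\<in>-{x}. q x y) \<le> (\<Sum>\<^sub>\<infinity>y. q x y)"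
      by (rule infsum_mono2[OF summable_on_subset[OF q_summable] q_summable]) (auto simp: q_nonneg)
    ultimately show ?thesis using q_le[of x] by linarith
  qed
  have mult: "pmf (kern \<tau> x) x * pmf (kern t x) x \<le> pmf (kern (\<tau> + t) x) x" if "0 \<le> \<tau>" "0 \<le> t" for \<tau> t
  proof -
    have "evolve \<tau> (\<lambda>y. pmf (kern t x) x * g y) x \<le> evolve \<tau> (evolve t g) x"
      unfolding evolve_def[of \<tau>]
    proof (intro integral_mono)
      show "pmf (kern t x) x * g y \<le> evolve t g y" for y
        using a[of t] by (cases "y = x") (auto simp: g_def evolve_def)
      show "integrable (measure_pmf (kern \<tau> x)) (\<lambda>y. pmf (kern t x) x * g y)"
        by (intro integrable_mult_right integrable_pmf_bounded[OF g])
      show "integrable (measure_pmf (kern \<tau> x)) (evolve t g)"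
        by (rule integrable_pmf_bounded[OF evolve_bound[OF g]])
    qed
    then show ?thesis
      unfolding evolve_add[OF that g, symmetric] evolve_cmult a by (simp add: mult.commute)
  qed
  have power: "pmf (kern \<tau> x) x ^ n \<le> pmf (kern (n * \<tau>) x) x" if "0 \<le> \<tau>" for \<tau> n
  proof (induction n)
    case 0
    then show ?case using a[of 0] by (simp add: evolve_zero g_def)
  next
    case (Suc n)
    have "pmf (kern \<tau> x) x ^ Suc n \<le> pmf (kern \<tau> x) x * pmf (kern (n * \<tau>) x) x"
      using Suc by (simp add: mult_left_mono)
    also have "\<dots> \<le> pmf (kern (\<tau> + n * \<tau>) x) x" using that by (intro mult) auto
    finally show ?case by (simp add: algebra_simps)
  qed
  have "1 + real n * (evolve (h / n) g x - g x) \<le> pmf (kern h x) x" if n: "n > 0" for n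
  proof -
    have "1 + real n * (pmf (kern (h / n) x) x - 1) \<le> (1 + (pmf (kern (h / n) x) x - 1)) ^ n"
      by (rule Bernoulli_inequality) simp
    also have "\<dots> \<le> pmf (kern (n * (h / n)) x) x" using power[of "h / n" n] h by simp
    finally show ?thesis using n unfolding a gx by simp
  qed
  then have "\<forall>\<^sub>F n in sequentially. 1 + real n * (evolve (h / n) g x - g x) \<le> pmf (kern h x) x"
    by (intro eventually_sequentiallyI[of 1]) auto
  moreover have "(\<lambda>n. 1 + real n * (evolve (h / n) g x - g x)) \<longlonglongrightarrow> 1 + h * Q g x"
    by (intro tendsto_intros evolve_small_steps[OF g h])
  ultimately have "1 + h * Q g x \<le> pmf (kern h x) x"
    using tendsto_upperbound trivial_limit_sequentially by blast
  moreover have "h * (- R) \<le> h * Q g x" using \<open>- R \<le> Q g x\<close> h by (intro mult_left_mono) auto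
  ultimately show ?thesis by (simp add: mult.commute)
qed

lemma evolve_first_order:
  assumes g: "\<And>y. \<bar>g y\<bar> \<le> B" and h: "0 \<le> h"
  shows "\<bar>evolve h g x - g x\<bar> \<le> 2 * B * (R * h)"
proof (cases "h = 0")
  case False
  with h have h: "0 < h" by simp
  have B: "0 \<le> B" using g[of undefined] by linarith
  have D: "\<bar>g y - g x\<bar> \<le> 2 * B * indicat_real (-{x}) y" for y
    using g[of y] g[of x] by (cases "y = x") auto
  have D': "\<bar>g y - g x\<bar> \<le> 2 * B" for y using g[of y] g[of x] by linarith
  have "\<bar>evolve h g x - g x\<bar> = \<bar>measure_pmf.expectation (kern h x) (\<lambda>y. g y - g x)\<bar>"
    using evolve_diff[of g B "\<lambda>_. g x" B h x] g by (simp add: evolve_const evolve_def)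
  also have "\<dots> \<le> measure_pmf.expectation (kern h x) (\<lambda>y. \<bar>g y - g x\<bar>)"
    by (rule integral_abs_bound)
  also have "\<dots> \<le> measure_pmf.expectation (kern h x) (\<lambda>y. 2 * B * indicat_real (-{x}) y)"
  proof (intro integral_mono D)
    show "integrable (measure_pmf (kern h x)) (\<lambda>y. \<bar>g y - g x\<bar>)"
      by (rule integrable_pmf_bounded[where B="2 * B"]) (simp add: D')
    show "integrable (measure_pmf (kern h x)) (\<lambda>y. 2 * B * indicat_real (-{x}) y)"
      by (rule integrable_pmf_bounded[where B="2 * B"]) (use B in \<open>auto simp: indicator_def\<close>)
  qed
  also have "\<dots> = 2 * B * measure (measure_pmf (kern h x)) (- {x})" by simp
  also have "measure (measure_pmf (kern h x)) (- {x}) = 1 - pmf (kern h x) x"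
    using measure_pmf.prob_compl[of "{x}" "kern h x"] by (simp add: Compl_eq_Diff_UNIV measure_pmf_single)
  also have "2 * B * \<dots> \<le> 2 * B * (R * h)"
    using B by (intro mult_left_mono leave_prob_le h) auto
  finally show ?thesis .
qed (simp add: evolve_zero)

text \<open>
  With \<open>\<tau> = h / N\<close>, each increment \<open>evolve \<tau> G x - G x\<close> for \<open>G = evolve (k * \<tau>) g\<close> is compared with the same
  increment of \<open>g\<close>.  By the first order estimate, applied to \<open>G - g\<close>, the error is of order \<open>h * \<tau>\<close>,
  and \<open>N\<close> times the increment of \<open>g\<close> tends to \<open>h * Q g x\<close>.
\<close>

lemma evolve_second_order:
  assumes g: "\<And>y. \<bar>g y\<bar> \<le> B" and h: "0 < h"
  shows "\<bar>evolve h g x - g x - h * Q g x\<bar> \<le> 4 * B * (R * h)\<^sup>2"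
proof -
  have B: "0 \<le> B" using g[of undefined] by linarith
  have bound: "\<bar>evolve h g x - g x - real N * (evolve (h / N) g x - g x)\<bar> \<le> 4 * B * (R * h)\<^sup>2"
    if N: "N > 0" for N
  proof -
    define \<tau> where "\<tau> = h / N"
    have \<tau>: "0 < \<tau>" "N * \<tau> = h" using N h by (auto simp: \<tau>_def)
    define e where "e = 2 * (2 * B * (R * h)) * (R * \<tau>)"
    have "\<bar>evolve (k * \<tau>) g x - g x - k * (evolve \<tau> g x - g x)\<bar> \<le> k * e" if "k \<le> N" for k :: nat
      using that
    proof (induction k)
      case 0
      then show ?case by (simp add: evolve_zero)
    next
      case (Suc k)
      define G where "G = evolve (k * \<tau>) g"
      have s: "0 \<le> k * \<tau>" "k * \<tau> \<le> h"
        using \<tau> Suc.prems mult_right_mono[of "real k" "real N" \<tau>] by auto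
      have GB: "\<bar>G y\<bar> \<le> B" for y unfolding G_def by (rule evolve_bound[OF g])
      have Gg: "\<bar>G y - g y\<bar> \<le> 2 * B * (R * h)" for y
      proof -
        have "\<bar>G y - g y\<bar> \<le> 2 * B * (R * (k * \<tau>))" unfolding G_def by (rule evolve_first_order[OF g s(1)])
        also have "\<dots> \<le> 2 * B * (R * h)" using s B R_nonneg by (intro mult_left_mono) auto
        finally show ?thesis .
      qed
      have "\<bar>evolve \<tau> (\<lambda>y. G y - g y) x - (G x - g x)\<bar> \<le> e"
        unfolding e_def by (rule evolve_first_order[where g="\<lambda>y. G y - g y", OF Gg]) (use \<tau> in simp)
      then have 1: "\<bar>evolve \<tau> G x - evolve \<tau> g x - (G x - g x)\<bar> \<le> e"
        unfolding evolve_diff[of G B g B, OF GB g] .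
      have "evolve (\<tau> + k * \<tau>) g x = evolve \<tau> G x"
        unfolding G_def using \<tau> s by (intro evolve_add[OF _ _ g]) auto
      then have 2: "evolve (Suc k * \<tau>) g x = evolve \<tau> G x" by (simp add: algebra_simps)
      have 3: "\<bar>G x - g x - k * (evolve \<tau> g x - g x)\<bar> \<le> k * e" using Suc unfolding G_def by simp
      have 4: "real (Suc k) * (evolve \<tau> g x - g x) = k * (evolve \<tau> g x - g x) + (evolve \<tau> g x - g x)"
        "real (Suc k) * e = k * e + e" by (simp_all add: algebra_simps)
      show ?case unfolding 2 4 using 1 3 by linarith
    qed
    from this[of N] have "\<bar>evolve h g x - g x - N * (evolve \<tau> g x - g x)\<bar> \<le> N * e" using \<tau> by simp
    also have "N * e = 4 * B * (R * h)\<^sup>2"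
      unfolding \<tau>(2)[symmetric] e_def by (simp add: power2_eq_square)
    finally show ?thesis by (simp add: \<tau>_def)
  qed
  have "(\<lambda>N. \<bar>evolve h g x - g x - real N * (evolve (h / N) g x - g x)\<bar>)
      \<longlonglongrightarrow> \<bar>evolve h g x - g x - h * Q g x\<bar>"
    by (intro tendsto_intros evolve_small_steps[OF g h])
  then show ?thesis
    by (rule tendsto_upperbound) (auto intro!: eventually_sequentiallyI[of 1] bound)
qed

end

section \<open>The Feynman--Kac formula\<close>

lemma step_function_value:
  fixes a :: "nat \<Rightarrow> real"
  assumes h: "0 < h"
  shows "(\<Sum>j<n. a j * indicator {real j * h..<real (Suc j) * h} s)
    = (if 0 \<le> s \<and> s < n * h then a (nat \<lfloor>s / h\<rfloor>) else 0)"
proof (cases "0 \<le> s")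
  case False
  then have "indicator {real j * h..<real (Suc j) * h} s = (0::real)" for j
  proof -
    have "0 \<le> real j * h" using h by simp
    then show ?thesis using False by (simp add: indicator_def)
  qed
  then show ?thesis using False by simp
next
  case True
  define i where "i = nat \<lfloor>s / h\<rfloor>"
  have "s / h \<ge> 0" using True h by simp
  then have i: "real i \<le> s / h" "s / h < real i + 1"
    by (simp_all add: i_def)
  have ind: "indicator {real j * h..<real (Suc j) * h} s = (of_bool (j = i) :: real)" for j
  proof -
    have "s \<in> {real j * h..<real (Suc j) * h} \<longleftrightarrow> real j \<le> s / h \<and> s / h < real (Suc j)"
      using h by (simp add: pos_le_divide_eq pos_divide_less_eq)
    also have "\<dots> \<longleftrightarrow> j = i" using i by auto
    finally show ?thesis by (simp add: indicator_def)
  qed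
  have "i < n \<longleftrightarrow> s < n * h"
  proof -
    have "s < n * h \<longleftrightarrow> s / h < n" using h by (simp add: pos_divide_less_eq)
    also have "\<dots> \<longleftrightarrow> i < n" using i by linarith
    finally show ?thesis by simp
  qed
  then show ?thesis
    unfolding ind using True by (simp add: i_def[symmetric] of_bool_def if_distrib cong: if_cong)
qed

locale killed_chain = bounded_rate_chain q P X R
  for q :: "'a::countable \<Rightarrow> 'a \<Rightarrow> real" and P :: "'a \<Rightarrow> 'w measure" and X :: "real \<Rightarrow> 'w \<Rightarrow> 'a" and R +
  fixes V :: "'a \<Rightarrow> real"
  assumes V_nonneg: "0 \<le> V x" and V_le: "V x \<le> R"
begin

definition occupation :: "real \<Rightarrow> 'w \<Rightarrow> real" where
  "occupation T \<omega> = (\<integral>s. V (X s \<omega>) * indicator {0..<T} s \<partial>lborel)"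

text \<open>
  The sum samples each subinterval at its right endpoint, because the paths are continuous from the right.
\<close>

definition riemann_sum :: "real \<Rightarrow> nat \<Rightarrow> 'w \<Rightarrow> real" where
  "riemann_sum h n \<omega> = h * (\<Sum>j<n. V (X (real (Suc j) * h) \<omega>))"

text \<open>
  For each \<open>s\<close> the right endpoint \<open>r n\<close> of the grid interval of length \<open>T / n\<close> that contains \<open>s\<close> tends to
  \<open>s\<close> strictly from above, so \<open>X (r n) \<omega>\<close> eventually equals \<open>X s \<omega>\<close>.  Hence the step functions \<open>f n\<close> converge everywhere, which
  yields measurability of \<open>V\<close> along the path, and dominated convergence yields the integral.
\<close>

lemma path_occupation:
  assumes \<omega>: "\<omega> \<in> space (P x)" and T: "0 < T"
  shows "integrable lborel (\<lambda>s. V (X s \<omega>) * indicator {0..<T} s)"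
    and "(\<lambda>n. riemann_sum (T / n) n \<omega>) \<longlonglongrightarrow> occupation T \<omega>"
proof -
  define f where "f n s = (\<Sum>j<n. V (X (real (Suc j) * (T / n)) \<omega>)
      * indicator {real j * (T / n)..<real (Suc j) * (T / n)} s)" for n :: nat and s :: real
  let ?v = "\<lambda>s. V (X s \<omega>) * indicator {0..<T} s"
  have f_eq: "f n s = V (X (real (Suc (nat \<lfloor>s / (T / n)\<rfloor>)) * (T / n)) \<omega>) * indicator {0..<T} s"
    if "n > 0" for n :: nat and s :: real
    unfolding f_def using step_function_value[where h="T / n" and a="\<lambda>j. V (X (real (Suc j) * (T / n)) \<omega>)" and n=n and s=s] T that
    by (auto simp: indicator_def)
  have f_meas: "f n \<in> borel_measurable lborel" for n unfolding f_def by measurable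
  have f_lim: "(\<lambda>n. f n s) \<longlonglongrightarrow> ?v s" for s
  proof (cases "s \<in> {0..<T}")
    case False
    then have "\<forall>\<^sub>F n in sequentially. ?v s = f n s"
      by (intro eventually_sequentiallyI[of 1]) (auto simp: f_eq)
    then show ?thesis by (rule Lim_transform_eventually[OF tendsto_const, rotated])
  next
    case True
    define r where "r n = real (Suc (nat \<lfloor>s / (T / n)\<rfloor>)) * (T / n)" for n :: nat
    have r: "s < r n" "r n \<le> s + T / n" if n: "n > 0" for n
    proof -
      define h where "h = T / n"
      have h: "h > 0" using T n by (simp add: h_def)
      have "s / h \<ge> 0" using True h by simp
      then have k: "real (nat \<lfloor>s / h\<rfloor>) \<le> s / h" "s / h < real (Suc (nat \<lfloor>s / h\<rfloor>))" by linarith+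
      show "s < r n" using k(2) h unfolding r_def h_def[symmetric] by (simp add: pos_divide_less_eq)
      have "real (nat \<lfloor>s / h\<rfloor>) * h \<le> s" using k(1) h by (simp add: pos_le_divide_eq)
      then show "r n \<le> s + T / n" unfolding r_def h_def[symmetric] by (simp add: algebra_simps)
    qed
    have "r \<longlonglongrightarrow> s"
    proof (rule tendsto_sandwich)
      show "(\<lambda>n. s) \<longlonglongrightarrow> s" by simp
      have "(\<lambda>n. s + T / real n) \<longlonglongrightarrow> s + 0" by (intro tendsto_intros lim_const_over_n)
      then show "(\<lambda>n. s + T / real n) \<longlonglongrightarrow> s" by simp
    qed (auto intro!: eventually_sequentiallyI[of 1] less_imp_le[OF r(1)] r(2))
    then have "filterlim r (at_right s) sequentially"
      unfolding filterlim_at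
      by (intro conjI eventually_sequentiallyI[of 1]) (use r(1) in \<open>auto simp: less_imp_neq[THEN not_sym]\<close>)
    then have "\<forall>\<^sub>F n in sequentially. X (r n) \<omega> = X s \<omega>"
      using right_continuous[OF \<omega>, of s] True by (auto dest: filterlim_iff[THEN iffD1])
    moreover have "\<forall>\<^sub>F n in sequentially. n > (0::nat)" by (rule eventually_gt_at_top)
    ultimately have "\<forall>\<^sub>F n in sequentially. ?v s = f n s"
    proof eventually_elim
      case (elim n)
      then show ?case unfolding f_eq[OF elim(2)] r_def by (simp only:)
    qed
    then show ?thesis by (rule Lim_transform_eventually[OF tendsto_const, rotated])
  qed
  have v_meas: "?v \<in> borel_measurable lborel"
    by (rule borel_measurable_LIMSEQ_real[OF f_lim f_meas])
  have dom: "integrable lborel (\<lambda>s. R * indicator {0..<T} s)"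
    by (intro integrable_mult_right integrable_real_indicator) (use T in simp_all)
  have f_dom: "norm (f n s) \<le> R * indicator {0..<T} s" for n :: nat and s :: real
  proof (cases "n = 0")
    case True
    then show ?thesis using R_nonneg by (simp add: f_def)
  next
    case False
    then show ?thesis
      using V_nonneg V_le by (simp add: f_eq abs_mult mult_right_mono)
  qed
  show "integrable lborel ?v"
    by (rule integrable_dominated_convergence[where s=f, OF v_meas f_meas dom])
      (auto simp: f_lim f_dom simp del: real_norm_def)
  have "(\<lambda>n. \<integral>s. f n s \<partial>lborel) \<longlonglongrightarrow> (\<integral>s. ?v s \<partial>lborel)"
    by (rule integral_dominated_convergence[where s=f, OF v_meas f_meas dom])
      (auto simp: f_lim f_dom simp del: real_norm_def)
  moreover have "(\<integral>s. f n s \<partial>lborel) = riemann_sum (T / n) n \<omega>" for n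
  proof -
    have "(\<integral>s. f n s \<partial>lborel) = (\<Sum>j<n. V (X (real (Suc j) * (T / n)) \<omega>) * (T / n))"
      unfolding f_def using T by (subst Bochner_Integration.integral_sum) (auto simp: field_simps)
    then show ?thesis by (simp add: riemann_sum_def sum_distrib_left mult.commute)
  qed
  ultimately show "(\<lambda>n. riemann_sum (T / n) n \<omega>) \<longlonglongrightarrow> occupation T \<omega>"
    by (simp add: occupation_def)
qed

lemma riemann_sum_measurable: "0 \<le> h \<Longrightarrow> riemann_sum h n \<in> borel_measurable (P x)"
  unfolding riemann_sum_def
  by (intro borel_measurable_times borel_measurable_const borel_measurable_sum
      measurable_compose[OF measurable_X]) auto

lemma riemann_sum_nonneg: "0 \<le> h \<Longrightarrow> 0 \<le> riemann_sum h n \<omega>"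
  unfolding riemann_sum_def by (intro mult_nonneg_nonneg sum_nonneg V_nonneg)

lemma occupation_measurable: "0 < T \<Longrightarrow> occupation T \<in> borel_measurable (P x)"
  by (rule borel_measurable_LIMSEQ_real[OF path_occupation(2) riemann_sum_measurable]) auto

lemma occupation_nonneg: "0 \<le> occupation T \<omega>"
  unfolding occupation_def by (intro integral_nonneg_AE) (simp add: V_nonneg)

definition killed_step :: "real \<Rightarrow> ('a \<Rightarrow> real) \<Rightarrow> 'a \<Rightarrow> real" where
  "killed_step h g = evolve h (\<lambda>y. exp (- h * V y) * g y)"

lemma kill_factor: "0 \<le> h \<Longrightarrow> \<bar>g y\<bar> \<le> B \<Longrightarrow> \<bar>exp (- h * V y) * g y\<bar> \<le> B"
  using mult_mono[of "exp (- h * V y)" 1 "\<bar>g y\<bar>" B] V_nonneg[of y] by (simp add: abs_mult)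

lemma killed_step_bound: "0 \<le> h \<Longrightarrow> (\<And>y. \<bar>g y\<bar> \<le> B) \<Longrightarrow> \<bar>killed_step h g x\<bar> \<le> B"
  unfolding killed_step_def by (intro evolve_bound kill_factor)

lemma killed_step_diff:
  assumes h: "0 \<le> h" and f: "\<And>y. \<bar>f y\<bar> \<le> A" and g: "\<And>y. \<bar>g y\<bar> \<le> B"
    and fg: "\<And>y. \<bar>f y - g y\<bar> \<le> e"
  shows "\<bar>killed_step h f x - killed_step h g x\<bar> \<le> e"
proof -
  have "killed_step h f x - killed_step h g x = killed_step h (\<lambda>y. f y - g y) x"
    unfolding killed_step_def right_diff_distrib
    by (rule evolve_diff[OF kill_factor[OF h f] kill_factor[OF h g], symmetric])
  then show ?thesis using killed_step_bound[OF h fg] by simp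
qed

text \<open>
  The discrete Feynman--Kac formula: conditioning on the states up to time \<open>k * h\<close> replaces the last
  factor \<open>exp (- h * V) * g\<close> by \<open>killed_step h g\<close> one time step earlier.
\<close>

lemma expectation_riemann_sum:
  assumes h: "0 < h" and g: "\<And>y. \<bar>g y\<bar> \<le> B"
  shows "(\<integral>\<omega>. exp (- riemann_sum h k \<omega>) * g (X (real k * h) \<omega>) \<partial>P x) = (killed_step h ^^ k) g x"
  using g
proof (induction k arbitrary: g)
  case 0
  then show ?case by (simp add: riemann_sum_def expectation_start)
next
  case (Suc k)
  \<comment> \<open>Time \<open>0\<close> is included so that the history is nonempty for \<open>k = 0\<close>.\<close>
  define ts where "ts = map (\<lambda>j. real j * h) [0..<Suc k]"
  define \<Psi> where "\<Psi> cs = exp (- h * (\<Sum>j<k. V (cs ! Suc j)))" for cs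
  define G where "G y = exp (- h * V y) * g y" for y
  have ts_k: "ts ! k = real k * h" unfolding ts_def by (subst nth_map) (auto simp del: upt_Suc)
  have dist: "distinct ts" unfolding ts_def using h by (auto simp: distinct_map inj_on_def simp del: upt_Suc)
  have len: "k < length ts" by (simp add: ts_def)
  have range: "set ts \<subseteq> {0..ts ! k}"
    unfolding ts_k unfolding ts_def using h by (auto simp del: upt_Suc)
  have hist: "map (\<lambda>r. X r \<omega>) ts ! j = X (real j * h) \<omega>" if "j \<le> k" for j \<omega>
    using that unfolding ts_def by (simp del: upt_Suc add: nth_map)
  have \<Psi>_eq: "\<Psi> (map (\<lambda>r. X r \<omega>) ts) = exp (- riemann_sum h k \<omega>)" for \<omega>
    unfolding \<Psi>_def riemann_sum_def using hist by (simp add: Suc_leI)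
  have \<Psi>_bound: "\<bar>\<Psi> cs\<bar> \<le> 1" for cs
    unfolding \<Psi>_def using h V_nonneg by (simp add: sum_nonneg)
  have G: "\<bar>G y\<bar> \<le> B" for y unfolding G_def using h Suc.prems by (intro kill_factor) auto
  have "exp (- riemann_sum h (Suc k) \<omega>) * g (X (real (Suc k) * h) \<omega>)
      = \<Psi> (map (\<lambda>r. X r \<omega>) ts) * G (X (ts ! k + h) \<omega>)" for \<omega>
    unfolding \<Psi>_eq G_def ts_k
    by (simp add: riemann_sum_def distrib_left distrib_right exp_add[symmetric] exp_diff exp_minus
        field_simps)
  then have "(\<integral>\<omega>. exp (- riemann_sum h (Suc k) \<omega>) * g (X (real (Suc k) * h) \<omega>) \<partial>P x)
      = (\<integral>\<omega>. \<Psi> (map (\<lambda>r. X r \<omega>) ts) * G (X (ts ! k + h) \<omega>) \<partial>P x)" by simp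
  also have "\<dots> = (\<integral>\<omega>. \<Psi> (map (\<lambda>r. X r \<omega>) ts) * evolve h G (X (ts ! k) \<omega>) \<partial>P x)"
    using h by (intro markov_expectation[OF dist len range _ \<Psi>_bound G]) simp
  also have "\<dots> = (\<integral>\<omega>. exp (- riemann_sum h k \<omega>) * killed_step h g (X (real k * h) \<omega>) \<partial>P x)"
    unfolding \<Psi>_eq ts_k killed_step_def G_def ..
  also have "\<dots> = (killed_step h ^^ k) (killed_step h g) x"
    using h Suc.prems by (intro Suc.IH killed_step_bound) auto
  also have "\<dots> = (killed_step h ^^ Suc k) g x" by (simp add: funpow_swap1)
  finally show ?case .
qed

lemma exp_minus_quadratic:
  fixes u :: real
  assumes "0 \<le> u"
  shows "0 \<le> exp (- u) - (1 - u)" "exp (- u) - (1 - u) \<le> u\<^sup>2"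
proof -
  show "0 \<le> exp (- u) - (1 - u)" using exp_ge_add_one_self[of "- u"] by simp
  have "exp (- u) * (1 + u) \<le> exp (- u) * exp u"
    using exp_ge_add_one_self[of u] by (intro mult_left_mono) auto
  also have "\<dots> = 1" by (simp add: exp_minus)
  also have "1 \<le> (1 - u + u\<^sup>2) * (1 + u)" using assms by (simp add: algebra_simps power2_eq_square)
  finally have "exp (- u) \<le> 1 - u + u\<^sup>2"
    using assms by (simp add: mult_le_cancel_right_pos add_nonneg_pos)
  then show "exp (- u) - (1 - u) \<le> u\<^sup>2" by simp
qed

lemma killed_step_second_order:
  assumes g: "\<And>y. \<bar>g y\<bar> \<le> 1" and h: "0 < h"
  shows "\<bar>killed_step h g x - (g x + h * (Q g x - V x * g x))\<bar> \<le> 7 * R\<^sup>2 * h\<^sup>2"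
proof -
  have Vg: "\<bar>V y * g y\<bar> \<le> R" for y
    using mult_mono[OF V_le[of y] g[of y]] V_nonneg[of y] R_nonneg by (simp add: abs_mult)
  have hVg: "\<bar>h * (V y * g y)\<bar> \<le> h * R" for y
    using mult_left_mono[OF Vg[of y], of h] h by (simp add: abs_mult)
  have lin: "\<bar>g y - h * (V y * g y)\<bar> \<le> 1 + h * R" for y
    using g[of y] hVg[of y] by linarith
  have eg: "\<bar>exp (- h * V y) * g y\<bar> \<le> 1" for y
    using kill_factor[OF less_imp_le[OF h] g] .
  have rem: "\<bar>exp (- h * V y) * g y - (g y - h * (V y * g y))\<bar> \<le> (h * R)\<^sup>2" for y
  proof -
    have u: "0 \<le> h * V y" "h * V y \<le> h * R"
      using h V_nonneg[of y] V_le[of y] by (auto intro: mult_left_mono)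
    have "\<bar>exp (- (h * V y)) - (1 - h * V y)\<bar> \<le> (h * V y)\<^sup>2"
      using exp_minus_quadratic[OF u(1)] by simp
    also have "\<dots> \<le> (h * R)\<^sup>2" using u by (intro power_mono)
    finally have "\<bar>exp (- (h * V y)) - (1 - h * V y)\<bar> * \<bar>g y\<bar> \<le> (h * R)\<^sup>2 * 1"
      using g[of y] by (intro mult_mono) auto
    then show ?thesis by (simp add: abs_mult[symmetric] algebra_simps)
  qed
  have 1: "\<bar>killed_step h g x - evolve h (\<lambda>y. g y - h * (V y * g y)) x\<bar> \<le> (h * R)\<^sup>2"
    unfolding killed_step_def evolve_diff[OF eg lin, symmetric] by (rule evolve_bound[OF rem])
  have 2: "evolve h (\<lambda>y. g y - h * (V y * g y)) x = evolve h g x - h * evolve h (\<lambda>y. V y * g y) x"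
    unfolding evolve_diff[OF g hVg] evolve_cmult ..
  have 3: "\<bar>evolve h g x - g x - h * Q g x\<bar> \<le> 4 * 1 * (R * h)\<^sup>2"
    by (rule evolve_second_order[OF g h])
  have "\<bar>evolve h (\<lambda>y. V y * g y) x - V x * g x\<bar> \<le> 2 * R * (R * h)"
    by (rule evolve_first_order[where g="\<lambda>y. V y * g y", OF Vg]) (use h in simp)
  then have "h * \<bar>evolve h (\<lambda>y. V y * g y) x - V x * g x\<bar> \<le> h * (2 * R * (R * h))"
    using h by (intro mult_left_mono) auto
  then have 4: "\<bar>h * evolve h (\<lambda>y. V y * g y) x - h * (V x * g x)\<bar> \<le> 2 * (R * h)\<^sup>2"
  proof -
    have "\<bar>h * a - h * b\<bar> = h * \<bar>a - b\<bar>" for a b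
      unfolding right_diff_distrib[symmetric] abs_mult using h by simp
    moreover have "h * (2 * R * (R * h)) = 2 * (R * h)\<^sup>2" by (simp add: power2_eq_square)
    ultimately show ?thesis using \<open>h * \<bar>evolve h (\<lambda>y. V y * g y) x - V x * g x\<bar> \<le> h * (2 * R * (R * h))\<close>
      by simp
  qed
  have 5: "7 * R\<^sup>2 * h\<^sup>2 = 7 * (R * h)\<^sup>2" "(h * R)\<^sup>2 = (R * h)\<^sup>2"
    by (simp_all add: power_mult_distrib)
  have 6: "h * (Q g x - V x * g x) = h * Q g x - h * (V x * g x)" by (simp add: right_diff_distrib)
  show ?thesis using 1 3 4 unfolding 2 5 6 by linarith
qed

text \<open>
  By \<open>killed_step_second_order\<close> one step of \<open>killed_step h\<close> agrees with the evolution of \<open>d\<close> up to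
  order \<open>h\<^sup>2\<close>, and the steps are contractions.  Thus \<open>n\<close> steps of length \<open>T / n\<close>, started from \<open>d 0 = 1\<close>,
  approximate \<open>d T\<close>; by the discrete formula they equal expectations of exponentials of Riemann sums.
\<close>

lemma feynman_kac:
  fixes d :: "real \<Rightarrow> 'a \<Rightarrow> real"
  assumes d: "\<And>t x. 0 \<le> t \<Longrightarrow> 0 \<le> d t x" "\<And>t x. 0 \<le> t \<Longrightarrow> d t x \<le> 1" "\<And>x. d 0 x = 1"
    and step: "\<And>t h x. 0 \<le> t \<Longrightarrow> 0 < h \<Longrightarrow>
      \<bar>d (t + h) x - d t x - h * (Q (d t) x - V x * d t x)\<bar> \<le> C * h\<^sup>2"
    and T: "0 < T"
  shows "d T x = (\<integral>\<omega>. exp (- occupation T \<omega>) \<partial>P x)"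
proof -
  interpret P: prob_space "P x" by (rule prob)
  define C' where "C' = C + 7 * R\<^sup>2"
  have d': "\<bar>d t y\<bar> \<le> 1" if "0 \<le> t" for t :: real and y using d(1,2)[OF that, of y] by simp
  have one: "\<bar>killed_step h (d t) y - d (t + h) y\<bar> \<le> C' * h\<^sup>2" if "0 \<le> t" "0 < h" for t h :: real and y
    using killed_step_second_order[where g="d t" and x=y, OF d'[OF that(1)] that(2)] step[OF that, of y]
    unfolding C'_def distrib_right by linarith
  have iter: "\<bar>(killed_step h ^^ k) (\<lambda>_. 1) y\<bar> \<le> 1 \<and> \<bar>(killed_step h ^^ k) (\<lambda>_. 1) y - d (k * h) y\<bar> \<le> k * (C' * h\<^sup>2)"
    if h: "0 < h" for h :: real and k :: nat and y
  proof (induction k arbitrary: y)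
    case 0
    then show ?case by (simp add: d)
  next
    case (Suc k)
    let ?f = "(killed_step h ^^ k) (\<lambda>_. 1)"
    have kh: "0 \<le> k * h" using h by simp
    have "\<bar>killed_step h ?f y\<bar> \<le> 1" using h Suc by (intro killed_step_bound) auto
    moreover have "\<bar>killed_step h ?f y - killed_step h (d (k * h)) y\<bar> \<le> k * (C' * h\<^sup>2)"
      using h Suc d'[OF kh] by (intro killed_step_diff[where A=1 and B=1]) auto
    moreover have "\<bar>killed_step h (d (k * h)) y - d (k * h + h) y\<bar> \<le> C' * h\<^sup>2" by (rule one[OF kh h])
    moreover have "real (Suc k) * h = k * h + h" "real (Suc k) * (C' * h\<^sup>2) = k * (C' * h\<^sup>2) + C' * h\<^sup>2"
      by (simp_all add: algebra_simps)
    ultimately show ?case by simp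
  qed
  have close: "\<bar>(\<integral>\<omega>. exp (- riemann_sum (T / n) n \<omega>) \<partial>P x) - d T x\<bar> \<le> C' * T\<^sup>2 / n" if n: "n > 0" for n :: nat
  proof -
    have h: "0 < T / n" using T n by simp
    have "(\<integral>\<omega>. exp (- riemann_sum (T / n) n \<omega>) \<partial>P x) = (killed_step (T / n) ^^ n) (\<lambda>_. 1) x"
      using expectation_riemann_sum[OF h, where g="\<lambda>_. 1" and B=1 and k=n and x=x] by simp
    moreover have "n * (C' * (T / n)\<^sup>2) = C' * T\<^sup>2 / n"
      using n by (simp add: power2_eq_square)
    ultimately show ?thesis using iter[OF h, of n x] n by simp
  qed
  have "(\<lambda>n. (\<integral>\<omega>. exp (- riemann_sum (T / n) n \<omega>) \<partial>P x) - d T x) \<longlonglongrightarrow> 0"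
  proof (rule Lim_null_comparison)
    show "\<forall>\<^sub>F n in sequentially. norm ((\<integral>\<omega>. exp (- riemann_sum (T / n) n \<omega>) \<partial>P x) - d T x) \<le> C' * T\<^sup>2 / real n"
      by (intro eventually_sequentiallyI[of 1]) (use close in auto)
    show "(\<lambda>n. C' * T\<^sup>2 / real n) \<longlonglongrightarrow> 0" by (rule lim_const_over_n)
  qed
  then have 1: "(\<lambda>n. \<integral>\<omega>. exp (- riemann_sum (T / n) n \<omega>) \<partial>P x) \<longlonglongrightarrow> d T x"
    by (rule Lim_null[THEN iffD2])
  have 2: "(\<lambda>n. \<integral>\<omega>. exp (- riemann_sum (T / n) n \<omega>) \<partial>P x) \<longlonglongrightarrow> (\<integral>\<omega>. exp (- occupation T \<omega>) \<partial>P x)"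
  proof (rule integral_dominated_convergence[where w="\<lambda>_. 1"])
    show "(\<lambda>\<omega>. exp (- occupation T \<omega>)) \<in> borel_measurable (P x)"
      using occupation_measurable[OF T] by measurable
    show "(\<lambda>\<omega>. exp (- riemann_sum (T / n) n \<omega>)) \<in> borel_measurable (P x)" for n
    proof -
      have "riemann_sum (T / n) n \<in> borel_measurable (P x)"
        using T by (intro riemann_sum_measurable) simp
      then show ?thesis by measurable
    qed
    show "AE \<omega> in P x. (\<lambda>n. exp (- riemann_sum (T / n) n \<omega>)) \<longlonglongrightarrow> exp (- occupation T \<omega>)"
      by (intro AE_I2 tendsto_intros path_occupation(2)[OF _ T])
    show "AE \<omega> in P x. norm (exp (- riemann_sum (T / n) n \<omega>)) \<le> 1" for n
      using riemann_sum_nonneg T by simp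
  qed simp
  show ?thesis using LIMSEQ_unique[OF 1 2] .
qed

definition total_noise :: "'w \<Rightarrow> ennreal" where
  "total_noise \<omega> = (\<integral>\<^sup>+t\<in>{0..}. ennreal (V (X t \<omega>)) \<partial>lborel)"

lemma total_noise_SUP:
  assumes \<omega>: "\<omega> \<in> space (P x)"
  shows "total_noise \<omega> = (SUP n. ennreal (occupation (Suc n) \<omega>))"
proof -
  let ?v = "\<lambda>n s. V (X s \<omega>) * indicator {0..<real (Suc n)} s"
  have int: "integrable lborel (?v n)" for n by (rule path_occupation(1)[OF \<omega>]) simp
  have "(SUP n. ennreal (?v n s)) = ennreal (V (X s \<omega>)) * indicator {0..} s" for s
  proof (rule antisym)
    show "(SUP n. ennreal (?v n s)) \<le> ennreal (V (X s \<omega>)) * indicator {0..} s"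
      by (rule SUP_least) (auto simp: indicator_def)
    obtain n :: nat where "s < n" using reals_Archimedean2 by blast
    then have "ennreal (V (X s \<omega>)) * indicator {0..} s = ennreal (?v n s)"
      by (auto simp: indicator_def)
    then show "ennreal (V (X s \<omega>)) * indicator {0..} s \<le> (SUP n. ennreal (?v n s))"
      by (simp only:) (rule SUP_upper, simp)
  qed
  then have "total_noise \<omega> = (\<integral>\<^sup>+s. (SUP n. ennreal (?v n s)) \<partial>lborel)"
    by (simp add: total_noise_def)
  also have "\<dots> = (SUP n. \<integral>\<^sup>+s. ennreal (?v n s) \<partial>lborel)"
  proof (rule nn_integral_monotone_convergence_SUP)
    show "incseq (\<lambda>n s. ennreal (?v n s))"
      by (intro incseq_SucI le_funI ennreal_leI mult_left_mono V_nonneg) (auto simp: indicator_def)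
    show "(\<lambda>s. ennreal (?v n s)) \<in> borel_measurable lborel" for n
      using int[of n] by measurable
  qed
  also have "\<dots> = (SUP n. ennreal (occupation (Suc n) \<omega>))"
    unfolding occupation_def by (subst nn_integral_eq_integral[OF int]) (auto simp: V_nonneg)
  finally show ?thesis .
qed

lemma occupation_mono:
  assumes \<omega>: "\<omega> \<in> space (P x)" and "0 < s" "s \<le> t"
  shows "occupation s \<omega> \<le> occupation t \<omega>"
  unfolding occupation_def using assms
  by (intro integral_mono path_occupation(1)[OF \<omega>]) (auto simp: indicator_def V_nonneg)

lemma total_noise_limit:
  assumes \<omega>: "\<omega> \<in> space (P x)"
  shows "(\<lambda>n. ennreal (occupation (Suc n) \<omega>)) \<longlonglongrightarrow> total_noise \<omega>"
  unfolding total_noise_SUP[OF \<omega>]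
  by (intro LIMSEQ_SUP incseq_SucI ennreal_leI occupation_mono[OF \<omega>]) auto

text \<open>
  The limit of \<open>exp (- occupation T \<omega>)\<close> as \<open>T\<close> tends to infinity, with \<open>exp (- \<infinity>) = 0\<close>; the case
  distinction is needed since \<open>enn2real \<infinity> = 0\<close>.
\<close>

definition survival :: "'w \<Rightarrow> real" where
  "survival \<omega> = (if total_noise \<omega> = \<infinity> then 0 else exp (- enn2real (total_noise \<omega>)))"

lemma survival_limit:
  assumes \<omega>: "\<omega> \<in> space (P x)"
  shows "(\<lambda>n. exp (- occupation (Suc n) \<omega>)) \<longlonglongrightarrow> survival \<omega>"
proof (cases "total_noise \<omega> = \<infinity>")
  case True
  have "filterlim (\<lambda>n. occupation (Suc n) \<omega>) at_top sequentially"
    unfolding filterlim_at_top_dense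
  proof
    fix Z :: real
    have "\<forall>\<^sub>F n in sequentially. ennreal (max Z 0) < ennreal (occupation (Suc n) \<omega>)"
      by (rule order_tendstoD(1)[OF total_noise_limit[OF \<omega>]]) (simp add: True)
    then show "\<forall>\<^sub>F n in sequentially. Z < occupation (Suc n) \<omega>"
    proof eventually_elim
      case (elim n)
      then have "max Z 0 < occupation (Suc n) \<omega>" by (subst (asm) ennreal_less_iff) auto
      then show ?case by simp
    qed
  qed
  then have "((\<lambda>n. exp (- occupation (Suc n) \<omega>)) \<longlonglongrightarrow> 0)"
    by (intro filterlim_compose[OF exp_at_bot] filterlim_compose[OF filterlim_uminus_at_bot_at_top])
  then show ?thesis by (simp add: survival_def True)
next
  case False
  then obtain r where r: "total_noise \<omega> = ennreal r" "0 \<le> r" by (cases "total_noise \<omega>") auto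
  have "(\<lambda>n. occupation (Suc n) \<omega>) \<longlonglongrightarrow> r"
    by (rule tendsto_ennrealD[OF total_noise_limit[OF \<omega>, unfolded r(1)]])
      (auto simp: occupation_nonneg r(2))
  then show ?thesis using False by (auto simp: survival_def r intro!: tendsto_intros)
qed

lemma survival_vanishes_iff:
  "((\<lambda>n. \<integral>\<omega>. exp (- occupation (Suc n) \<omega>) \<partial>P x) \<longlonglongrightarrow> 0)
    \<longleftrightarrow> measure (P x) {\<omega> \<in> space (P x). total_noise \<omega> = \<infinity>} = 1"
proof -
  interpret P: prob_space "P x" by (rule prob)
  have occ: "(\<lambda>\<omega>. exp (- occupation (Suc n) \<omega>)) \<in> borel_measurable (P x)" for n
    using occupation_measurable[of "Suc n" x] by measurable
  have surv: "survival \<in> borel_measurable (P x)"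
    by (rule borel_measurable_LIMSEQ_real[OF survival_limit occ])
  have lim: "(\<lambda>n. \<integral>\<omega>. exp (- occupation (Suc n) \<omega>) \<partial>P x) \<longlonglongrightarrow> (\<integral>\<omega>. survival \<omega> \<partial>P x)"
  proof (rule integral_dominated_convergence[OF surv occ, where w="\<lambda>_. 1"])
    show "AE \<omega> in P x. (\<lambda>n. exp (- occupation (Suc n) \<omega>)) \<longlonglongrightarrow> survival \<omega>"
      by (intro AE_I2 survival_limit)
    show "AE \<omega> in P x. norm (exp (- occupation (Suc n) \<omega>)) \<le> 1" for n
      using occupation_nonneg by simp
  qed simp
  have int: "integrable (P x) survival"
    by (rule P.integrable_const_bound[where B=1]) (auto simp: survival_def surv)
  have zero: "survival \<omega> = 0 \<longleftrightarrow> total_noise \<omega> = \<infinity>" for \<omega> by (simp add: survival_def)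
  have set: "{\<omega> \<in> space (P x). total_noise \<omega> = \<infinity>} \<in> sets (P x)"
    using surv unfolding zero[symmetric] by measurable
  have "((\<lambda>n. \<integral>\<omega>. exp (- occupation (Suc n) \<omega>) \<partial>P x) \<longlonglongrightarrow> 0) \<longleftrightarrow> (\<integral>\<omega>. survival \<omega> \<partial>P x) = 0"
    using lim LIMSEQ_unique by metis
  also have "\<dots> \<longleftrightarrow> (AE \<omega> in P x. survival \<omega> = 0)"
    by (rule integral_nonneg_eq_0_iff_AE[OF int]) (simp add: survival_def)
  also have "\<dots> \<longleftrightarrow> (AE \<omega> in P x. \<omega> \<in> {\<omega> \<in> space (P x). total_noise \<omega> = \<infinity>})"
    by (intro AE_cong) (simp add: zero)
  also have "\<dots> \<longleftrightarrow> measure (P x) {\<omega> \<in> space (P x). total_noise \<omega> = \<infinity>} = 1"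
    by (rule P.AE_in_set_eq_1[OF set])
  finally show ?thesis .
qed

text \<open>
  The expectation is nonincreasing in \<open>T\<close>, so its limit can be computed along the integers.
\<close>

lemma killing_probability_one_iff:
  "((\<lambda>T. \<integral>\<omega>. exp (- occupation T \<omega>) \<partial>P x) \<longlongrightarrow> 0) at_top
    \<longleftrightarrow> measure (P x) {\<omega> \<in> space (P x). total_noise \<omega> = \<infinity>} = 1"
  (is "(?E \<longlongrightarrow> 0) at_top \<longleftrightarrow> _")
proof -
  interpret P: prob_space "P x" by (rule prob)
  have "(?E \<longlongrightarrow> 0) at_top \<longleftrightarrow> ((\<lambda>n. ?E (real (Suc n))) \<longlonglongrightarrow> 0)"
  proof
    assume "(?E \<longlongrightarrow> 0) at_top"
    then show "(\<lambda>n. ?E (real (Suc n))) \<longlonglongrightarrow> 0"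
      by (rule filterlim_compose) (rule filterlim_compose[OF filterlim_real_sequentially filterlim_Suc])
  next
    assume lim: "(\<lambda>n. ?E (real (Suc n))) \<longlonglongrightarrow> 0"
    have int: "integrable (P x) (\<lambda>\<omega>. exp (- occupation t \<omega>))" if "0 < t" for t
    proof (rule P.integrable_const_bound[where B=1])
      show "(\<lambda>\<omega>. exp (- occupation t \<omega>)) \<in> borel_measurable (P x)"
        using occupation_measurable[OF that, of x] by measurable
    qed (simp add: occupation_nonneg)
    have anti: "?E t \<le> ?E s" if "0 < s" "s \<le> t" for s t
      using that by (intro integral_mono int) (auto intro: occupation_mono)
    show "(?E \<longlongrightarrow> 0) at_top"
    proof (rule tendstoI)
      fix e :: real assume "e > 0"
      then have "\<forall>\<^sub>F n in sequentially. ?E (real (Suc n)) < e" using lim by (intro order_tendstoD(2))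
      then obtain n where n: "?E (real (Suc n)) < e" by (auto simp: eventually_sequentially)
      have "dist (?E t) 0 < e" if "t \<ge> real (Suc n)" for t
      proof -
        have "?E t \<le> ?E (real (Suc n))" using that by (intro anti) auto
        moreover have "0 \<le> ?E t" by simp
        ultimately show ?thesis using n by simp
      qed
      then show "\<forall>\<^sub>F t in at_top. dist (?E t) 0 < e"
        unfolding eventually_at_top_linorder by blast
    qed
  qed
  then show ?thesis using survival_vanishes_iff by simp
qed

end

section \<open>Measures on the configuration space\<close>

text \<open>
  The induction principle behind all extensions from products of coordinates to continuous functions:
  truncating a configuration to a large finite set of sites changes \<open>f\<close> uniformly little.
\<close>

lemma continuous_induct_occ [consumes 1]:
  fixes f :: "'a::countable config \<Rightarrow> real"
  assumes f: "continuous_on UNIV f"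
    and occ: "\<And>A. finite A \<Longrightarrow> C (occ A)"
    and add: "\<And>f g. C f \<Longrightarrow> C g \<Longrightarrow> C (\<lambda>\<eta>. f \<eta> + g \<eta>)"
    and scale: "\<And>f c. C f \<Longrightarrow> C (\<lambda>\<eta>. c * f \<eta>)"
    and limit: "\<And>f. continuous_on UNIV f \<Longrightarrow>
      (\<And>\<epsilon>. \<epsilon> > 0 \<Longrightarrow> \<exists>g. C g \<and> (\<forall>\<eta>. \<bar>f \<eta> - g \<eta>\<bar> \<le> \<epsilon>)) \<Longrightarrow> C f"
  shows "C f"
proof (rule limit[OF f])
  fix \<epsilon> :: real assume "\<epsilon> > 0"
  then obtain A where A: "finite A" "\<And>\<eta> \<zeta>. (\<forall>x\<in>A. \<eta> x = \<zeta> x) \<Longrightarrow> \<bar>f \<eta> - f \<zeta>\<bar> < \<epsilon>"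
    using uniformly_finitely_dependent[OF f] by blast
  define g where "g \<eta> = f (\<lambda>x. x \<in> A \<and> \<eta> x)" for \<eta>
  have "C g"
  proof (rule finitely_dependent_in_occ_span[of C, OF occ add scale A(1)])
    show "g \<eta> = g \<zeta>" if "\<forall>x\<in>A. \<eta> x = \<zeta> x" for \<eta> \<zeta>
    proof -
      have "(\<lambda>x. x \<in> A \<and> \<eta> x) = (\<lambda>x. x \<in> A \<and> \<zeta> x)" using that by auto
      then show ?thesis unfolding g_def by simp
    qed
  qed
  moreover have "\<bar>f \<eta> - g \<eta>\<bar> \<le> \<epsilon>" for \<eta>
    unfolding g_def by (rule less_imp_le[OF A(2)]) auto
  ultimately show "\<exists>g. C g \<and> (\<forall>\<eta>. \<bar>f \<eta> - g \<eta>\<bar> \<le> \<epsilon>)" by blast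
qed

text \<open>
  Indicators of clopen sets are continuous, so a functional on continuous functions determines the
  measures of these sets, and they generate the Borel sets.
\<close>

definition clopens :: "'a config set set" where
  "clopens = {C. open C \<and> closed C}"

lemma cylinder_clopen:
  assumes "finite A" shows "cylinder A \<eta> \<in> clopens"
proof -
  have "- cylinder A \<eta> = (\<Union>x\<in>A. {\<zeta>. \<zeta> x = (\<not> \<eta> x)})" by (auto simp: cylinder_def)
  then have "open (- cylinder A \<eta>)" by (simp add: open_UN clopen_coordinate)
  then show ?thesis using open_cylinder[OF assms] by (simp add: clopens_def closed_def)
qed

lemma continuous_indicator_clopen:
  assumes "C \<in> clopens" shows "continuous_on UNIV (indicat_real C)"
  unfolding continuous_on_open_vimage[OF open_UNIV]
proof (intro allI impI)
  fix B :: "real set"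
  have "indicat_real C -` B = (if 1 \<in> B then C else {}) \<union> (if 0 \<in> B then - C else {})"
    by (auto simp: indicator_def of_bool_def split: if_splits)
  then show "open (indicat_real C -` B \<inter> UNIV)"
    using assms by (simp add: clopens_def closed_def open_Un)
qed

lemma sigma_sets_clopens: "sigma_sets UNIV clopens = sets (borel :: 'a::countable config measure)"
proof -
  have "sets (borel :: 'a config measure) = sigma_sets UNIV {S. open S}"
    by (simp add: borel_def)
  moreover have "sigma_sets UNIV clopens \<subseteq> sigma_sets UNIV {S :: 'a config set. open S}"
    by (rule sigma_sets_mono') (auto simp: clopens_def)
  moreover have "sigma_sets UNIV {S :: 'a config set. open S} \<subseteq> sigma_sets UNIV clopens"
  proof (rule sigma_sets_mono, rule subsetI)
    fix S :: "'a config set" assume "S \<in> {S. open S}"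
    then have S: "open S" by simp
    \<comment> \<open>The cylinders inside \<open>S\<close>, indexed by a countable set: \<open>A\<close> are the sites that are fixed and \<open>B\<close> are the occupied ones.\<close>
    define I where "I = {(A, B). finite A \<and> finite B \<and> cylinder A (\<lambda>x. x \<in> B) \<subseteq> S}"
    have "countable (Collect (finite :: 'a set \<Rightarrow> bool) \<times> Collect (finite :: 'a set \<Rightarrow> bool))"
      by (intro countable_SIGMA countable_Collect_finite)
    then have "countable I" by (rule countable_subset[rotated]) (auto simp: I_def)
    have eq: "S = (\<Union>(A, B)\<in>I. cylinder A (\<lambda>x. x \<in> B))"
    proof (intro equalityI subsetI)
      fix \<eta> assume "\<eta> \<in> S"
      from open_contains_cylinder[OF S this] obtain A where A: "finite A" "cylinder A \<eta> \<subseteq> S" by blast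
      have "cylinder A (\<lambda>x. x \<in> {x\<in>A. \<eta> x}) = cylinder A \<eta>" by (auto simp: cylinder_def)
      then have "(A, {x\<in>A. \<eta> x}) \<in> I" "\<eta> \<in> cylinder A (\<lambda>x. x \<in> {x\<in>A. \<eta> x})"
        using A by (auto simp: I_def) (auto simp: cylinder_def)
      then show "\<eta> \<in> (\<Union>(A, B)\<in>I. cylinder A (\<lambda>x. x \<in> B))" by blast
    qed (auto simp: I_def)
    have "(\<Union>p\<in>I. case p of (A, B) \<Rightarrow> cylinder A (\<lambda>x. x \<in> B)) \<in> sigma_sets UNIV clopens"
      by (rule sigma_sets_UNION) (use \<open>countable I\<close> cylinder_clopen in \<open>auto simp: I_def\<close>)
    then show "S \<in> sigma_sets UNIV clopens" using eq by simp
  qed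
  ultimately show ?thesis by blast
qed

lemma Int_stable_clopens: "Int_stable clopens"
  by (auto simp: Int_stable_def clopens_def)

lemma prob_eqI_continuous:
  fixes M N :: "'a::countable config measure"
  assumes M: "prob_space M" "sets M = sets borel" and N: "prob_space N" "sets N = sets borel"
    and eq: "\<And>f :: 'a config \<Rightarrow> real. continuous_on UNIV f \<Longrightarrow> (\<integral>\<eta>. f \<eta> \<partial>M) = (\<integral>\<eta>. f \<eta> \<partial>N)"
  shows "M = N"
proof -
  interpret M: prob_space M by fact
  interpret N: prob_space N by fact
  show ?thesis
  proof (rule measure_eqI_generator_eq[OF Int_stable_clopens])
    fix C :: "'a config set" assume C: "C \<in> clopens"
    then have "C \<in> sets borel" by (auto simp: clopens_def)
    then have "measure M C = measure N C"
      using eq[OF continuous_indicator_clopen[OF C]] M(2) N(2) by simp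
    then show "emeasure M C = emeasure N C"
      by (simp add: M.emeasure_eq_measure N.emeasure_eq_measure)
  next
    show "range (\<lambda>_::nat. UNIV) \<subseteq> (clopens :: 'a config set set)" by (auto simp: clopens_def)
    show "emeasure M UNIV \<noteq> \<infinity>" by simp
  qed (auto simp: sigma_sets_clopens M(2) N(2))
qed

text \<open>
  Because of this form of compactness, finitely additive set functions on the clopen sets
  are countably additive.
\<close>

lemma compact_decseq_empty:
  fixes C :: "nat \<Rightarrow> 'a config set"
  assumes C: "\<And>n. closed (C n)" "decseq C" "(\<Inter>n. C n) = {}"
  obtains N where "C N = {}"
proof -
  have "UNIV \<subseteq> (\<Union>n. - C n)" using C(3) by blast
  then obtain F where F: "finite F" "UNIV \<subseteq> (\<Union>n\<in>F. - C n)"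
    using compactE_image[OF compact_configs, of UNIV "\<lambda>n. - C n"] C(1) by (metis open_Compl)
  have sub: "C (Max (insert 0 F)) \<subseteq> C n" if "n \<in> F" for n
    by (rule decseqD[OF C(2)]) (simp add: F(1) that)
  have "\<eta> \<notin> C (Max (insert 0 F))" for \<eta>
  proof -
    obtain n where "n \<in> F" "\<eta> \<notin> C n" using F(2) by auto
    then show ?thesis using sub by blast
  qed
  then have "C (Max (insert 0 F)) = {}" by blast
  then show thesis using that by blast
qed

text \<open>
  The Riesz representation theorem for configurations.  The values of \<open>\<Lambda>\<close> on indicators of clopen sets
  extend to a measure by Caratheodory's theorem, whose continuity condition at the empty set
  concerns sequences that are eventually empty.
\<close>

lemma riesz_configs:
  fixes \<Lambda> :: "('a::countable config \<Rightarrow> real) \<Rightarrow> real"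
  assumes add: "\<And>f g. continuous_on UNIV f \<Longrightarrow> continuous_on UNIV g \<Longrightarrow> \<Lambda> (\<lambda>\<eta>. f \<eta> + g \<eta>) = \<Lambda> f + \<Lambda> g"
    and scale: "\<And>f c. continuous_on UNIV f \<Longrightarrow> \<Lambda> (\<lambda>\<eta>. c * f \<eta>) = c * \<Lambda> f"
    and mono: "\<And>f g. continuous_on UNIV f \<Longrightarrow> continuous_on UNIV g \<Longrightarrow> (\<And>\<eta>. f \<eta> \<le> g \<eta>) \<Longrightarrow> \<Lambda> f \<le> \<Lambda> g"
    and one: "\<Lambda> (\<lambda>_. 1) = 1"
  shows "\<exists>\<nu>. prob_space \<nu> \<and> sets \<nu> = sets borel
    \<and> (\<forall>f. continuous_on UNIV f \<longrightarrow> (\<integral>\<eta>. f \<eta> \<partial>\<nu>) = \<Lambda> f)"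
proof -
  let ?M = "clopens :: 'a config set set"
  define F where "F C = ennreal (\<Lambda> (indicat_real C))" for C
  have zero: "\<Lambda> (\<lambda>_. 0) = 0" using scale[of "\<lambda>_. 0" 0] by simp
  have nonneg: "0 \<le> \<Lambda> (indicat_real C)" if "C \<in> ?M" for C
    using mono[of "\<lambda>_. 0" "indicat_real C"] continuous_indicator_clopen[OF that] by (simp add: zero)
  interpret algebra UNIV ?M
    unfolding algebra_iff_Un by (auto simp: clopens_def closed_def Compl_eq_Diff_UNIV[symmetric])
  have "indicat_real {} = (\<lambda>_ :: 'a config. 0)" by auto
  then have F_empty: "F {} = 0" by (simp add: F_def zero)
  have "\<exists>\<mu> :: 'a config set \<Rightarrow> ennreal. (\<forall>s \<in> ?M. \<mu> s = F s) \<and> measure_space UNIV (sigma_sets UNIV ?M) \<mu>"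
  proof (rule caratheodory_empty_continuous)
    show "positive ?M F" by (simp add: positive_def F_empty)
    show "additive ?M F"
      unfolding additive_def
    proof (intro ballI impI)
      fix C D assume CD: "C \<in> ?M" "D \<in> ?M" "C \<inter> D = {}"
      then have "indicat_real (C \<union> D) = (\<lambda>\<eta>. indicat_real C \<eta> + indicat_real D \<eta>)"
        by (auto simp: fun_eq_iff indicator_def)
      then show "F (C \<union> D) = F C + F D"
        using add[of "indicat_real C" "indicat_real D"] CD nonneg
        by (simp add: F_def continuous_indicator_clopen ennreal_plus)
    qed
    show "F C \<noteq> \<infinity>" for C by (simp add: F_def)
    show "(\<lambda>i. F (C i)) \<longlonglongrightarrow> 0" if C: "range C \<subseteq> ?M" "decseq C" "(\<Inter>i. C i) = {}" for C
    proof -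
      have "closed (C n)" for n using C(1) by (auto simp: clopens_def)
      then obtain N where "C N = {}" using compact_decseq_empty[OF _ C(2,3)] by blast
      then have "C n = {}" if "n \<ge> N" for n using decseqD[OF C(2) that] by simp
      then have "\<forall>\<^sub>F n in sequentially. 0 = F (C n)"
        by (intro eventually_sequentiallyI[of N]) (simp add: F_empty)
      then show ?thesis by (rule Lim_transform_eventually[OF tendsto_const])
    qed
  qed
  then obtain \<mu> where \<mu>: "\<And>C. C \<in> ?M \<Longrightarrow> \<mu> C = F C" "measure_space UNIV (sigma_sets UNIV ?M) \<mu>"
    by blast
  define \<nu> where "\<nu> = measure_of UNIV (sigma_sets UNIV ?M) \<mu>"
  have sa: "sigma_algebra UNIV (sigma_sets UNIV ?M)" using \<mu>(2) by (simp add: measure_space_def)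
  have sets: "sets \<nu> = sets borel"
    unfolding \<nu>_def using sigma_algebra.sets_measure_of_eq[OF sa] by (simp add: sigma_sets_clopens)
  have space: "space \<nu> = UNIV" using sets_eq_imp_space_eq[OF sets] by simp
  have em: "emeasure \<nu> C = F C" if "C \<in> ?M" for C
    unfolding \<nu>_def using \<mu>(2) that
    by (subst emeasure_measure_of_sigma) (auto simp: measure_space_def \<mu>(1))
  have top: "UNIV \<in> ?M" by (simp add: clopens_def)
  interpret \<nu>: prob_space \<nu>
    by (rule prob_spaceI) (simp add: space em[OF top] F_def one)
  have int: "integrable \<nu> f" if "continuous_on UNIV f" for f :: "'a config \<Rightarrow> real"
    by (rule integrable_continuous[OF \<nu>.finite_measure_axioms sets that])
  have "continuous_on UNIV f \<and> (\<integral>\<eta>. f \<eta> \<partial>\<nu>) = \<Lambda> f" if "continuous_on UNIV f" for f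
    using that
  proof (induction rule: continuous_induct_occ)
    case (1 A)
    have C: "cylinder A (\<lambda>_. True) \<in> ?M" by (rule cylinder_clopen[OF 1])
    have eq: "occ A = indicat_real (cylinder A (\<lambda>_. True))"
      by (auto simp: occ_def cylinder_def fun_eq_iff indicator_def)
    have "C' \<in> sets \<nu>" if "C' \<in> ?M" for C' using that sets by (auto simp: clopens_def)
    then have "(\<integral>\<eta>. occ A \<eta> \<partial>\<nu>) = measure \<nu> (cylinder A (\<lambda>_. True))"
      unfolding eq using C by (simp add: space)
    also have "\<dots> = \<Lambda> (occ A)" using em[OF C] nonneg[OF C] by (simp add: measure_def F_def eq)
    finally show ?case using continuous_occ[OF 1] by simp
  next
    case (2 f g)
    then show ?case by (simp add: int add continuous_on_add)
  next
    case (3 f c)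
    then show ?case by (simp add: scale continuous_on_mult_left)
  next
    case (4 f)
    have "\<bar>(\<integral>\<eta>. f \<eta> \<partial>\<nu>) - \<Lambda> f\<bar> \<le> 0 + e" if "e > 0" for e
    proof -
      have "e / 2 > 0" using that by simp
      from 4(2)[OF this] obtain g where g: "continuous_on UNIV g" "(\<integral>\<eta>. g \<eta> \<partial>\<nu>) = \<Lambda> g"
        "\<And>\<eta>. \<bar>f \<eta> - g \<eta>\<bar> \<le> e / 2" by blast
      have le: "f \<eta> \<le> g \<eta> + e / 2 * 1" "g \<eta> \<le> f \<eta> + e / 2 * 1" for \<eta> using g(3)[of \<eta>] by linarith+
      have c: "continuous_on UNIV (\<lambda>\<eta> :: 'a config. e / 2 * 1)" by simp
      have "\<Lambda> f \<le> \<Lambda> (\<lambda>\<eta>. g \<eta> + e / 2 * 1)" "\<Lambda> g \<le> \<Lambda> (\<lambda>\<eta>. f \<eta> + e / 2 * 1)"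
        by (rule mono[OF 4(1) continuous_on_add[OF g(1) c] le(1)] mono[OF g(1) continuous_on_add[OF 4(1) c] le(2)])+
      moreover have "\<Lambda> (\<lambda>\<eta>. h \<eta> + e / 2 * 1) = \<Lambda> h + e / 2" if "continuous_on UNIV h" for h
        unfolding add[OF that c] using scale[of "\<lambda>_. 1" "e / 2"] one by simp
      ultimately have "\<Lambda> f \<le> \<Lambda> g + e / 2" "\<Lambda> g \<le> \<Lambda> f + e / 2" using g(1) 4(1) by simp_all
      then have 1: "\<bar>\<Lambda> f - \<Lambda> g\<bar> \<le> e / 2" by linarith
      have "(\<integral>\<eta>. f \<eta> \<partial>\<nu>) \<le> (\<integral>\<eta>. g \<eta> + e / 2 * 1 \<partial>\<nu>)" "(\<integral>\<eta>. g \<eta> \<partial>\<nu>) \<le> (\<integral>\<eta>. f \<eta> + e / 2 * 1 \<partial>\<nu>)"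
        by (rule integral_mono[OF int[OF 4(1)] int[OF continuous_on_add[OF g(1) c]] le(1)]
            integral_mono[OF int[OF g(1)] int[OF continuous_on_add[OF 4(1) c]] le(2)])+
      then have "(\<integral>\<eta>. f \<eta> \<partial>\<nu>) \<le> (\<integral>\<eta>. g \<eta> \<partial>\<nu>) + e / 2" "(\<integral>\<eta>. g \<eta> \<partial>\<nu>) \<le> (\<integral>\<eta>. f \<eta> \<partial>\<nu>) + e / 2"
        using int[OF g(1)] int[OF 4(1)] by (simp_all add: \<nu>.prob_space)
      then have "\<bar>(\<integral>\<eta>. f \<eta> \<partial>\<nu>) - (\<integral>\<eta>. g \<eta> \<partial>\<nu>)\<bar> \<le> e / 2" by linarith
      then show ?thesis using 1 g(2) by linarith
    qed
    then have "\<bar>(\<integral>\<eta>. f \<eta> \<partial>\<nu>) - \<Lambda> f\<bar> \<le> 0" by (rule field_le_epsilon)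
    then show ?case using 4(1) by simp
  qed
  then show ?thesis using \<nu>.prob_space_axioms sets by blast
qed

section \<open>Ergodicity and loss of memory\<close>

context feller begin

definition forgets :: "('a config \<Rightarrow> real) \<Rightarrow> bool" where
  "forgets f \<longleftrightarrow> (\<forall>\<epsilon>>0. \<forall>\<^sub>F t in at_top. \<forall>\<eta> \<zeta>. \<bar>S t f \<eta> - S t f \<zeta>\<bar> \<le> \<epsilon>)"

text \<open>
  Once the oscillation of \<open>S N f\<close> is at most \<open>\<epsilon>\<close>, all later values \<open>S t f \<eta> = S (t - N) (S N f) \<eta>\<close> are
  averages of values of \<open>S N f\<close> and stay within \<open>\<epsilon>\<close> of each of them.
\<close>

lemma forgets_limit:
  assumes f: "continuous_on UNIV f" "forgets f"
  shows "\<exists>L. \<forall>\<epsilon>>0. \<forall>\<^sub>F t in at_top. \<forall>\<eta>. \<bar>S t f \<eta> - L\<bar> \<le> \<epsilon>"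
proof -
  have settle: "\<exists>N::nat. \<forall>t\<ge>real N. \<forall>\<eta> \<zeta>. \<bar>S t f \<eta> - S N f \<zeta>\<bar> \<le> \<epsilon>" if "\<epsilon> > 0" for \<epsilon>
  proof -
    obtain T where T: "\<And>t \<eta> \<zeta>. t \<ge> T \<Longrightarrow> \<bar>S t f \<eta> - S t f \<zeta>\<bar> \<le> \<epsilon>"
      using f(2) \<open>\<epsilon> > 0\<close> unfolding forgets_def eventually_at_top_linorder by metis
    obtain N :: nat where N: "T \<le> N" using real_arch_simple by blast
    have "\<bar>S t f \<eta> - S N f \<zeta>\<bar> \<le> \<epsilon>" if "t \<ge> real N" for t \<eta> \<zeta>
    proof -
      have c: "continuous_on UNIV (S N f)" by (rule S_continuous[OF _ f(1)]) simp
      have "S t f \<eta> = S (t - N) (S N f) \<eta>"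
        using S_add[of "t - N" N f \<eta>] that f(1) by simp
      moreover have "S (t - N) (\<lambda>\<xi>. S N f \<xi> - S N f \<zeta>) \<eta> = S (t - N) (S N f) \<eta> - S N f \<zeta>"
        using that c by (simp add: S_diff S_const)
      moreover have "\<bar>S (t - N) (\<lambda>\<xi>. S N f \<xi> - S N f \<zeta>) \<eta>\<bar> \<le> \<epsilon>"
        using that c T[OF N] by (intro S_bound continuous_on_diff continuous_on_const) auto
      ultimately show ?thesis by simp
    qed
    then show ?thesis by blast
  qed
  define x where "x n = S (real n) f (\<lambda>_. True)" for n :: nat
  have "Cauchy x"
    unfolding Cauchy_altdef2
  proof (intro allI impI)
    fix e :: real assume "e > 0"
    then obtain N :: nat where N: "\<And>t \<eta> \<zeta>. t \<ge> real N \<Longrightarrow> \<bar>S t f \<eta> - S N f \<zeta>\<bar> \<le> e / 2"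
      using settle[of "e / 2"] by auto
    have "dist (x n) (x N) < e" if "n \<ge> N" for n
    proof -
      have "real N \<le> real n" using that by simp
      from N[OF this] have "dist (x n) (x N) \<le> e / 2" by (simp add: x_def dist_real_def)
      then show ?thesis using \<open>e > 0\<close> by linarith
    qed
    then show "\<exists>N. \<forall>n\<ge>N. dist (x n) (x N) < e" by blast
  qed
  then obtain L where L: "x \<longlonglongrightarrow> L" using Cauchy_convergent convergent_def by blast
  show ?thesis
  proof (intro exI allI impI)
    fix \<epsilon> :: real assume "\<epsilon> > 0"
    then obtain N :: nat where N: "\<And>t \<eta> \<zeta>. t \<ge> real N \<Longrightarrow> \<bar>S t f \<eta> - S N f \<zeta>\<bar> \<le> \<epsilon> / 2"
      using settle[of "\<epsilon> / 2"] by auto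
    have "\<bar>L - x N\<bar> \<le> \<epsilon> / 2"
    proof (rule tendsto_upperbound)
      show "(\<lambda>n. \<bar>x n - x N\<bar>) \<longlonglongrightarrow> \<bar>L - x N\<bar>" by (intro tendsto_intros L)
      show "\<forall>\<^sub>F n in sequentially. \<bar>x n - x N\<bar> \<le> \<epsilon> / 2"
        unfolding x_def by (intro eventually_sequentiallyI[of N] N) simp
    qed simp
    moreover have "\<bar>S t f \<eta> - x N\<bar> \<le> \<epsilon> / 2" if "t \<ge> real N" for t \<eta>
      unfolding x_def by (rule N[OF that])
    ultimately have "\<bar>S t f \<eta> - L\<bar> \<le> \<epsilon>" if "t \<ge> real N" for t \<eta>
      using that by (smt (verit) field_sum_of_halves)
    then show "\<forall>\<^sub>F t in at_top. \<forall>\<eta>. \<bar>S t f \<eta> - L\<bar> \<le> \<epsilon>"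
      unfolding eventually_at_top_linorder by blast
  qed
qed

lemma integral_law_at:
  assumes \<mu>: "\<mu> \<in> space (prob_algebra borel)" and t: "0 \<le> t" and f: "continuous_on UNIV f"
  shows "(\<integral>\<eta>. f \<eta> \<partial>law_at K \<mu> t) = (\<integral>\<eta>. S t f \<eta> \<partial>\<mu>)"
  unfolding law_at_def using \<mu> by (intro integral_bind_kernel[OF t f]) (auto simp: space_prob_algebra)

lemma law_at_prob:
  assumes "\<mu> \<in> space (prob_algebra borel)" "0 \<le> t"
  shows "prob_space (law_at K \<mu> t)" "sets (law_at K \<mu> t) = sets borel"
  unfolding law_at_def
  by (rule prob_space_bind'[OF assms(1) kernel[OF assms(2)]] sets_bind'[OF assms(1) kernel[OF assms(2)]])+

lemma law_at_return: "0 \<le> t \<Longrightarrow> law_at K (return borel \<eta>) t = K t \<eta>"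
  unfolding law_at_def by (rule bind_return[OF measurable_prob_algebraD[OF kernel]]) auto

text \<open>
  The limits \<open>\<Lambda> f\<close> of \<open>S t f\<close> form a positive linear functional, which is represented by a measure \<open>\<nu>\<close>.
  Invariance of \<open>\<nu>\<close> is \<open>\<Lambda> (S t f) = \<Lambda> f\<close>, and uniformity of the limit in the initial configuration
  permits integration over any initial law, which gives uniqueness and weak convergence.
\<close>

lemma ergodic_if_forgets:
  assumes forgets: "\<And>f. continuous_on UNIV f \<Longrightarrow> forgets f"
  shows "ergodic K"
proof -
  define \<Lambda> where "\<Lambda> f = (SOME L. \<forall>\<epsilon>>0. \<forall>\<^sub>F t in at_top. \<forall>\<eta>. \<bar>S t f \<eta> - L\<bar> \<le> \<epsilon>)" for f
  have \<Lambda>: "\<forall>\<^sub>F t in at_top. \<forall>\<eta>. \<bar>S t f \<eta> - \<Lambda> f\<bar> \<le> \<epsilon>"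
    if f: "continuous_on UNIV f" and "\<epsilon> > 0" for f \<epsilon>
    using someI_ex[OF forgets_limit[OF f forgets[OF f]]] \<open>\<epsilon> > 0\<close> unfolding \<Lambda>_def by blast
  have lim: "((\<lambda>t. \<integral>\<eta>. S t f \<eta> \<partial>\<mu>) \<longlongrightarrow> \<Lambda> f) at_top"
    if f: "continuous_on UNIV f" and \<mu>: "\<mu> \<in> space (prob_algebra borel)" for f \<mu>
  proof (rule tendstoI)
    fix e :: real assume "e > 0"
    then have "\<forall>\<^sub>F t in at_top. \<forall>\<eta>. \<bar>S t f \<eta> - \<Lambda> f\<bar> \<le> e / 2" by (intro \<Lambda> f) simp
    moreover have "\<forall>\<^sub>F t in at_top. t \<ge> (0::real)" by (rule eventually_ge_at_top)
    ultimately show "\<forall>\<^sub>F t in at_top. dist (\<integral>\<eta>. S t f \<eta> \<partial>\<mu>) (\<Lambda> f) < e"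
    proof eventually_elim
      case (elim t)
      interpret \<mu>: prob_space \<mu> using \<mu> by (simp add: space_prob_algebra)
      have int: "integrable \<mu> (S t f)"
        using \<mu> elim f by (intro integrable_continuous S_continuous) (auto simp: space_prob_algebra \<mu>.finite_measure)
      have b: "S t f \<eta> \<le> \<Lambda> f + e / 2" "\<Lambda> f - e / 2 \<le> S t f \<eta>" for \<eta>
        using elim(1)[rule_format, of \<eta>] by linarith+
      have "(\<integral>\<eta>. S t f \<eta> \<partial>\<mu>) \<le> \<Lambda> f + e / 2"
        by (rule \<mu>.integral_le_const[OF int]) (simp add: b)
      moreover have "\<Lambda> f - e / 2 \<le> (\<integral>\<eta>. S t f \<eta> \<partial>\<mu>)"
        by (rule \<mu>.integral_ge_const[OF int]) (simp add: b)
      ultimately show ?case using \<open>e > 0\<close> by (simp add: dist_real_def abs_le_iff abs_less_iff)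
    qed
  qed
  have ret: "return borel \<eta> \<in> space (prob_algebra borel)" for \<eta> :: "'a config"
    by (simp add: space_prob_algebra prob_space_return)
  have pos: "\<forall>\<^sub>F t in at_top. 0 \<le> (t::real)" by (rule eventually_ge_at_top)
  have ptlim: "((\<lambda>t. S t f \<eta>) \<longlongrightarrow> \<Lambda> f) at_top" if f: "continuous_on UNIV f" for f \<eta>
  proof (rule Lim_transform_eventually[OF lim[OF f ret]])
    show "\<forall>\<^sub>F t in at_top. (\<integral>\<xi>. S t f \<xi> \<partial>return borel \<eta>) = S t f \<eta>"
      using pos by eventually_elim
        (simp add: integral_return borel_measurable_continuous_onI[OF S_continuous[OF _ f]])
  qed
  define \<eta>\<^sub>0 :: "'a config" where "\<eta>\<^sub>0 = (\<lambda>_. True)"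
  have "\<exists>\<nu>. prob_space \<nu> \<and> sets \<nu> = sets borel
    \<and> (\<forall>f. continuous_on UNIV f \<longrightarrow> (\<integral>\<eta>. f \<eta> \<partial>\<nu>) = \<Lambda> f)"
  proof (rule riesz_configs[of \<Lambda>])
    fix f g :: "'a config \<Rightarrow> real" and c :: real
    assume f: "continuous_on UNIV f"
    show "\<Lambda> (\<lambda>\<eta>. c * f \<eta>) = c * \<Lambda> f"
    proof (rule tendsto_unique[OF trivial_limit_at_top_linorder ptlim])
      show "continuous_on UNIV (\<lambda>\<eta>. c * f \<eta>)" using f by (intro continuous_intros)
      show "((\<lambda>t. S t (\<lambda>\<eta>. c * f \<eta>) \<eta>\<^sub>0) \<longlongrightarrow> c * \<Lambda> f) at_top"
        unfolding S_cmult by (intro tendsto_intros ptlim f)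
    qed
    assume g: "continuous_on UNIV g"
    show "\<Lambda> (\<lambda>\<eta>. f \<eta> + g \<eta>) = \<Lambda> f + \<Lambda> g"
    proof (rule tendsto_unique[OF trivial_limit_at_top_linorder ptlim])
      show "continuous_on UNIV (\<lambda>\<eta>. f \<eta> + g \<eta>)" using f g by (intro continuous_intros)
      show "((\<lambda>t. S t (\<lambda>\<eta>. f \<eta> + g \<eta>) \<eta>\<^sub>0) \<longlongrightarrow> \<Lambda> f + \<Lambda> g) at_top"
      proof (rule Lim_transform_eventually[OF tendsto_add[OF ptlim[OF f] ptlim[OF g]]])
        show "\<forall>\<^sub>F t in at_top. S t f \<eta>\<^sub>0 + S t g \<eta>\<^sub>0 = S t (\<lambda>\<eta>. f \<eta> + g \<eta>) \<eta>\<^sub>0"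
          using pos by eventually_elim (simp add: S_def integrable_kernel f g)
      qed
    qed
    assume le: "\<And>\<eta>. f \<eta> \<le> g \<eta>"
    show "\<Lambda> f \<le> \<Lambda> g"
    proof (rule tendsto_le[OF trivial_limit_at_top_linorder ptlim[OF g] ptlim[OF f]])
      show "\<forall>\<^sub>F t in at_top. S t f \<eta>\<^sub>0 \<le> S t g \<eta>\<^sub>0"
        using pos by eventually_elim (intro S_mono f g le)
    qed
  next
    show "\<Lambda> (\<lambda>_. 1) = 1"
    proof (rule tendsto_unique[OF trivial_limit_at_top_linorder ptlim])
      show "((\<lambda>t. S t (\<lambda>_. 1) \<eta>\<^sub>0) \<longlongrightarrow> 1) at_top"
        by (rule Lim_transform_eventually[OF tendsto_const])
          (use pos in \<open>eventually_elim, simp add: S_const\<close>)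
    qed simp
  qed
  then obtain \<nu> where \<nu>: "prob_space \<nu>" "sets \<nu> = sets borel"
    "\<And>f. continuous_on UNIV f \<Longrightarrow> (\<integral>\<eta>. f \<eta> \<partial>\<nu>) = \<Lambda> f" by blast
  have \<nu>_space: "\<nu> \<in> space (prob_algebra borel)" using \<nu> by (simp add: space_prob_algebra)
  have inv: "invariant_measure K \<nu>"
    unfolding invariant_measure_def
  proof (intro conjI \<nu>_space allI impI)
    fix t :: real assume t: "0 \<le> t"
    show "law_at K \<nu> t = \<nu>"
    proof (rule prob_eqI_continuous[OF law_at_prob[OF \<nu>_space t] \<nu>(1,2)])
      fix f :: "'a config \<Rightarrow> real" assume f: "continuous_on UNIV f"
      have c: "continuous_on UNIV (S t f)" by (rule S_continuous[OF t f])
      have "((\<lambda>s. S (s + t) f \<eta>\<^sub>0) \<longlongrightarrow> \<Lambda> f) at_top"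
        by (rule filterlim_compose[OF ptlim[OF f]])
          (rule filterlim_tendsto_add_at_top[OF tendsto_const filterlim_ident, of t, simplified add.commute])
      then have "((\<lambda>s. S s (S t f) \<eta>\<^sub>0) \<longlongrightarrow> \<Lambda> f) at_top"
        by (rule Lim_transform_eventually) (use pos in \<open>eventually_elim, simp add: S_add t f\<close>)
      then have "\<Lambda> (S t f) = \<Lambda> f"
        by (rule tendsto_unique[OF trivial_limit_at_top_linorder ptlim[OF c]])
      then show "(\<integral>\<eta>. f \<eta> \<partial>law_at K \<nu> t) = (\<integral>\<eta>. f \<eta> \<partial>\<nu>)"
        by (simp add: integral_law_at[OF \<nu>_space t f] \<nu>(3) c f)
    qed
  qed
  moreover have "\<nu>' = \<nu>" if \<nu>': "invariant_measure K \<nu>'" for \<nu>'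
  proof -
    have sp: "\<nu>' \<in> space (prob_algebra borel)" using \<nu>' by (simp add: invariant_measure_def)
    then have p: "prob_space \<nu>'" "sets \<nu>' = sets borel" by (auto simp: space_prob_algebra)
    show ?thesis
    proof (rule prob_eqI_continuous[OF p \<nu>(1,2)])
      fix f :: "'a config \<Rightarrow> real" assume f: "continuous_on UNIV f"
      have "((\<lambda>t :: real. \<integral>\<eta>. f \<eta> \<partial>\<nu>') \<longlongrightarrow> \<Lambda> f) at_top"
      proof (rule Lim_transform_eventually[OF lim[OF f sp]])
        show "\<forall>\<^sub>F t in at_top. (\<integral>\<eta>. S t f \<eta> \<partial>\<nu>') = (\<integral>\<eta>. f \<eta> \<partial>\<nu>')"
          using pos
        proof eventually_elim
          case (elim t)
          then have "law_at K \<nu>' t = \<nu>'" using \<nu>' by (simp add: invariant_measure_def)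
          then show ?case using integral_law_at[OF sp elim f] by simp
        qed
      qed
      then show "(\<integral>\<eta>. f \<eta> \<partial>\<nu>') = (\<integral>\<eta>. f \<eta> \<partial>\<nu>)"
        unfolding \<nu>(3)[OF f] by (rule tendsto_unique[OF trivial_limit_at_top_linorder tendsto_const])
    qed
  qed
  moreover have "converges_weakly (law_at K \<mu>) \<nu>" if \<mu>: "\<mu> \<in> space (prob_algebra borel)" for \<mu>
    unfolding converges_weakly_def
  proof
    fix F :: "'a config \<Rightarrow>\<^sub>C real"
    have f: "continuous_on UNIV (apply_bcontfun F)"
      using apply_bcontfun[of F] by (simp add: bcontfun_def)
    show "((\<lambda>t. \<integral>\<eta>. apply_bcontfun F \<eta> \<partial>law_at K \<mu> t) \<longlongrightarrow> (\<integral>\<eta>. apply_bcontfun F \<eta> \<partial>\<nu>)) at_top"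
      unfolding \<nu>(3)[OF f]
      by (rule Lim_transform_eventually[OF lim[OF f \<mu>]])
        (use pos in \<open>eventually_elim, simp add: integral_law_at[OF \<mu> _ f]\<close>)
  qed
  ultimately show ?thesis unfolding ergodic_def by blast
qed

lemma ergodic_forgets_start:
  assumes "ergodic K" and f: "continuous_on UNIV f"
  shows "((\<lambda>t. S t f \<eta> - S t f \<zeta>) \<longlongrightarrow> 0) at_top"
proof -
  obtain \<nu> where \<nu>: "\<And>\<mu>. \<mu> \<in> space (prob_algebra borel) \<Longrightarrow> converges_weakly (law_at K \<mu>) \<nu>"
    using assms(1) unfolding ergodic_def by blast
  have "((\<lambda>t. S t f \<xi>) \<longlongrightarrow> (\<integral>\<eta>. f \<eta> \<partial>\<nu>)) at_top" for \<xi>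
  proof -
    have "return borel \<xi> \<in> space (prob_algebra borel)"
      by (simp add: space_prob_algebra prob_space_return)
    from \<nu>[OF this] have "((\<lambda>t. \<integral>\<eta>. f \<eta> \<partial>law_at K (return borel \<xi>) t) \<longlongrightarrow> (\<integral>\<eta>. f \<eta> \<partial>\<nu>)) at_top"
      unfolding converges_weakly_def by (metis continuous_apply_Bcontfun[OF f])
    then show ?thesis
      by (rule Lim_transform_eventually)
        (use eventually_ge_at_top[of "0::real"] in \<open>eventually_elim, simp add: law_at_return S_def\<close>)
  qed
  from tendsto_diff[OF this[of \<eta>] this[of \<zeta>]] show ?thesis by simp
qed

end

context nve begin

text \<open>
  If the gaps vanish, then \<open>moment_diff_le_gap\<close> shows that products of coordinates are forgotten, and the
  property passes to linear combinations and uniform limits.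
\<close>

lemma ergodic_iff_gap_vanishes: "ergodic K \<longleftrightarrow> (\<forall>x. ((\<lambda>t. gap t x) \<longlongrightarrow> 0) at_top)"
proof
  assume "ergodic K"
  then show "\<forall>x. ((\<lambda>t. gap t x) \<longlongrightarrow> 0) at_top"
    unfolding gap_def moment_def by (intro allI ergodic_forgets_start continuous_occ) auto
next
  assume gap: "\<forall>x. ((\<lambda>t. gap t x) \<longlongrightarrow> 0) at_top"
  have pos: "\<forall>\<^sub>F t in at_top. 0 \<le> (t::real)" by (rule eventually_ge_at_top)
  have "continuous_on UNIV f \<and> forgets f" if "continuous_on UNIV f" for f
    using that
  proof (induction rule: continuous_induct_occ)
    case (1 A)
    have "((\<lambda>t. \<Sum>x\<in>A. gap t x) \<longlongrightarrow> (\<Sum>x\<in>A. 0)) at_top" by (intro tendsto_sum) (simp add: gap)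
    then have "((\<lambda>t. \<Sum>x\<in>A. gap t x) \<longlongrightarrow> 0) at_top" by simp
    then have small: "\<forall>\<^sub>F t in at_top. (\<Sum>x\<in>A. gap t x) < \<epsilon>" if "\<epsilon> > 0" for \<epsilon>
      using that by (rule order_tendstoD(2))
    have "\<forall>\<^sub>F t in at_top. \<forall>\<eta> \<zeta>. \<bar>S t (occ A) \<eta> - S t (occ A) \<zeta>\<bar> \<le> \<epsilon>" if "\<epsilon> > 0" for \<epsilon>
      using small[OF that] pos
    proof eventually_elim
      case (elim t)
      show ?case
      proof (intro allI)
        fix \<eta> \<zeta>
        show "\<bar>S t (occ A) \<eta> - S t (occ A) \<zeta>\<bar> \<le> \<epsilon>"
          using moment_diff_le_gap[OF elim(2) 1, of \<eta> \<zeta>] elim(1) by (simp add: moment_def)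
      qed
    qed
    then show ?case using continuous_occ[OF 1] by (simp add: forgets_def)
  next
    case (2 f g)
    have "\<forall>\<^sub>F t in at_top. \<forall>\<eta> \<zeta>. \<bar>S t (\<lambda>\<eta>. f \<eta> + g \<eta>) \<eta> - S t (\<lambda>\<eta>. f \<eta> + g \<eta>) \<zeta>\<bar> \<le> \<epsilon>" if "\<epsilon> > 0" for \<epsilon>
    proof -
      have "\<epsilon> / 2 > 0" using that by simp
      then have "\<forall>\<^sub>F t in at_top. \<forall>\<eta> \<zeta>. \<bar>S t f \<eta> - S t f \<zeta>\<bar> \<le> \<epsilon> / 2"
        "\<forall>\<^sub>F t in at_top. \<forall>\<eta> \<zeta>. \<bar>S t g \<eta> - S t g \<zeta>\<bar> \<le> \<epsilon> / 2"
        using 2 unfolding forgets_def by blast+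
      with pos show ?thesis
      proof eventually_elim
        case (elim t)
        have "S t (\<lambda>\<eta>. f \<eta> + g \<eta>) \<eta> = S t f \<eta> + S t g \<eta>" for \<eta>
          unfolding S_def using 2 elim(1) by (intro Bochner_Integration.integral_add integrable_kernel) auto
        then show ?case using elim(2,3) by (smt (verit) field_sum_of_halves)
      qed
    qed
    then show ?case using 2 by (simp add: forgets_def continuous_on_add)
  next
    case (3 f c)
    have "\<forall>\<^sub>F t in at_top. \<forall>\<eta> \<zeta>. \<bar>S t (\<lambda>\<eta>. c * f \<eta>) \<eta> - S t (\<lambda>\<eta>. c * f \<eta>) \<zeta>\<bar> \<le> \<epsilon>" if "\<epsilon> > 0" for \<epsilon>
    proof -
      have pc: "0 < \<bar>c\<bar> + 1" by simp
      then have "\<epsilon> / (\<bar>c\<bar> + 1) > 0" using that by simp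
      then have "\<forall>\<^sub>F t in at_top. \<forall>\<eta> \<zeta>. \<bar>S t f \<eta> - S t f \<zeta>\<bar> \<le> \<epsilon> / (\<bar>c\<bar> + 1)"
        using 3 unfolding forgets_def by blast
      then show ?thesis
      proof eventually_elim
        case (elim t)
        have "\<bar>c * S t f \<eta> - c * S t f \<zeta>\<bar> \<le> \<epsilon>" for \<eta> \<zeta>
        proof -
          have "\<bar>c * S t f \<eta> - c * S t f \<zeta>\<bar> = \<bar>c\<bar> * \<bar>S t f \<eta> - S t f \<zeta>\<bar>"
            unfolding right_diff_distrib[symmetric] abs_mult ..
          also have "\<dots> \<le> (\<bar>c\<bar> + 1) * (\<epsilon> / (\<bar>c\<bar> + 1))"
            using elim by (intro mult_mono) auto
          also have "\<dots> = \<epsilon>" using pc by simp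
          finally show ?thesis .
        qed
        then show ?case by (simp add: S_cmult)
      qed
    qed
    then show ?case using 3 by (simp add: forgets_def continuous_on_mult_left)
  next
    case (4 f)
    have "\<forall>\<^sub>F t in at_top. \<forall>\<eta> \<zeta>. \<bar>S t f \<eta> - S t f \<zeta>\<bar> \<le> \<epsilon>" if "\<epsilon> > 0" for \<epsilon>
    proof -
      have e: "\<epsilon> / 3 > 0" using that by simp
      obtain g where g: "continuous_on UNIV g" "forgets g" "\<And>\<eta>. \<bar>f \<eta> - g \<eta>\<bar> \<le> \<epsilon> / 3"
        using 4(2)[OF e] by blast
      have "\<forall>\<^sub>F t in at_top. \<forall>\<eta> \<zeta>. \<bar>S t g \<eta> - S t g \<zeta>\<bar> \<le> \<epsilon> / 3"
        using g(2) e unfolding forgets_def by blast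
      with pos show ?thesis
      proof eventually_elim
        case (elim t)
        have close: "\<bar>S t f \<eta> - S t g \<eta>\<bar> \<le> \<epsilon> / 3" for \<eta>
          unfolding S_diff[OF elim(1) 4(1) g(1), symmetric]
          by (rule S_bound[OF elim(1) continuous_on_diff[OF 4(1) g(1)] g(3)])
        show ?case
        proof (intro allI)
          fix \<eta> \<zeta>
          show "\<bar>S t f \<eta> - S t f \<zeta>\<bar> \<le> \<epsilon>"
            using close[of \<eta>] close[of \<zeta>] elim(2)[rule_format, of \<eta> \<zeta>] by linarith
        qed
      qed
    qed
    then show ?case using 4(1) by (simp add: forgets_def)
  qed
  then show "ergodic K" by (intro ergodic_if_forgets) auto
qed

end

theorem theorem1p1:
  fixes qe qv :: "'a::countable \<Rightarrow> 'a \<Rightarrow> real"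
    and \<beta> \<delta> :: "'a \<Rightarrow> real"
    and K :: "real \<Rightarrow> ('a \<Rightarrow> bool) \<Rightarrow> ('a \<Rightarrow> bool) measure"
    and P :: "'a \<Rightarrow> 'w measure"
    and X :: "real \<Rightarrow> 'w \<Rightarrow> 'a"
  assumes "nve_rates qe qv \<beta> \<delta>"
    and "nve_process qe qv \<beta> \<delta> K"
    and "markov_chain (\<lambda>x y. qe x y + qv x y) P X"
  shows "ergodic K \<longleftrightarrow>
    (\<forall>x. measure (P x)
           {\<omega> \<in> space (P x).
              (\<integral>\<^sup>+t\<in>{0..}. ennreal (\<beta> (X t \<omega>) + \<delta> (X t \<omega>)) \<partial>lborel) = \<infinity>} = 1)"
proof -
  interpret nve qe qv \<beta> \<delta> K
    using assms(1,2) unfolding nve_process_def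
    by (intro nve.intro feller.intro nve_axioms.intro) auto
  interpret killed_chain "\<lambda>x y. qe x y + qv x y" P X rate_bound "\<lambda>x. \<beta> x + \<delta> x"
  proof (intro killed_chain.intro bounded_rate_chain.intro assms(3)
      bounded_rate_chain_axioms.intro killed_chain_axioms.intro)
    show "(\<Sum>\<^sub>\<infinity>y. qe x y + qv x y) \<le> rate_bound" for x
      using rate_bound[of x] \<beta>_nonneg[of x] \<delta>_nonneg[of x] by linarith
  qed (auto simp: qe_nonneg qv_nonneg \<beta>_nonneg \<delta>_nonneg q_summable noise_le_rate_bound)
  have gap: "gap T x = (\<integral>\<omega>. exp (- occupation T \<omega>) \<partial>P x)" if "0 < T" for T x
  proof (rule feynman_kac[where d=gap and C="8 * rate_bound\<^sup>2", OF gap_nonneg gap_le_1 gap_zero _ that])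
    show "\<bar>gap (t + h) x - gap t x - h * (Q (gap t) x - (\<beta> x + \<delta> x) * gap t x)\<bar>
        \<le> 8 * rate_bound\<^sup>2 * h\<^sup>2" if "0 \<le> t" "0 < h" for t h x
      unfolding Q_def by (rule gap_step[OF that])
  qed
  have "((\<lambda>T. gap T x) \<longlongrightarrow> 0) at_top
      \<longleftrightarrow> ((\<lambda>T. \<integral>\<omega>. exp (- occupation T \<omega>) \<partial>P x) \<longlongrightarrow> 0) at_top" for x
    by (rule tendsto_cong, rule eventually_mono[OF eventually_gt_at_top[of 0]]) (rule gap)
  then show ?thesis
    unfolding ergodic_iff_gap_vanishes killing_probability_one_iff total_noise_def by simp
qed

end
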